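(* Let $(N,g)$ be a smooth connected Riemannian manifold and equip $\operatorname{Diff}_0(N)$ with the right invariant $H^0$-metric $G^0$. For $X\in\mathfrak X_c(N)$ let $\beta(X)=g^{-1}\mathcal L_X(g)+\operatorname{div}^g(X)\operatorname{Id}_{TN}:TN\to TN$. Then for all $X,Y\in\mathfrak X_c(N)$ the curvature $R$ of $G^0$ at the identity satisfies $$4G^0(R(X,Y)X,Y)=\int_N\Bigl(-\|\beta(X)Y-\beta(Y)X+[X,Y]\|_g^2-4g\bigl([\beta(X),\beta(Y)]X,Y\bigr)\Bigr)\operatorname{vol}(g),$$ where $[X,Y]$ is the usual bracket of vector fields and $[\beta(X),\beta(Y)]=\beta(X)\beta(Y)-\beta(Y)\beta(X)$ is the commutator of endomorphisms of $TN$.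
   Context: $\operatorname{Diff}_0(N)$ is the identity component of the Lie group of compactly supported diffeomorphisms of $N$; its Lie algebra is the space $\mathfrak X_c(N)$ of compactly supported smooth vector fields with the negative of the usual bracket, so $\operatorname{ad}(X)Y=-[X,Y]$. The right invariant metric is given on the Lie algebra by $G^0(X,Y)=\int_Ng(X,Y)\operatorname{vol}(g)$. $\mathcal L_X$ is the Lie derivative, and $g^{-1}\mathcal L_X(g)$ is the $g$-symmetric endomorphism of $TN$ with $g((g^{-1}\mathcal L_Xg)Y,Z)=(\mathcal L_Xg)(Y,Z)$. The adjoint $\operatorname{ad}(X)^*$ is defined by $G^0(\operatorname{ad}(X)^*Y,Z)=G^0(Y,\operatorname{ad}(X)Z)$. The curvature of the right invariant metric (in the sign convention in which the sectional curvature of the plane spanned by $X,Y$ is $-G^0(R(X,Y)X,Y)/(\|X\|^2\|Y\|^2-G^0(X,Y)^2)$) is given by Arnold's formula $$\begin{aligned}4G(R(X,Y)X,Y)={}&3G(\operatorname{ad}(X)Y,\operatorname{ad}(X)Y)-2G(\operatorname{ad}(Y)^*X,\operatorname{ad}(X)Y)-2G(\operatorname{ad}(X)^*Y,\operatorname{ad}(Y)X)\\&+4G(\operatorname{ad}(X)^*X,\operatorname{ad}(Y)^*Y)-G(\operatorname{ad}(X)^*Y+\operatorname{ad}(Y)^*X,\operatorname{ad}(X)^*Y+\operatorname{ad}(Y)^*X).\end{aligned}$$ *)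

theory Defs
  imports "HOL-Analysis.Analysis" "HOL-Library.Function_Algebras"
begin

section \<open>Smooth functions on open subsets of normed spaces\<close>

primrec differentiable_times_on ::
  "nat \<Rightarrow> 'a::real_normed_vector set \<Rightarrow> ('a \<Rightarrow> 'b::real_normed_vector) \<Rightarrow> bool" where
  "differentiable_times_on 0 S f \<longleftrightarrow> continuous_on S f"
| "differentiable_times_on (Suc k) S f \<longleftrightarrow>
     (\<forall>x\<in>S. f differentiable (at x)) \<and>
     (\<forall>v. differentiable_times_on k S (\<lambda>x. frechet_derivative f (at x) v))"

definition smooth_on :: "'a::real_normed_vector set \<Rightarrow> ('a \<Rightarrow> 'b::real_normed_vector) \<Rightarrow> bool" where
  "smooth_on S f \<longleftrightarrow> (\<forall>k. differentiable_times_on k S f)"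

section \<open>Smooth manifolds\<close>

text \<open>The manifold is the whole (Hausdorff, second countable) type \<open>'m\<close>, of dimension \<open>CARD('n)\<close>.
  Its smooth structure is given by an atlas, which need not be maximal.\<close>

type_synonym ('m, 'n) chart = "'m set \<times> ('m \<Rightarrow> real ^ 'n)"
type_synonym ('m, 'n) atlas = "('m, 'n) chart set"

abbreviation chart_dom :: "('m, 'n) chart \<Rightarrow> 'm set" where
  "chart_dom c \<equiv> fst c"

abbreviation chart_map :: "('m, 'n) chart \<Rightarrow> 'm \<Rightarrow> real ^ 'n" where
  "chart_map c \<equiv> snd c"

definition chart_inv :: "('m, 'n) chart \<Rightarrow> real ^ 'n \<Rightarrow> 'm" where
  "chart_inv c = inv_into (chart_dom c) (chart_map c)"

definition is_chart :: "('m::topological_space, 'n::finite) chart \<Rightarrow> bool" where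
  "is_chart c \<longleftrightarrow> open (chart_dom c) \<and> open (chart_map c ` chart_dom c) \<and>
     homeomorphism (chart_dom c) (chart_map c ` chart_dom c) (chart_map c) (chart_inv c)"

definition smooth_atlas :: "('m::topological_space, 'n::finite) atlas \<Rightarrow> bool" where
  "smooth_atlas A \<longleftrightarrow>
     (\<forall>c\<in>A. is_chart c) \<and> (\<Union>c\<in>A. chart_dom c) = UNIV \<and>
     (\<forall>c\<in>A. \<forall>d\<in>A. smooth_on (chart_map c ` (chart_dom c \<inter> chart_dom d))
        (chart_map d \<circ> chart_inv c))"

section \<open>Tangent vectors and vector fields\<close>

text \<open>A tangent vector at \<open>p\<close> is an equivalence class of pairs of a chart around \<open>p\<close> and a vector in
  \<open>real ^ 'n\<close>.  Each class has exactly one member whose chart is the preferred chart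
  \<open>chart_at A p\<close>, and that member represents it: the tangent space at \<open>p\<close> is \<open>real ^ 'n\<close>, read in
  \<open>chart_at A p\<close>.  The preferred chart may jump from point to point, so smoothness is always
  expressed through the components \<open>vf_in\<close>, \<open>metric_in\<close> in the charts of the atlas.\<close>

definition chart_at :: "('m, 'n) atlas \<Rightarrow> 'm \<Rightarrow> ('m, 'n) chart" where
  "chart_at A p = (SOME c. c \<in> A \<and> p \<in> chart_dom c)"

definition coord_at :: "('m, 'n) atlas \<Rightarrow> 'm \<Rightarrow> real ^ 'n" where
  "coord_at A p = chart_map (chart_at A p) p"

definition coord_change ::
  "('m, 'n::finite) chart \<Rightarrow> ('m, 'n) chart \<Rightarrow> 'm \<Rightarrow> real ^ 'n \<Rightarrow> real ^ 'n" where
  "coord_change c d p = frechet_derivative (chart_map d \<circ> chart_inv c) (at (chart_map c p))"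

definition to_chart ::
  "('m, 'n::finite) atlas \<Rightarrow> ('m, 'n) chart \<Rightarrow> 'm \<Rightarrow> real ^ 'n \<Rightarrow> real ^ 'n" where
  "to_chart A c p = coord_change (chart_at A p) c p"

definition from_chart ::
  "('m, 'n::finite) atlas \<Rightarrow> ('m, 'n) chart \<Rightarrow> 'm \<Rightarrow> real ^ 'n \<Rightarrow> real ^ 'n" where
  "from_chart A c p = coord_change c (chart_at A p) p"

type_synonym ('m, 'n) vfield = "'m \<Rightarrow> real ^ 'n"

definition vf_in ::
  "('m, 'n::finite) atlas \<Rightarrow> ('m, 'n) vfield \<Rightarrow> ('m, 'n) chart \<Rightarrow> real ^ 'n \<Rightarrow> real ^ 'n" where
  "vf_in A X c x = to_chart A c (chart_inv c x) (X (chart_inv c x))"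

text \<open>Smooth vector fields with compact support.\<close>

definition vfields_c :: "('m::topological_space, 'n::finite) atlas \<Rightarrow> ('m, 'n) vfield set" where
  "vfields_c A = {X. (\<forall>c\<in>A. smooth_on (chart_map c ` chart_dom c) (vf_in A X c)) \<and>
                     compact (closure {p. X p \<noteq> 0})}"

text \<open>The derivative of the components of \<open>X\<close> in the preferred chart at \<open>p\<close>, that is, the
  matrix of the partial derivatives at \<open>p\<close>.\<close>

definition vf_jacobian ::
  "('m, 'n::finite) atlas \<Rightarrow> ('m, 'n) vfield \<Rightarrow> 'm \<Rightarrow> real ^ 'n \<Rightarrow> real ^ 'n" where
  "vf_jacobian A X p = frechet_derivative (vf_in A X (chart_at A p)) (at (coord_at A p))"

text \<open>The usual bracket, with \<open>[X,Y](f) = X(Y(f)) - Y(X(f))\<close>.\<close>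

definition lie_bracket ::
  "('m, 'n::finite) atlas \<Rightarrow> ('m, 'n) vfield \<Rightarrow> ('m, 'n) vfield \<Rightarrow> ('m, 'n) vfield" where
  "lie_bracket A X Y = (\<lambda>p. vf_jacobian A Y p (X p) - vf_jacobian A X p (Y p))"

section \<open>Riemannian metrics\<close>

type_synonym ('m, 'n) metric = "'m \<Rightarrow> real ^ 'n \<Rightarrow> real ^ 'n \<Rightarrow> real"

definition metric_in ::
  "('m, 'n::finite) atlas \<Rightarrow> ('m, 'n) metric \<Rightarrow> ('m, 'n) chart
     \<Rightarrow> real ^ 'n \<Rightarrow> real ^ 'n \<Rightarrow> real ^ 'n \<Rightarrow> real" where
  "metric_in A g c x u v =
     g (chart_inv c x) (from_chart A c (chart_inv c x) u) (from_chart A c (chart_inv c x) v)"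

definition riemannian_metric ::
  "('m::topological_space, 'n::finite) atlas \<Rightarrow> ('m, 'n) metric \<Rightarrow> bool" where
  "riemannian_metric A g \<longleftrightarrow>
     (\<forall>p. bilinear (g p) \<and> (\<forall>u v. g p u v = g p v u) \<and> (\<forall>u. u \<noteq> 0 \<longrightarrow> 0 < g p u u)) \<and>
     (\<forall>c\<in>A. \<forall>u v. smooth_on (chart_map c ` chart_dom c) (\<lambda>x. metric_in A g c x u v))"

definition metric_norm :: "('m, 'n) metric \<Rightarrow> 'm \<Rightarrow> real ^ 'n \<Rightarrow> real" where
  "metric_norm g p u = sqrt (g p u u)"

text \<open>The density \<open>sqrt (det (g\<^sub>i\<^sub>j))\<close> of \<open>vol(g)\<close> with respect to Lebesgue measure in a chart.\<close>

definition vol_density ::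
  "('m, 'n::finite) atlas \<Rightarrow> ('m, 'n) metric \<Rightarrow> ('m, 'n) chart \<Rightarrow> real ^ 'n \<Rightarrow> real" where
  "vol_density A g c x =
     sqrt (det ((\<chi> i j. metric_in A g c x (axis i 1) (axis j 1)) :: real ^ 'n ^ 'n))"

definition is_vol ::
  "('m::topological_space, 'n::finite) atlas \<Rightarrow> ('m, 'n) metric \<Rightarrow> 'm measure \<Rightarrow> bool" where
  "is_vol A g \<mu> \<longleftrightarrow> sets \<mu> = sets borel \<and>
     (\<forall>c\<in>A. \<forall>B\<in>sets borel. B \<subseteq> chart_dom c \<longrightarrow>
        emeasure \<mu> B =
          (\<integral>\<^sup>+x. ennreal (vol_density A g c x) * indicator (chart_map c ` B) x \<partial>lborel))"

definition vol :: "('m::topological_space, 'n::finite) atlas \<Rightarrow> ('m, 'n) metric \<Rightarrow> 'm measure" where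
  "vol A g = (THE \<mu>. is_vol A g \<mu>)"

text \<open>\<open>L\<^sub>X g\<close> as a bilinear form on the tangent space at \<open>p\<close>; in coordinates
  \<open>(L\<^sub>X g)\<^sub>i\<^sub>j = X\<^sup>k \<partial>\<^sub>k g\<^sub>i\<^sub>j + g\<^sub>k\<^sub>j \<partial>\<^sub>i X\<^sup>k + g\<^sub>i\<^sub>k \<partial>\<^sub>j X\<^sup>k\<close>.\<close>

definition lie_metric ::
  "('m, 'n::finite) atlas \<Rightarrow> ('m, 'n) metric \<Rightarrow> ('m, 'n) vfield
     \<Rightarrow> 'm \<Rightarrow> real ^ 'n \<Rightarrow> real ^ 'n \<Rightarrow> real" where
  "lie_metric A g X p u v =
     frechet_derivative (\<lambda>x. metric_in A g (chart_at A p) x u v) (at (coord_at A p)) (X p)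
     + g p (vf_jacobian A X p u) v + g p u (vf_jacobian A X p v)"

text \<open>The endomorphism \<open>g\<^sup>-\<^sup>1 L\<^sub>X g\<close> of the tangent space at \<open>p\<close>.\<close>

definition lie_metric_endo ::
  "('m, 'n::finite) atlas \<Rightarrow> ('m, 'n) metric \<Rightarrow> ('m, 'n) vfield
     \<Rightarrow> 'm \<Rightarrow> real ^ 'n \<Rightarrow> real ^ 'n" where
  "lie_metric_endo A g X p u = (THE w. \<forall>v. g p w v = lie_metric A g X p u v)"

text \<open>The function with \<open>L\<^sub>X vol(g) = div X vol(g)\<close>; in coordinates it is
  \<open>\<rho>\<^sup>-\<^sup>1 \<partial>\<^sub>i (\<rho> X\<^sup>i)\<close>, where \<open>\<rho>\<close> is the density of \<open>vol(g)\<close>.\<close>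

definition divergence ::
  "('m, 'n::finite) atlas \<Rightarrow> ('m, 'n) metric \<Rightarrow> ('m, 'n) vfield \<Rightarrow> 'm \<Rightarrow> real" where
  "divergence A g X p =
     trace (matrix (frechet_derivative
       (\<lambda>x. vol_density A g (chart_at A p) x *\<^sub>R vf_in A X (chart_at A p) x) (at (coord_at A p))))
     / vol_density A g (chart_at A p) (coord_at A p)"

definition beta ::
  "('m, 'n::finite) atlas \<Rightarrow> ('m, 'n) metric \<Rightarrow> ('m, 'n) vfield
     \<Rightarrow> 'm \<Rightarrow> real ^ 'n \<Rightarrow> real ^ 'n" where
  "beta A g X p u = lie_metric_endo A g X p u + divergence A g X p *\<^sub>R u"

definition endo_commutator ::
  "(real ^ 'n \<Rightarrow> real ^ 'n) \<Rightarrow> (real ^ 'n \<Rightarrow> real ^ 'n) \<Rightarrow> real ^ 'n \<Rightarrow> real ^ 'n" where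
  "endo_commutator S T u = S (T u) - T (S u)"

section \<open>Curvature of a right invariant metric on a Lie group\<close>

text \<open>Let \<open>L\<close> be the Lie algebra of a Lie group, \<open>ad\<close> its bracket and \<open>G\<close> the restriction of a right
  invariant metric to \<open>L\<close>.  An element \<open>X\<close> of \<open>L\<close> stands for the right invariant vector field \<open>R\<^sub>X\<close> on
  the group.  The functions \<open>G(R\<^sub>X, R\<^sub>Y)\<close> are constant and the bracket of the vector fields \<open>R\<^sub>X\<close>
  and \<open>R\<^sub>Y\<close> is \<open>R\<close> at \<open>- ad X Y\<close>.  So \<open>levi_civita\<close> says that \<open>D\<close>, the covariant derivative of
  right invariant vector fields, is torsion free and compatible with the metric.  By
  Koszul's formula this determines \<open>D\<close> on \<open>L\<close> and makes it bilinear there.\<close>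

definition levi_civita ::
  "'v::ab_group_add set \<Rightarrow> ('v \<Rightarrow> 'v \<Rightarrow> 'v) \<Rightarrow> ('v \<Rightarrow> 'v \<Rightarrow> real) \<Rightarrow> ('v \<Rightarrow> 'v \<Rightarrow> 'v) \<Rightarrow> bool" where
  "levi_civita L ad G D \<longleftrightarrow>
     (\<forall>X\<in>L. \<forall>Y\<in>L. D X Y \<in> L) \<and>
     (\<forall>X\<in>L. \<forall>Y\<in>L. D X Y - D Y X = - ad X Y) \<and>
     (\<forall>X\<in>L. \<forall>Y\<in>L. \<forall>Z\<in>L. G (D X Y) Z + G Y (D X Z) = 0)"

text \<open>\<open>R(X,Y)Z\<close> is the usual \<open>D\<^sub>X D\<^sub>Y Z - D\<^sub>Y D\<^sub>X Z - D Z\<close> along the bracket \<open>- ad X Y\<close>.\<close>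

definition curvature ::
  "('v::ab_group_add \<Rightarrow> 'v \<Rightarrow> 'v) \<Rightarrow> ('v \<Rightarrow> 'v \<Rightarrow> 'v) \<Rightarrow> 'v \<Rightarrow> 'v \<Rightarrow> 'v \<Rightarrow> 'v" where
  "curvature ad D X Y Z = D X (D Y Z) - D Y (D X Z) - D (- ad X Y) Z"

text \<open>Arnold's formula holds for this curvature as soon as \<open>ad\<close> has an adjoint \<open>adT\<close>.  This
  confirms the sign conventions.\<close>

lemma arnold_formula:
  fixes L :: "'v::ab_group_add set" and G :: "'v \<Rightarrow> 'v \<Rightarrow> real"
  assumes D: "levi_civita L ad G D"
    and L_diff: "\<And>X Y. X \<in> L \<Longrightarrow> Y \<in> L \<Longrightarrow> X - Y \<in> L"
    and G_sym: "\<And>X Y. X \<in> L \<Longrightarrow> Y \<in> L \<Longrightarrow> G X Y = G Y X"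
    and G_diff: "\<And>X Y Z. X \<in> L \<Longrightarrow> Y \<in> L \<Longrightarrow> Z \<in> L \<Longrightarrow> G (X - Y) Z = G X Z - G Y Z"
    and ad_L: "\<And>X Y. X \<in> L \<Longrightarrow> Y \<in> L \<Longrightarrow> ad X Y \<in> L"
    and ad_skew: "\<And>X Y. X \<in> L \<Longrightarrow> Y \<in> L \<Longrightarrow> ad Y X = - ad X Y"
    and adT_L: "\<And>X Y. X \<in> L \<Longrightarrow> Y \<in> L \<Longrightarrow> adT X Y \<in> L"
    and adT: "\<And>X Y Z. X \<in> L \<Longrightarrow> Y \<in> L \<Longrightarrow> Z \<in> L \<Longrightarrow> G (adT X Y) Z = G Y (ad X Z)"
    and X: "X \<in> L" and Y: "Y \<in> L"
  shows "4 * G (curvature ad D X Y X) Y =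
    3 * G (ad X Y) (ad X Y) - 2 * G (adT Y X) (ad X Y) - 2 * G (adT X Y) (ad Y X)
    + 4 * G (adT X X) (adT Y Y) - G (adT X Y + adT Y X) (adT X Y + adT Y X)"
proof -
  have L0: "0 \<in> L" using L_diff[OF X X] by simp
  have L_minus: "- U \<in> L" if "U \<in> L" for U using L_diff[OF L0 that] by simp
  have L_add: "U + V \<in> L" if "U \<in> L" "V \<in> L" for U V
    using L_diff[OF that(1) L_minus[OF that(2)]] by simp
  have G0: "G 0 Z = 0" if "Z \<in> L" for Z using G_diff[OF L0 L0 that] by simp
  have G_minus: "G (- U) Z = - G U Z" if "U \<in> L" "Z \<in> L" for U Z
    using G_diff[OF L0 that] G0[OF that(2)] by simp
  have G_add: "G (U + V) Z = G U Z + G V Z" if "U \<in> L" "V \<in> L" "Z \<in> L" for U V Z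
    using G_diff[OF that(1) L_minus[OF that(2)] that(3)] G_minus[OF that(2,3)] by simp
  have G_diff': "G Z (U - V) = G Z U - G Z V" if "U \<in> L" "V \<in> L" "Z \<in> L" for U V Z
    using G_diff[OF that] that by (simp add: G_sym L_diff)
  have G_add': "G Z (U + V) = G Z U + G Z V" if "U \<in> L" "V \<in> L" "Z \<in> L" for U V Z
    using G_add[OF that] that by (simp add: G_sym L_add)
  have G_minus': "G Z (- U) = - G Z U" if "U \<in> L" "Z \<in> L" for U Z
    using G_minus[OF that] that by (simp add: G_sym L_minus)
  have DL: "D U V \<in> L" if "U \<in> L" "V \<in> L" for U V
    using D that by (auto simp: levi_civita_def)
  have tor: "D U V = D V U - ad U V" if "U \<in> L" "V \<in> L" for U V
    using D that by (auto simp: levi_civita_def algebra_simps)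
  have met: "G (D U V) W = - G V (D U W)" if "U \<in> L" "V \<in> L" "W \<in> L" for U V W
  proof -
    have "G (D U V) W + G V (D U W) = 0" using D that by (auto simp: levi_civita_def)
    then show ?thesis by simp
  qed
  have koszul: "2 * G (D U V) W = G (adT U V + adT V U - ad U V) W"
    if U: "U \<in> L" and V: "V \<in> L" and W: "W \<in> L" for U V W
  proof -
    note m = U V W DL ad_L adT_L L_diff L_add
    have t: "G (D U V) W = G (D V U) W - G (ad U V) W" if "U \<in> L" "V \<in> L" "W \<in> L" for U V W
      using tor[OF that(1,2)] G_diff that DL ad_L by metis
    have "G (D U V) W = - G (D U W) V" using met[OF U V W] m by (simp add: G_sym)
    moreover have "G (D U W) V = G (D W U) V - G (ad U W) V" using t[OF U W V] .
    moreover have "G (D W U) V = - G (D W V) U" using met[OF W U V] m by (simp add: G_sym)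
    moreover have "G (D W V) U = G (D V W) U + G (ad V W) U" using t[OF V W U] by simp
    moreover have "G (D V W) U = - G (D V U) W" using met[OF V W U] m by (simp add: G_sym)
    moreover have "G (D U V) W = G (D V U) W - G (ad U V) W" using t[OF U V W] .
    moreover have "G (adT U V) W = G (ad U W) V" "G (adT V U) W = G (ad V W) U"
      using adT[OF U V W] adT[OF V U W] G_sym[OF V ad_L[OF U W]] G_sym[OF U ad_L[OF V W]] by simp_all
    ultimately show ?thesis using m by (simp add: G_diff G_add)
  qed
  define B where "B = ad X Y"
  define P where "P = adT X Y"
  define Q where "Q = adT Y X"
  have B: "B \<in> L" and P: "P \<in> L" and Q: "Q \<in> L"
    using X Y ad_L adT_L by (auto simp: B_def P_def Q_def)
  have adYX: "ad Y X = - B" using ad_skew[OF X Y] by (simp add: B_def)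
  note m = X Y B P Q DL L_diff L_add L_minus ad_L adT_L
  have "4 * G (D Y X) (D X Y) = 2 * G (P + Q + B) (D X Y)"
    using koszul[OF Y X DL[OF X Y]] by (simp add: P_def Q_def adYX add.commute)
  also have "\<dots> = 2 * G (D X Y) (P + Q + B)" using m by (simp add: G_sym)
  also have "\<dots> = G (P + Q - B) (P + Q + B)"
    using koszul[OF X Y, of "P + Q + B"] m by (simp add: P_def Q_def B_def)
  finally have 1: "4 * G (D Y X) (D X Y) = G (P + Q - B) (P + Q + B)" .
  have self: "G (ad U U) W = 0" if "U \<in> L" "W \<in> L" for U W
    using G_minus[of "ad U U" W] ad_skew[of U U] ad_L[of U U] that by simp
  have k': "G (D U U) W = G (adT U U) W" if "U \<in> L" "W \<in> L" for U W
    using koszul[of U U W] self[of U W] that m by (simp add: G_diff G_add)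
  have "G (D X X) (D Y Y) = G (adT X X) (D Y Y)" using k' m by simp
  also have "\<dots> = G (D Y Y) (adT X X)" using m by (simp add: G_sym)
  also have "\<dots> = G (adT X X) (adT Y Y)"
    using k'[OF Y adT_L[OF X X]] G_sym[OF adT_L[OF X X] adT_L[OF Y Y]] by simp
  finally have 2: "G (D X X) (D Y Y) = G (adT X X) (adT Y Y)" .
  have "2 * G (D (- B) X) Y = G (adT (- B) X + adT X (- B) - ad (- B) X) Y"
    using koszul m by simp
  also have "\<dots> = G X (ad (- B) Y) + G (- B) B - G (ad (- B) X) Y"
    using m by (simp add: G_diff G_add adT B_def)
  also have "ad (- B) Y = - ad Y (- B)" using ad_skew[of Y "- B"] m by simp
  also have "ad (- B) X = - ad X (- B)" using ad_skew[of X "- B"] m by simp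
  also have "G X (- ad Y (- B)) + G (- B) B - G (- ad X (- B)) Y
      = - G X (ad Y (- B)) - G B B + G Y (ad X (- B))"
    using m by (simp add: G_minus G_minus' G_sym)
  also have "\<dots> = G Q B - G B B - G P B"
    using m adT[OF Y X, of "- B"] adT[OF X Y, of "- B"] by (simp add: P_def Q_def G_minus')
  finally have 3: "2 * G (D (- B) X) Y = G Q B - G B B - G P B" .
  have "G (curvature ad D X Y X) Y
      = G (D X (D Y X)) Y - G (D Y (D X X)) Y - G (D (- B) X) Y"
    using m by (simp add: curvature_def G_diff flip: B_def)
  also have "\<dots> = - G (D Y X) (D X Y) + G (D X X) (D Y Y) - G (D (- B) X) Y"
    using m met by simp
  finally have "4 * G (curvature ad D X Y X) Y = - G (P + Q - B) (P + Q + B)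
      + 4 * G (adT X X) (adT Y Y) - 2 * (G Q B - G B B - G P B)"
    using 1 2 3 by simp
  then show ?thesis
    unfolding adYX B_def[symmetric] P_def[symmetric] Q_def[symmetric]
    using m by (simp add: G_diff G_add G_diff' G_add' G_minus' G_sym)
qed

section \<open>The right invariant \<open>H\<^sup>0\<close>-metric on the diffeomorphism group\<close>

text \<open>The Lie algebra of \<open>Diff\<^sub>0(N)\<close> is \<open>vfields_c A\<close>.  Its bracket is the negative of the usual one.\<close>

definition ad_diff ::
  "('m, 'n::finite) atlas \<Rightarrow> ('m, 'n) vfield \<Rightarrow> ('m, 'n) vfield \<Rightarrow> ('m, 'n) vfield" where
  "ad_diff A X Y = - lie_bracket A X Y"

definition H0_metric ::
  "('m::topological_space, 'n::finite) atlas \<Rightarrow> ('m, 'n) metric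
     \<Rightarrow> ('m, 'n) vfield \<Rightarrow> ('m, 'n) vfield \<Rightarrow> real" where
  "H0_metric A g X Y = (\<integral>p. g p (X p) (Y p) \<partial>vol A g)"

definition H0_curvature ::
  "('m::topological_space, 'n::finite) atlas \<Rightarrow> ('m, 'n) metric
     \<Rightarrow> ('m, 'n) vfield \<Rightarrow> ('m, 'n) vfield \<Rightarrow> ('m, 'n) vfield \<Rightarrow> ('m, 'n) vfield" where
  "H0_curvature A g =
     curvature (ad_diff A) (SOME D. levi_civita (vfields_c A) (ad_diff A) (H0_metric A g) D)"

end

theory Submission
  imports Defs
begin

text \<open>Integrating the divergence of \<open>g(Y,Z) X\<close> over the manifold shows that \<open>ad(X)\<close> has the adjoint
  \<open>Y \<mapsto> \<beta>(X)Y + [X,Y]\<close>.  So Koszul's formula defines a covariant derivative on the Lie algebra,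
  Arnold's formula applies, and its integrand agrees pointwise with that of the claim because
  \<open>\<beta>(X)\<close> is \<open>g\<close>-symmetric.

  The divergence theorem is reduced to one chart by \<open>C\<^sup>1\<close> bump functions; in a chart it follows from
  the translation invariance of Lebesgue measure.\<close>

section \<open>Calculus of \<open>k\<close> times differentiable functions\<close>

text \<open>The measure \<open>vol\<close>, the endomorphism \<open>lie_metric_endo\<close> and the
  covariant derivative inside \<open>H0_curvature\<close> are given by description, so each needs an
  existence proof before anything can be computed with it. For the covariant derivative this means
  that the adjoint of \<open>ad(X)\<close> must map the Lie algebra to itself, hence that
  \<beta>(X)Y is smooth, although \<beta>(X) is defined pointwise as the solution of a linear
  equation.

  The other obstacle is that a tangent vector is read in a preferred chart, which may jump with the
  point; a field can be differentiated only through its components in one fixed chart. Bracket, Lie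
  derivative of the metric and divergence therefore get versions in an arbitrary chart
  (\<open>bracket_in\<close>, \<open>lie_in\<close>, \<open>div_in\<close>) that must be shown to
  agree on overlaps. In each of them the second derivatives of the transition map have to cancel.
  The symmetry of second derivatives serves this in all three, and the derivative of the determinant
  serves it in the last.\<close>

lemma frechet_derivative_eqI:
  "(f has_derivative f') (at x) \<Longrightarrow> frechet_derivative f (at x) = f'"
  by (metis frechet_derivative_at)

lemma has_derivative_frechet:
  "f differentiable (at x) \<Longrightarrow> (f has_derivative frechet_derivative f (at x)) (at x)"
  by (simp add: frechet_derivative_works[symmetric])

lemma frechet_derivative_cong_open:
  assumes "open S" "x \<in> S" "\<And>y. y \<in> S \<Longrightarrow> f y = g y"
  shows "frechet_derivative f (at x) = frechet_derivative g (at x)"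
proof -
  have "(f has_derivative D) (at x) \<longleftrightarrow> (g has_derivative D) (at x)" for D
    using has_derivative_transform_within_open[OF _ assms(1,2), of f D UNIV g]
      has_derivative_transform_within_open[OF _ assms(1,2), of g D UNIV f] assms(3) by auto
  then show ?thesis unfolding frechet_derivative_def by simp
qed

lemma differentiable_cong_open:
  assumes "open S" "x \<in> S" "\<And>y. y \<in> S \<Longrightarrow> f y = g y"
  shows "f differentiable (at x) \<longleftrightarrow> g differentiable (at x)"
  using has_derivative_transform_within_open[OF _ assms(1,2), of f _ UNIV g]
      has_derivative_transform_within_open[OF _ assms(1,2), of g _ UNIV f] assms(3)
  unfolding differentiable_def by metis

lemma dto_cong:
  assumes "open S" "\<And>x. x \<in> S \<Longrightarrow> f x = g x"
  shows "differentiable_times_on k S f \<longleftrightarrow> differentiable_times_on k S g"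
  using assms(2)
proof (induction k arbitrary: f g)
  case 0
  then show ?case by (simp cong: continuous_on_cong)
next
  case (Suc k)
  have "differentiable_times_on k S (\<lambda>x. frechet_derivative f (at x) v) \<longleftrightarrow>
        differentiable_times_on k S (\<lambda>x. frechet_derivative g (at x) v)" for v
    using frechet_derivative_cong_open[OF assms(1) _ Suc.prems] by (intro Suc.IH) simp
  then show ?case
    using differentiable_cong_open[OF assms(1) _ Suc.prems] by simp
qed

text \<open>Only values and derivatives at single points enter, so the property can be checked near
  each point. Functions extended by zero out of a chart are treated this way below.\<close>

lemma dto_local:
  assumes "\<And>x. x \<in> S \<Longrightarrow> \<exists>T. open T \<and> x \<in> T \<and> differentiable_times_on k T f"
  shows "differentiable_times_on k S f"
  using assms
proof (induction k arbitrary: f)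
  case 0
  have "continuous (at x) f" if x: "x \<in> S" for x
    using 0[OF x] by (auto simp: continuous_on_eq_continuous_at)
  then show ?case by (simp add: continuous_at_imp_continuous_on)
next
  case (Suc k)
  have "f differentiable (at x)" if "x \<in> S" for x
    using Suc.prems[OF that] by auto
  moreover have "differentiable_times_on k S (\<lambda>x. frechet_derivative f (at x) v)" for v
    by (rule Suc.IH) (use Suc.prems in fastforce)
  ultimately show ?case by simp
qed

lemma dto_imp_continuous_on: "differentiable_times_on k S f \<Longrightarrow> continuous_on S f"
  by (cases k) (auto intro!: continuous_at_imp_continuous_on differentiable_imp_continuous_within)

lemma dto_SucD: "differentiable_times_on (Suc k) S f \<Longrightarrow> differentiable_times_on k S f"
proof (induction k arbitrary: f)
  case 0
  then show ?case using dto_imp_continuous_on[of "Suc 0"] by simp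
next
  case (Suc k)
  have "f differentiable (at x)" if "x \<in> S" for x
    using Suc.prems that by simp
  moreover have "differentiable_times_on k S (\<lambda>x. frechet_derivative f (at x) v)" for v
    by (rule Suc.IH) (use Suc.prems in simp)
  ultimately show ?case by simp
qed

lemma dto_mono:
  assumes "k \<le> l" "differentiable_times_on l S f" shows "differentiable_times_on k S f"
  using assms by (induction rule: inc_induct) (auto intro: dto_SucD simp del: differentiable_times_on.simps)

lemma dto_const [simp]: "differentiable_times_on k S (\<lambda>x. c)"
  by (induction k arbitrary: c) (auto simp: continuous_on_const)

text \<open>Lets a derivative found by the differentiation rules stand in for
  \<open>frechet_derivative\<close>. The two families agree on \<open>S\<close> only, and openness
  of \<open>S\<close> makes this enough for the higher derivatives.\<close>

lemma dto_SucI: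
  assumes S: "open S" and d: "\<And>x. x \<in> S \<Longrightarrow> (f has_derivative D x) (at x)"
    and D: "\<And>v. differentiable_times_on k S (\<lambda>x. D x v)"
  shows "differentiable_times_on (Suc k) S f"
proof -
  have "D x v = frechet_derivative f (at x) v" if "x \<in> S" for x v
    using d[OF that] by (simp add: frechet_derivative_eqI)
  then have "differentiable_times_on k S (\<lambda>x. frechet_derivative f (at x) v)" for v
    using dto_cong[OF S, of "\<lambda>x. D x v" "\<lambda>x. frechet_derivative f (at x) v" k] D by blast
  then show ?thesis using d by (auto simp: differentiable_def)
qed

lemma dto_SucE:
  assumes "differentiable_times_on (Suc k) S f"
  obtains "\<And>x. x \<in> S \<Longrightarrow> (f has_derivative frechet_derivative f (at x)) (at x)"
    "\<And>v. differentiable_times_on k S (\<lambda>x. frechet_derivative f (at x) v)"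
    "differentiable_times_on k S f"
  using dto_SucD[OF assms] assms by (auto intro: has_derivative_frechet)

lemma dto_bounded_linear:
  assumes f: "bounded_linear f" and S: "open S" and g: "differentiable_times_on k S g"
  shows "differentiable_times_on k S (\<lambda>x. f (g x))"
  using g
proof (induction k arbitrary: g)
  case 0
  then show ?case using bounded_linear.continuous_on[OF f] by simp
next
  case (Suc k)
  from Suc.prems show ?case
  proof (rule dto_SucE)
    assume "\<And>x. x \<in> S \<Longrightarrow> (g has_derivative frechet_derivative g (at x)) (at x)"
      and "\<And>v. differentiable_times_on k S (\<lambda>x. frechet_derivative g (at x) v)"
    then show ?thesis
      by (intro dto_SucI[OF S bounded_linear.has_derivative[OF f]] Suc.IH)
  qed
qed

lemma dto_add:
  assumes S: "open S" and "differentiable_times_on k S f" "differentiable_times_on k S g"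
  shows "differentiable_times_on k S (\<lambda>x. f x + g x)"
  using assms(2,3)
proof (induction k arbitrary: f g)
  case 0
  then show ?case by (auto intro: continuous_intros)
next
  case (Suc k)
  show ?case
    by (rule dto_SucE[OF Suc.prems(1)], rule dto_SucE[OF Suc.prems(2)])
       (intro dto_SucI[OF S has_derivative_add] Suc.IH)
qed

lemma dto_sum:
  assumes "open S" "\<And>i. i \<in> I \<Longrightarrow> differentiable_times_on k S (f i)"
  shows "differentiable_times_on k S (\<lambda>x. \<Sum>i\<in>I. f i x)"
  using assms(2) by (induction I rule: infinite_finite_induct) (auto intro: dto_add assms(1))

lemma dto_bounded_bilinear:
  assumes b: "bounded_bilinear b" and S: "open S"
    and "differentiable_times_on k S f" "differentiable_times_on k S g"
  shows "differentiable_times_on k S (\<lambda>x. b (f x) (g x))"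
  using assms(3,4)
proof (induction k arbitrary: f g)
  case 0
  then show ?case using bounded_bilinear.continuous_on[OF b] by simp
next
  case (Suc k)
  show ?case
    by (rule dto_SucE[OF Suc.prems(1)], rule dto_SucE[OF Suc.prems(2)])
       (intro dto_SucI[OF S bounded_bilinear.FDERIV[OF b]] dto_add[OF S] Suc.IH)
qed

lemmas dto_mult = dto_bounded_bilinear[OF bounded_bilinear_mult]
  and dto_scaleR = dto_bounded_bilinear[OF bounded_bilinear_scaleR]
  and dto_minus = dto_bounded_linear[OF bounded_linear_minus[OF bounded_linear_ident]]
  and dto_inner_left = dto_bounded_linear[OF bounded_linear_inner_left]
  and dto_vec_nth = dto_bounded_linear[OF bounded_linear_vec_nth]

lemma dto_diff:
  assumes "open S" "differentiable_times_on k S f" "differentiable_times_on k S g"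
  shows "differentiable_times_on k S (\<lambda>x. f x - g x)"
  using dto_add[OF assms(1,2) dto_minus[OF assms(1,3)]] by simp

lemma dto_prod:
  fixes f :: "'i \<Rightarrow> 'a::real_normed_vector \<Rightarrow> real"
  assumes "open S" "\<And>i. i \<in> I \<Longrightarrow> differentiable_times_on k S (f i)"
  shows "differentiable_times_on k S (\<lambda>x. \<Prod>i\<in>I. f i x)"
  using assms(2) by (induction I rule: infinite_finite_induct) (auto intro: dto_mult assms(1))

lemma dto_ident:
  assumes "open S" shows "differentiable_times_on k S (\<lambda>x. x)"
  by (cases k) (auto intro!: dto_SucI[OF assms has_derivative_ident] continuous_on_id
      simp del: differentiable_times_on.simps(2))

lemma linear_euclidean_sum:
  fixes L :: "'b::euclidean_space \<Rightarrow> 'c::real_vector"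
  assumes "linear L" shows "L v = (\<Sum>i\<in>Basis. (v \<bullet> i) *\<^sub>R L i)"
proof -
  have "L v = L (\<Sum>i\<in>Basis. (v \<bullet> i) *\<^sub>R i)" by (simp add: euclidean_representation)
  then show ?thesis using assms by (simp add: linear_sum linear_scale)
qed

text \<open>The chain rule applies the derivative of \<open>f\<close> to a direction that moves with
  \<open>x\<close>, whereas the induction hypothesis speaks of fixed directions. Expanding the
  moving direction in the basis leaves a finite sum of products to which it applies.\<close>

lemma dto_compose:
  fixes g :: "'a::real_normed_vector \<Rightarrow> 'b::euclidean_space" and f :: "'b \<Rightarrow> 'c::real_normed_vector"
  assumes S: "open S" and "differentiable_times_on k T f" "differentiable_times_on k S g"
    and T: "\<And>x. x \<in> S \<Longrightarrow> g x \<in> T"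
  shows "differentiable_times_on k S (\<lambda>x. f (g x))"
  using assms(2,3)
proof (induction k arbitrary: f)
  case 0
  then show ?case using continuous_on_compose2[of T f S g] T by auto
next
  case (Suc k)
  show ?case
  proof (rule dto_SucE[OF Suc.prems(1)], rule dto_SucE[OF Suc.prems(2)], rule dto_SucI[OF S])
    fix x assume x: "x \<in> S"
      and f: "\<And>x. x \<in> T \<Longrightarrow> (f has_derivative frechet_derivative f (at x)) (at x)"
      and g: "\<And>x. x \<in> S \<Longrightarrow> (g has_derivative frechet_derivative g (at x)) (at x)"
    have "((\<lambda>x. f (g x)) has_derivative
        (\<lambda>v. frechet_derivative f (at (g x)) (frechet_derivative g (at x) v))) (at x)"
      using diff_chain_at[OF g[OF x] f[OF T[OF x]]] by (simp add: o_def)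
    moreover have "linear (frechet_derivative f (at (g x)))"
      using f[OF T[OF x]] by (rule has_derivative_linear)
    ultimately show "((\<lambda>x. f (g x)) has_derivative (\<lambda>v. \<Sum>i\<in>Basis. (frechet_derivative g (at x) v \<bullet> i) *\<^sub>R
        frechet_derivative f (at (g x)) i)) (at x)"
      by (subst (asm) linear_euclidean_sum[of "frechet_derivative f (at (g x))"])
  next
    fix v
    assume f: "\<And>v. differentiable_times_on k T (\<lambda>x. frechet_derivative f (at x) v)"
      and g: "\<And>v. differentiable_times_on k S (\<lambda>x. frechet_derivative g (at x) v)"
      and g': "differentiable_times_on k S g"
    show "differentiable_times_on k S (\<lambda>x. \<Sum>i\<in>Basis. (frechet_derivative g (at x) v \<bullet> i) *\<^sub>R
        frechet_derivative f (at (g x)) i)"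
      by (intro dto_sum dto_scaleR dto_inner_left S g Suc.IH[OF f g'])
  qed
qed

lemma dto_frechet_apply:
  fixes f :: "'a::euclidean_space \<Rightarrow> 'b::real_normed_vector"
  assumes S: "open S" and f: "differentiable_times_on (Suc k) S f" and w: "differentiable_times_on k S w"
  shows "differentiable_times_on k S (\<lambda>x. frechet_derivative f (at x) (w x))"
proof -
  have "differentiable_times_on k S (\<lambda>x. \<Sum>i\<in>Basis. (w x \<bullet> i) *\<^sub>R frechet_derivative f (at x) i)"
    using f by (intro dto_sum dto_scaleR dto_inner_left S w) simp
  then show ?thesis
    using f by (subst dto_cong[OF S, of _ "\<lambda>x. \<Sum>i\<in>Basis. (w x \<bullet> i) *\<^sub>R frechet_derivative f (at x) i"])
      (auto intro: linear_euclidean_sum linear_frechet_derivative)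
qed

text \<open>Differentiation lowers the exponent by one, so the induction must run over all exponents
  at once. Square roots and reciprocals are the instances used.\<close>

lemma dto_powr:
  fixes f :: "'a::real_normed_vector \<Rightarrow> real"
  assumes S: "open S" and f: "differentiable_times_on k S f" and pos: "\<And>x. x \<in> S \<Longrightarrow> 0 < f x"
  shows "differentiable_times_on k S (\<lambda>x. f x powr a)"
  using f
proof (induction k arbitrary: a)
  case 0
  then show ?case using pos by (auto intro!: continuous_on_powr' continuous_on_const) fastforce+
next
  case (Suc k)
  show ?case
  proof (rule dto_SucE[OF Suc.prems], rule dto_SucI[OF S])
    fix x assume x: "x \<in> S"
      and d: "\<And>x. x \<in> S \<Longrightarrow> (f has_derivative frechet_derivative f (at x)) (at x)"
    show "((\<lambda>x. f x powr a) has_derivative (\<lambda>v. a * (f x powr (a - 1) * frechet_derivative f (at x) v))) (at x)"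
      using has_derivative_powr[OF d[OF x] has_derivative_const pos[OF x], of a] pos[OF x] x
      by (simp add: powr_diff field_simps)
  next
    fix v
    assume "\<And>v. differentiable_times_on k S (\<lambda>x. frechet_derivative f (at x) v)"
      and "differentiable_times_on k S f"
    then show "differentiable_times_on k S (\<lambda>x. a * (f x powr (a - 1) * frechet_derivative f (at x) v))"
      by (intro dto_mult S dto_const Suc.IH)
  qed
qed

lemma dto_sqrt:
  fixes f :: "'a::real_normed_vector \<Rightarrow> real"
  assumes "open S" "differentiable_times_on k S f" and pos: "\<And>x. x \<in> S \<Longrightarrow> 0 < f x"
  shows "differentiable_times_on k S (\<lambda>x. sqrt (f x))"
  using dto_powr[OF assms, of "1/2"]
    dto_cong[OF assms(1), of "\<lambda>x. f x powr (1/2)" "\<lambda>x. sqrt (f x)" k] pos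
  by (simp add: powr_half_sqrt less_imp_le)

lemma dto_divide:
  fixes f g :: "'a::real_normed_vector \<Rightarrow> real"
  assumes "open S" "differentiable_times_on k S f" "differentiable_times_on k S g" and pos: "\<And>x. x \<in> S \<Longrightarrow> 0 < g x"
  shows "differentiable_times_on k S (\<lambda>x. f x / g x)"
  using dto_mult[OF assms(1,2) dto_powr[OF assms(1,3,4), of "-1"]]
    dto_cong[OF assms(1), of "\<lambda>x. f x * g x powr (-1)" "\<lambda>x. f x / g x" k] pos
  by (simp add: powr_minus_divide less_imp_le)

lemma dto_vec:
  fixes f :: "'a::real_normed_vector \<Rightarrow> real ^ 'n"
  assumes S: "open S" and "\<And>i. differentiable_times_on k S (\<lambda>x. f x $ i)"
  shows "differentiable_times_on k S f"
proof -
  have eq: "(\<lambda>x. \<Sum>i\<in>UNIV. f x $ i *\<^sub>R axis i 1) = f"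
    by (rule ext, subst (2) basis_expansion[symmetric]) (simp add: scalar_mult_eq_scaleR)
  have "differentiable_times_on k S (\<lambda>x. \<Sum>i\<in>UNIV. f x $ i *\<^sub>R axis i (1::real))"
    by (intro dto_sum dto_scaleR S assms dto_const)
  then show ?thesis by (simp only: eq)
qed

lemma dto_det:
  fixes M :: "'a::real_normed_vector \<Rightarrow> real ^ 'n ^ 'n"
  assumes S: "open S" and "\<And>i j. differentiable_times_on k S (\<lambda>x. M x $ i $ j)"
  shows "differentiable_times_on k S (\<lambda>x. det (M x))"
  unfolding det_def by (intro dto_sum dto_mult dto_prod S assms dto_const)

text \<open>The product rule for \<open>Df(y)\<close> paired with a moving vector
  \<open>w y\<close>. It is used with \<open>f\<close> a transition map and \<open>w\<close> the
  components of a vector field.\<close>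

lemma has_derivative_deriv_apply:
  fixes f :: "'a::euclidean_space \<Rightarrow> 'b::real_normed_vector"
  assumes S: "open S" "x \<in> S" and f: "differentiable_times_on 2 S f"
    and w: "(w has_derivative w') (at x)"
  shows "((\<lambda>y. frechet_derivative f (at y) (w y)) has_derivative
    (\<lambda>h. frechet_derivative (\<lambda>y. frechet_derivative f (at y) (w x)) (at x) h + frechet_derivative f (at x) (w' h))) (at x)"
proof -
  let ?F = "\<lambda>v y. frechet_derivative f (at y) v"
  have lin: "linear (\<lambda>v. ?F v y)" if "y \<in> S" for y
    using f that by (auto simp: numeral_2_eq_2 intro: linear_frechet_derivative)
  have F: "(?F v has_derivative frechet_derivative (?F v) (at x)) (at x)" for v
    using f S(2) by (intro has_derivative_frechet) (simp add: numeral_2_eq_2)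
  have 1: "((\<lambda>y. \<Sum>b\<in>Basis. (w y \<bullet> b) *\<^sub>R ?F b y) has_derivative
     (\<lambda>h. \<Sum>b\<in>Basis. (w x \<bullet> b) *\<^sub>R frechet_derivative (?F b) (at x) h + (w' h \<bullet> b) *\<^sub>R ?F b x)) (at x)"
    if w: "(w has_derivative w') (at x)" for w w'
    by (intro has_derivative_sum has_derivative_scaleR has_derivative_inner_left w F)
  have 2: "((\<lambda>y. ?F (w y) y) has_derivative
     (\<lambda>h. \<Sum>b\<in>Basis. (w x \<bullet> b) *\<^sub>R frechet_derivative (?F b) (at x) h + (w' h \<bullet> b) *\<^sub>R ?F b x)) (at x)"
    if "(w has_derivative w') (at x)" for w w'
    by (rule has_derivative_transform_within_open[OF 1[OF that] S])
       (rule linear_euclidean_sum[OF lin, symmetric])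
  \<comment> \<open>The general formula for the constant vector field \<open>w x\<close> identifies
    the first half of the sum as a second derivative of \<open>f\<close>.\<close>
  have 3: "frechet_derivative (?F (w x)) (at x) = (\<lambda>h. \<Sum>b\<in>Basis. (w x \<bullet> b) *\<^sub>R frechet_derivative (?F b) (at x) h)"
    using frechet_derivative_eqI[OF 2[OF has_derivative_const[of "w x"]]] by simp
  have 4: "?F (w' h) x = (\<Sum>b\<in>Basis. (w' h \<bullet> b) *\<^sub>R ?F b x)" for h
    by (rule linear_euclidean_sum[OF lin[OF S(2)]])
  show ?thesis using 2[OF w] unfolding 3 by (subst 4) (simp add: sum.distrib)
qed

lemma has_derivative_along_line:
  assumes "(f has_derivative f') (at (x + r *\<^sub>R e))"
  shows "((\<lambda>r. f (x + r *\<^sub>R e)) has_derivative (\<lambda>h. f' (h *\<^sub>R e))) (at r within A)"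
proof -
  have "((\<lambda>r. x + r *\<^sub>R e) has_derivative (\<lambda>h. h *\<^sub>R e)) (at r)"
    by (auto intro!: derivative_eq_intros)
  from has_derivative_compose[OF this assms] show ?thesis by (rule has_derivative_at_withinI)
qed

section \<open>Symmetry of second derivatives\<close>

text \<open>The mean value theorem is used along \<open>u\<close> and then along \<open>v\<close>.
  The second difference is symmetric in \<open>u\<close> and \<open>v\<close>, so exchanging them
  will give the other mixed derivative. The slack \<open>d\<close> keeps the intermediate point in
  the open ball even when \<open>u\<close> and \<open>v\<close> are both zero.\<close>

lemma second_difference_mean_value:
  fixes f :: "'a::real_normed_vector \<Rightarrow> real"
  assumes f: "differentiable_times_on 2 S f" and S: "ball x e \<subseteq> S"
    and s: "0 < s" "s * (norm u + norm v) < e" and d: "0 < d"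
  obtains y where "y \<in> ball x (s * (norm u + norm v) + d)"
    "f (x + s *\<^sub>R u + s *\<^sub>R v) - f (x + s *\<^sub>R u) - f (x + s *\<^sub>R v) + f x
      = s * s * frechet_derivative (\<lambda>y. frechet_derivative f (at y) u) (at y) v"
proof -
  have mem: "x + a *\<^sub>R u + b *\<^sub>R v \<in> S" if "0 \<le> a" "a \<le> s" "0 \<le> b" "b \<le> s" for a b
  proof -
    have "norm (a *\<^sub>R u + b *\<^sub>R v) \<le> a * norm u + b * norm v"
      using norm_triangle_ineq[of "a *\<^sub>R u" "b *\<^sub>R v"] that by simp
    also have "\<dots> \<le> s * (norm u + norm v)"
      using that by (simp add: distrib_left add_mono mult_right_mono)
    finally have "norm (a *\<^sub>R u + b *\<^sub>R v) < e" using s by linarith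
    then have "dist x (x + a *\<^sub>R u + b *\<^sub>R v) < e"
      using norm_minus_cancel[of "a *\<^sub>R u + b *\<^sub>R v"] by (simp add: dist_norm)
    then show ?thesis using S by auto
  qed
  have f1: "(f has_derivative frechet_derivative f (at y)) (at y)" if "y \<in> S" for y
    using f that by (intro has_derivative_frechet) (simp add: numeral_2_eq_2)
  have f2: "((\<lambda>y. frechet_derivative f (at y) u) has_derivative
      frechet_derivative (\<lambda>y. frechet_derivative f (at y) u) (at y)) (at y)" if "y \<in> S" for y
    using f that by (intro has_derivative_frechet) (simp add: numeral_2_eq_2)
  \<comment> \<open>The zero multiple of \<open>v\<close> is kept so that both points have the form
    treated by \<open>mem\<close>.\<close>
  define \<phi> where "\<phi> r = f (x + r *\<^sub>R u + s *\<^sub>R v) - f (x + r *\<^sub>R u + 0 *\<^sub>R v)" for r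
  have "\<exists>\<sigma>\<in>{0<..<s}. \<phi> s - \<phi> 0 = (\<lambda>h. frechet_derivative f (at (x + \<sigma> *\<^sub>R u + s *\<^sub>R v)) (h *\<^sub>R u)
      - frechet_derivative f (at (x + \<sigma> *\<^sub>R u + 0 *\<^sub>R v)) (h *\<^sub>R u)) (s - 0)"
    unfolding \<phi>_def
    by (rule mvt_simple[OF s(1)])
       (rule derivative_eq_intros has_derivative_at_withinI[OF has_derivative_compose[OF _ f1]] |
         use s mem in \<open>force\<close>)+
  then obtain \<sigma> where \<sigma>: "0 < \<sigma>" "\<sigma> < s" and
    1: "\<phi> s - \<phi> 0 = frechet_derivative f (at (x + \<sigma> *\<^sub>R u + s *\<^sub>R v)) (s *\<^sub>R u)
      - frechet_derivative f (at (x + \<sigma> *\<^sub>R u + 0 *\<^sub>R v)) (s *\<^sub>R u)" by auto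
  have 2: "frechet_derivative f (at (x + \<sigma> *\<^sub>R u + b *\<^sub>R v)) (s *\<^sub>R u)
     = s * frechet_derivative f (at (x + \<sigma> *\<^sub>R u + b *\<^sub>R v)) u" if "0 \<le> b" "b \<le> s" for b
    using has_derivative_linear[OF f1[OF mem, of \<sigma> b]] \<sigma> that by (simp add: linear_scale)
  define \<psi> where "\<psi> r = frechet_derivative f (at (x + \<sigma> *\<^sub>R u + r *\<^sub>R v)) u" for r
  have "\<exists>\<tau>\<in>{0<..<s}. \<psi> s - \<psi> 0 = (\<lambda>h. frechet_derivative (\<lambda>y. frechet_derivative f (at y) u)
      (at (x + \<sigma> *\<^sub>R u + \<tau> *\<^sub>R v)) (h *\<^sub>R v)) (s - 0)"
    unfolding \<psi>_def
    by (rule mvt_simple[OF s(1)])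
       (rule derivative_eq_intros has_derivative_at_withinI[OF has_derivative_compose[OF _ f2]] |
         use s \<sigma> mem in \<open>force\<close>)+
  then obtain \<tau> where \<tau>: "0 < \<tau>" "\<tau> < s" and
    3: "\<psi> s - \<psi> 0 = frechet_derivative (\<lambda>y. frechet_derivative f (at y) u)
      (at (x + \<sigma> *\<^sub>R u + \<tau> *\<^sub>R v)) (s *\<^sub>R v)" by auto
  have 4: "\<psi> s - \<psi> 0 = s * frechet_derivative (\<lambda>y. frechet_derivative f (at y) u)
      (at (x + \<sigma> *\<^sub>R u + \<tau> *\<^sub>R v)) v"
    using has_derivative_linear[OF f2[OF mem, of \<sigma> \<tau>]] \<sigma> \<tau> 3 by (simp add: linear_scale)
  show ?thesis
  proof (rule that)
    have "norm (\<sigma> *\<^sub>R u + \<tau> *\<^sub>R v) \<le> \<sigma> * norm u + \<tau> * norm v"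
      using norm_triangle_ineq[of "\<sigma> *\<^sub>R u" "\<tau> *\<^sub>R v"] \<sigma> \<tau> by simp
    also have "\<dots> \<le> s * (norm u + norm v)"
      using \<sigma> \<tau> by (simp add: distrib_left add_mono mult_right_mono)
    finally have "norm (\<sigma> *\<^sub>R u + \<tau> *\<^sub>R v) < s * (norm u + norm v) + d" using d by linarith
    then show "x + \<sigma> *\<^sub>R u + \<tau> *\<^sub>R v \<in> ball x (s * (norm u + norm v) + d)"
      using norm_minus_cancel[of "\<sigma> *\<^sub>R u + \<tau> *\<^sub>R v"] by (simp add: dist_norm)
    have "\<phi> s - \<phi> 0 = s * (\<psi> s - \<psi> 0)"
      using 1 2[of s] 2[of 0] s unfolding \<psi>_def by (simp add: right_diff_distrib)
    then show "f (x + s *\<^sub>R u + s *\<^sub>R v) - f (x + s *\<^sub>R u) - f (x + s *\<^sub>R v) + f x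
      = s * s * frechet_derivative (\<lambda>y. frechet_derivative f (at y) u) (at (x + \<sigma> *\<^sub>R u + \<tau> *\<^sub>R v)) v"
      using 4 unfolding \<phi>_def by simp
  qed
qed

text \<open>Both mixed derivatives, taken at suitable points near \<open>x\<close>, equal the same
  second difference divided by \<open>s * s\<close>. If they differed at \<open>x\<close>,
  continuity would keep them apart near \<open>x\<close>.\<close>

lemma second_derivative_symmetric_real:
  fixes f :: "'a::real_normed_vector \<Rightarrow> real"
  assumes S: "open S" "x \<in> S" and f: "differentiable_times_on 2 S f"
  shows "frechet_derivative (\<lambda>y. frechet_derivative f (at y) u) (at x) v =
         frechet_derivative (\<lambda>y. frechet_derivative f (at y) v) (at x) u"
proof (rule ccontr)
  define g where "g u v y = frechet_derivative (\<lambda>y. frechet_derivative f (at y) u) (at y) v" for u v y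
  define \<epsilon> where "\<epsilon> = \<bar>g u v x - g v u x\<bar> / 2"
  assume "\<not> ?thesis"
  then have \<epsilon>: "0 < \<epsilon>" unfolding \<epsilon>_def g_def by simp
  have "continuous (at x) (g u v)" for u v
  proof -
    have "continuous_on S (g u v)" using f unfolding g_def by (simp add: numeral_2_eq_2)
    then show ?thesis using S by (simp add: continuous_on_eq_continuous_at)
  qed
  then have "\<exists>d>0. \<forall>y. dist y x < d \<longrightarrow> dist (g u v y) (g u v x) < \<epsilon>" for u v
    using \<epsilon> unfolding continuous_at_eps_delta by blast
  then obtain d1 d2 where d: "0 < d1" "0 < d2"
    and d1: "\<And>y. dist y x < d1 \<Longrightarrow> dist (g u v y) (g u v x) < \<epsilon>"
    and d2: "\<And>y. dist y x < d2 \<Longrightarrow> dist (g v u y) (g v u x) < \<epsilon>" by metis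
  obtain e where e: "0 < e" "ball x e \<subseteq> S" using S open_contains_ball by blast
  define r where "r = min e (min d1 d2)"
  \<comment> \<open>This makes \<open>s * (norm u + norm v)\<close> at most \<open>r / 2\<close> and
    leaves \<open>r / 2\<close> for the slack. The summand 1 keeps the denominator positive when
    \<open>u\<close> and \<open>v\<close> vanish.\<close>
  define s where "s = r / (2 * (norm u + norm v + 1))"
  have r: "0 < r" using d e by (simp add: r_def)
  have s: "0 < s" using r unfolding s_def by (intro divide_pos_pos) (auto intro: add_nonneg_pos)
  have "s * (norm u + norm v) \<le> s * (norm u + norm v + 1)" using s by simp
  also have "\<dots> = r / 2" using add_nonneg_pos[of "norm u + norm v" 1] unfolding s_def by (simp add: field_simps)
  finally have sr: "s * (norm u + norm v) \<le> r / 2" .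
  then have se: "s * (norm u + norm v) < e" using r by (simp add: r_def)
  have se': "s * (norm v + norm u) < e" using se by (simp add: add.commute)
  obtain y where y: "y \<in> ball x (s * (norm u + norm v) + r / 2)" and
    1: "f (x + s *\<^sub>R u + s *\<^sub>R v) - f (x + s *\<^sub>R u) - f (x + s *\<^sub>R v) + f x = s * s * g u v y"
    using second_difference_mean_value[OF f e(2) s se half_gt_zero[OF r]] unfolding g_def by blast
  obtain z where z: "z \<in> ball x (s * (norm v + norm u) + r / 2)" and
    2: "f (x + s *\<^sub>R v + s *\<^sub>R u) - f (x + s *\<^sub>R v) - f (x + s *\<^sub>R u) + f x = s * s * g v u z"
    using second_difference_mean_value[OF f e(2) s se' half_gt_zero[OF r]] unfolding g_def by blast
  have "s * s * g u v y = s * s * g v u z" using 1 2 by (simp add: algebra_simps)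
  then have "g u v y = g v u z" using s by simp
  moreover have "dist (g u v y) (g u v x) < \<epsilon>" "dist (g v u z) (g v u x) < \<epsilon>"
    using d1[of y] d2[of z] y z sr by (auto simp: r_def dist_commute add.commute)
  ultimately show False unfolding \<epsilon>_def dist_real_def by (smt (verit) field_sum_of_halves)
qed

lemma second_derivative_symmetric:
  fixes f :: "'a::real_normed_vector \<Rightarrow> 'b::euclidean_space"
  assumes S: "open S" "x \<in> S" and f: "differentiable_times_on 2 S f"
  shows "frechet_derivative (\<lambda>y. frechet_derivative f (at y) u) (at x) v =
         frechet_derivative (\<lambda>y. frechet_derivative f (at y) v) (at x) u"
proof (rule euclidean_eqI)
  fix b :: 'b assume "b \<in> Basis"
  have D: "frechet_derivative (\<lambda>y. f y \<bullet> b) (at y) = (\<lambda>w. frechet_derivative f (at y) w \<bullet> b)" if "y \<in> S" for y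
    using f that by (intro frechet_derivative_eqI has_derivative_inner_left has_derivative_frechet)
      (simp add: numeral_2_eq_2)
  have "frechet_derivative (\<lambda>y. frechet_derivative (\<lambda>y. f y \<bullet> b) (at y) w) (at x) w'
     = frechet_derivative (\<lambda>y. frechet_derivative f (at y) w) (at x) w' \<bullet> b" for w w'
  proof -
    have "((\<lambda>y. frechet_derivative f (at y) w \<bullet> b) has_derivative
       (\<lambda>w'. frechet_derivative (\<lambda>y. frechet_derivative f (at y) w) (at x) w' \<bullet> b)) (at x)"
      using f S(2) by (intro has_derivative_inner_left has_derivative_frechet) (simp add: numeral_2_eq_2)
    then show ?thesis
      using frechet_derivative_cong_open[OF S, of "\<lambda>y. frechet_derivative (\<lambda>y. f y \<bullet> b) (at y) w"
        "\<lambda>y. frechet_derivative f (at y) w \<bullet> b"] D by (simp add: frechet_derivative_eqI)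
  qed
  then show "frechet_derivative (\<lambda>y. frechet_derivative f (at y) u) (at x) v \<bullet> b =
         frechet_derivative (\<lambda>y. frechet_derivative f (at y) v) (at x) u \<bullet> b"
    using second_derivative_symmetric_real[OF S dto_inner_left[OF S(1) f], of b u v] by simp
qed

section \<open>Derivative of the determinant\<close>

text \<open>Each term of the differentiated Leibniz sum keeps all but one factor of its product. At
  the identity matrix such a product vanishes unless the permutation is the identity, and what is
  left is the trace.\<close>

lemma has_derivative_det_mat_1:
  fixes M :: "'a::real_normed_vector \<Rightarrow> real ^ 'n ^ 'n"
  assumes M: "(M has_derivative M') (at x)" and 1: "M x = mat 1"
  shows "((\<lambda>y. det (M y)) has_derivative (\<lambda>h. trace (M' h))) (at x)"
proof -
  have e: "((\<lambda>y. M y $ i $ j) has_derivative (\<lambda>h. M' h $ i $ j)) (at x)" for i j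
    by (intro bounded_linear.has_derivative[OF bounded_linear_vec_nth] M)
  let ?P = "{p. p permutes (UNIV :: 'n set)}"
  have "((\<lambda>y. det (M y)) has_derivative (\<lambda>h. \<Sum>p\<in>?P. of_int (sign p) *
      (\<Sum>i\<in>UNIV. M' h $ i $ p i * (\<Prod>j\<in>UNIV - {i}. M x $ j $ p j)))) (at x)"
    unfolding det_def by (intro has_derivative_sum has_derivative_mult_right has_derivative_prod e)
  moreover have "(\<Sum>p\<in>?P. of_int (sign p) * (\<Sum>i\<in>UNIV. M' h $ i $ p i * (\<Prod>j\<in>UNIV - {i}. M x $ j $ p j)))
     = trace (M' h)" for h
  proof -
    have "(\<Prod>j\<in>UNIV - {i}. M x $ j $ p j) = (if p = id then 1 else 0)" if p: "p permutes UNIV" for p and i :: 'n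
    proof (cases "p = id")
      case True then show ?thesis by (simp add: 1 mat_def)
    next
      case False
      \<comment> \<open>A permutation cannot move exactly one point: if all points but
        \<open>i\<close> were fixed, injectivity would fix \<open>i\<close> as well.\<close>
      have "\<exists>j\<in>UNIV - {i}. p j \<noteq> j"
      proof (rule ccontr)
        assume *: "\<not> ?thesis"
        then have "p i = i" using permutes_inj[OF p] by (metis DiffI UNIV_I injD singletonD)
        then show False using * False by (auto simp: fun_eq_iff)
      qed
      then obtain j where "j \<noteq> i" "p j \<noteq> j" by auto
      then have "(\<Prod>j\<in>UNIV - {i}. M x $ j $ p j) = 0"
        by (intro prod_zero) (auto simp: 1 mat_def intro!: bexI[of _ j])
      then show ?thesis using False by simp
    qed
    then have "(\<Sum>p\<in>?P. of_int (sign p) * (\<Sum>i\<in>UNIV. M' h $ i $ p i * (\<Prod>j\<in>UNIV - {i}. M x $ j $ p j)))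
       = (\<Sum>p\<in>?P. if p = id then trace (M' h) else 0)"
      by (intro sum.cong) (auto simp: trace_def)
    also have "\<dots> = trace (M' h)"
      by (simp add: finite_permutations permutes_id)
    finally show ?thesis .
  qed
  ultimately show ?thesis by simp
qed

text \<open>Jacobi's formula, obtained from the case of the identity matrix by multiplying with the
  constant inverse \<open>B\<close>.\<close>

lemma has_derivative_det:
  fixes M :: "'a::real_normed_vector \<Rightarrow> real ^ 'n ^ 'n"
  assumes M: "(M has_derivative M') (at x)" and B: "B ** M x = mat 1"
  shows "((\<lambda>y. det (M y)) has_derivative (\<lambda>h. det (M x) * trace (B ** M' h))) (at x)"
proof -
  have bl: "bounded_linear (\<lambda>A::real^'n^'n. B ** A)"
  proof -
    have "linear (\<lambda>A::real^'n^'n. B ** A)"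
      by (rule linearI) (simp_all add: matrix_add_ldistrib,
        simp add: matrix_matrix_mult_def vec_eq_iff sum_distrib_left mult.left_commute)
    then show ?thesis by (rule linear_conv_bounded_linear[THEN iffD1])
  qed
  have "((\<lambda>y. det (B ** M y)) has_derivative (\<lambda>h. trace (B ** M' h))) (at x)"
    by (intro has_derivative_det_mat_1 bounded_linear.has_derivative[OF bl] M B)
  then have "((\<lambda>y. det (M x) * det (B ** M y)) has_derivative (\<lambda>h. det (M x) * trace (B ** M' h))) (at x)"
    by (rule has_derivative_mult_right)
  moreover have "det (M x) * det (B ** M y) = det (M y)" for y
  proof -
    have "det B * det (M x) = 1" using arg_cong[OF B, of det] by (simp add: det_mul)
    then show ?thesis by (simp add: det_mul mult.assoc[symmetric] mult.commute)
  qed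
  ultimately show ?thesis by simp
qed

section \<open>Integrals of derivatives\<close>

text \<open>By translation invariance the difference quotients have integral \<open>0\<close>.\<close>

lemma lborel_integral_derivative_eq_0:
  fixes \<phi> :: "'a::euclidean_space \<Rightarrow> real"
  assumes \<phi>: "differentiable_times_on 1 UNIV \<phi>" and K: "compact K" "\<And>x. x \<notin> K \<Longrightarrow> \<phi> x = 0"
  shows "(\<integral>x. frechet_derivative \<phi> (at x) e \<partial>lborel) = 0"
proof -
  let ?D = "\<lambda>x. frechet_derivative \<phi> (at x) e"
  obtain R where R: "0 < R" "K \<subseteq> ball 0 R" using compact_imp_bounded[OF K(1)] bounded_subset_ballD by blast
  have der: "(\<phi> has_derivative frechet_derivative \<phi> (at x)) (at x)" for x
    using \<phi> by (intro has_derivative_frechet) simp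
  have cont: "continuous_on UNIV \<phi>" "continuous_on UNIV ?D"
    using dto_imp_continuous_on[OF \<phi>] \<phi> by auto
  have zero: "?D x = 0" if "x \<notin> K" for x
    using frechet_derivative_cong_open[of "- K" x \<phi> "\<lambda>_. 0"] that K compact_imp_closed[OF K(1)] by (auto simp: open_Compl)
  have "compact (?D ` K)" by (intro compact_continuous_image K continuous_on_subset[OF cont(2)]) auto
  then obtain B where B: "\<And>x. x \<in> K \<Longrightarrow> \<bar>?D x\<bar> \<le> B"
    using compact_imp_bounded[of "?D ` K"] by (auto simp: bounded_iff)
  \<comment> \<open>If \<open>K\<close> is empty, then \<open>B\<close> may be negative; its
    absolute value is a bound in every case.\<close>
  have B': "\<bar>?D x\<bar> \<le> \<bar>B\<bar>" for x using B[of x] zero[of x] by (cases "x \<in> K") auto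
  have int: "integrable lborel \<phi>"
  proof -
    have "integrable lborel (\<lambda>x. indicator K x *\<^sub>R \<phi> x)"
      by (intro borel_integrable_compact K continuous_on_subset[OF cont(1)]) auto
    moreover have "(\<lambda>x. indicator K x *\<^sub>R \<phi> x) = \<phi>"
      using K(2) by (auto simp: fun_eq_iff indicator_def)
    ultimately show ?thesis by simp
  qed
  have meas [measurable]: "\<phi> \<in> borel_measurable borel" "?D \<in> borel_measurable borel"
    using cont by (auto intro: borel_measurable_continuous_onI)
  define s where "s n x = (\<phi> (inverse (Suc n) *\<^sub>R e + x) - \<phi> x) * Suc n" for n x
  \<comment> \<open>The majorant for dominated convergence. All shifts have length at most
    \<open>norm e\<close>, so the difference quotients vanish outside the ball enlarged by that
    amount.\<close>
  let ?w = "\<lambda>x. indicator (cball 0 (R + norm e)) x *\<^sub>R \<bar>B\<bar>"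
  have "(\<lambda>n. LINT x|lborel. s n x) \<longlonglongrightarrow> (LINT x|lborel. ?D x)"
  proof (rule integral_dominated_convergence)
    show "integrable lborel ?w" by (intro borel_integrable_compact) auto
    show "AE x in lborel. (\<lambda>n. s n x) \<longlonglongrightarrow> ?D x"
    proof (intro AE_I2)
      fix x
      have "((\<lambda>h. \<phi> (x + h *\<^sub>R e)) has_derivative (\<lambda>h. frechet_derivative \<phi> (at x) (h *\<^sub>R e))) (at 0)"
        using has_derivative_along_line[of \<phi> _ x 0 e UNIV] der[of x] by simp
      moreover have "frechet_derivative \<phi> (at x) (h *\<^sub>R e) = ?D x * h" for h
        using has_derivative_linear[OF der[of x]] by (simp add: linear_scale)
      ultimately have "((\<lambda>h. \<phi> (x + h *\<^sub>R e)) has_field_derivative ?D x) (at 0)"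
        by (simp add: has_field_derivative_def)
      then have "(\<lambda>h. (\<phi> (x + h *\<^sub>R e) - \<phi> x) / h) \<midarrow>0\<rightarrow> ?D x"
        by (simp add: DERIV_def)
      moreover have "filterlim (\<lambda>n. inverse (real (Suc n))) (at 0) sequentially"
        using LIMSEQ_inverse_real_of_nat by (auto simp: filterlim_at)
      ultimately have "(\<lambda>n. (\<phi> (x + inverse (real (Suc n)) *\<^sub>R e) - \<phi> x) / inverse (real (Suc n))) \<longlonglongrightarrow> ?D x"
        by (rule filterlim_compose)
      then show "(\<lambda>n. s n x) \<longlonglongrightarrow> ?D x"
        unfolding s_def divide_inverse inverse_inverse_eq by (simp only: add.commute[of x])
    qed
    show "AE x in lborel. norm (s n x) \<le> ?w x" for n
    proof (intro AE_I2)
      fix x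
      let ?t = "inverse (real (Suc n))"
      \<comment> \<open>By the mean value theorem a difference quotient is a value of
        \<open>?D\<close>, so the bound on \<open>?D\<close> holds for all of them
        uniformly.\<close>
      have "\<exists>r\<in>{0<..<?t}. \<phi> (x + ?t *\<^sub>R e) - \<phi> (x + 0 *\<^sub>R e) = (\<lambda>h. frechet_derivative \<phi> (at (x + r *\<^sub>R e)) (h *\<^sub>R e)) (?t - 0)"
        by (rule mvt_simple) (auto intro: has_derivative_along_line der)
      then obtain r where "\<phi> (x + ?t *\<^sub>R e) - \<phi> x = frechet_derivative \<phi> (at (x + r *\<^sub>R e)) (?t *\<^sub>R e)" by auto
      also have "\<dots> = ?t * ?D (x + r *\<^sub>R e)"
        using has_derivative_linear[OF der] by (simp add: linear_scale)
      finally have "s n x = ?D (x + r *\<^sub>R e)" by (simp add: s_def add.commute)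
      then have 1: "\<bar>s n x\<bar> \<le> \<bar>B\<bar>" using B' by simp
      have 2: "s n x = 0" if "x \<notin> cball 0 (R + norm e)"
      proof -
        have nx: "R + norm e < norm x" using that by simp
        have "norm x \<le> norm (x + ?t *\<^sub>R e) + norm (?t *\<^sub>R e)"
          using norm_triangle_ineq4[of "x + ?t *\<^sub>R e" "?t *\<^sub>R e"] by simp
        moreover have "norm (?t *\<^sub>R e) \<le> norm e"
          by (simp add: mult_left_le_one_le inverse_le_1_iff)
        ultimately have "R < norm (x + ?t *\<^sub>R e)" using nx by linarith
        moreover have "R < norm x" using nx norm_ge_zero[of e] by linarith
        ultimately have "x \<notin> K" "x + ?t *\<^sub>R e \<notin> K" using R(2) by auto
        then show ?thesis using K(2) by (simp add: s_def add.commute)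
      qed
      show "norm (s n x) \<le> ?w x" using 1 2 by (auto simp: indicator_def)
    qed
  qed (auto simp: s_def)
  moreover have "(LINT x|lborel. s n x) = 0" for n
  proof -
    let ?c = "inverse (real (Suc n)) *\<^sub>R e"
    have "integrable (distr lborel borel ((+) ?c)) \<phi>" "(LINT x|distr lborel borel ((+) ?c). \<phi> x) = (LINT x|lborel. \<phi> x)"
      using int by (simp_all add: lborel_distr_plus)
    then have "integrable lborel (\<lambda>x. \<phi> (?c + x))" "(LINT x|lborel. \<phi> (?c + x)) = (LINT x|lborel. \<phi> x)"
      by (simp_all add: integrable_distr_eq integral_distr)
    then show ?thesis using int by (simp add: s_def)
  qed
  ultimately have "(\<lambda>n. 0) \<longlonglongrightarrow> (LINT x|lborel. ?D x)" by simp
  then show ?thesis using LIMSEQ_unique tendsto_const by blast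
qed

section \<open>Change of variables\<close>

text \<open>The change of variables theorem of the library needs a well-ordered index type.  It is carried
  over to an arbitrary finite index type \<open>'n\<close> along a bijection with a well-ordered copy of \<open>'n\<close>.\<close>

typedef (overloaded) 'n ord_index = "{..<CARD('n::finite)}"
  by (rule exI[of _ 0]) simp

instance ord_index :: (finite) finite
proof
  have "finite (range (Rep_ord_index :: 'a ord_index \<Rightarrow> nat))"
    by (simp add: type_definition.Rep_range[OF type_definition_ord_index])
  then show "finite (UNIV :: 'a ord_index set)"
    by (rule finite_imageD) (simp add: inj_on_def Rep_ord_index_inject)
qed

instantiation ord_index :: (finite) wellorder
begin

definition "x \<le> y \<longleftrightarrow> Rep_ord_index x \<le> Rep_ord_index y"
definition "x < y \<longleftrightarrow> Rep_ord_index x < Rep_ord_index y"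

instance
proof
  fix P and a :: "'a ord_index"
  assume *: "\<And>x::'a ord_index. (\<And>y. y < x \<Longrightarrow> P y) \<Longrightarrow> P x"
  show "P a"
    by (induction a rule: measure_induct[of Rep_ord_index]) (auto intro: * simp: less_ord_index_def)
qed (auto simp: less_eq_ord_index_def less_ord_index_def Rep_ord_index_inject)

end

lemma bij_ord_index: "\<exists>h :: 'n::finite ord_index \<Rightarrow> 'n. bij h"
proof -
  have "CARD('n ord_index) = CARD('n)"
    using type_definition.card[OF type_definition_ord_index] by simp
  then show ?thesis using finite_same_card_bij[of "UNIV :: 'n ord_index set" "UNIV :: 'n set"] by auto
qed

section \<open>Renaming the coordinates: determinants and Lebesgue measure\<close>

definition reindex :: "('k \<Rightarrow> 'n) \<Rightarrow> real ^ 'n \<Rightarrow> real ^ 'k" where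
  "reindex h v = (\<chi> i. v $ h i)"

lemma reindex_nth [simp]: "reindex h v $ i = v $ h i"
  by (simp add: reindex_def)

lemma linear_reindex: "linear (reindex h)"
  by (rule linearI) (simp_all add: vec_eq_iff)

lemma bounded_linear_reindex: "bounded_linear (reindex h :: real ^ 'n::finite \<Rightarrow> real ^ 'k::finite)"
  using linear_reindex linear_conv_bounded_linear by blast

lemma reindex_inv [simp]:
  assumes "bij h" shows "reindex h (reindex (inv h) v) = v" "reindex (inv h) (reindex h w) = w"
  using assms by (simp_all add: vec_eq_iff bij_is_inj bij_is_surj surj_f_inv_f)

text \<open>Conjugation with \<open>h\<close> matches the permutations of the two index types, and
  hence the terms of the two Leibniz sums.\<close>

lemma det_reindex:
  fixes A :: "real ^ 'n ^ 'n" and h :: "'k::finite \<Rightarrow> 'n::finite"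
  assumes h: "bij h"
  shows "det ((\<chi> i j. A $ h i $ h j) :: real ^ 'k ^ 'k) = det A"
  unfolding det_def
proof (rule sum.reindex_bij_witness[where i = "\<lambda>q. inv h \<circ> q \<circ> h" and j = "\<lambda>p. h \<circ> p \<circ> inv h"], goal_cases)
  case (1 p)
  then show ?case using h by (simp add: fun_eq_iff bij_is_inj)
next
  case (2 p)
  then show ?case using h by (auto intro!: bij_imp_permutes bij_comp permutes_bij bij_imp_bij_inv)
next
  case (3 q)
  then show ?case using h by (simp add: fun_eq_iff bij_is_surj surj_f_inv_f)
next
  case (4 q)
  then show ?case using h by (auto intro!: bij_imp_permutes bij_comp permutes_bij bij_imp_bij_inv)
next
  case (5 p)
  \<comment> \<open>Conjugation by \<open>h\<close> is expressed through
    \<open>map_permutation\<close> because the two permutations act on different types; this form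
    preserves the sign.\<close>
  have "map_permutation UNIV h p = h \<circ> p \<circ> inv h"
    using h by (auto simp: map_permutation_def fun_eq_iff bij_is_surj)
  then have "sign (h \<circ> p \<circ> inv h) = sign p"
    using sign_map_permutation[of h UNIV p] 5 h by (simp add: bij_is_inj)
  moreover have "(\<Prod>i\<in>UNIV. A $ i $ (h \<circ> p \<circ> inv h) i) = (\<Prod>i\<in>UNIV. (\<chi> i j. A $ h i $ h j) $ i $ p i)"
    using prod.reindex_bij_betw[OF h, of "\<lambda>i. A $ i $ (h \<circ> p \<circ> inv h) i"] h by (simp add: bij_is_inj)
  ultimately show ?case by simp
qed

lemma det_matrix_reindex:
  fixes L :: "real ^ 'n::finite \<Rightarrow> real ^ 'n" and h :: "'k::finite \<Rightarrow> 'n"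
  assumes h: "bij h"
  shows "det (matrix (\<lambda>v. reindex h (L (reindex (inv h) v)))) = det (matrix L)"
proof -
  have "reindex (inv h) (axis j 1 :: real ^ 'k) = axis (h j) 1" for j
    using h by (auto simp: vec_eq_iff axis_def bij_is_inj bij_is_surj surj_f_inv_f)
  then have "matrix (\<lambda>v. reindex h (L (reindex (inv h) v))) = (\<chi> i j. matrix L $ h i $ h j)"
    by (simp add: matrix_def)
  then show ?thesis using det_reindex[OF h, of "matrix L"] by simp
qed

lemma prod_Basis_vec:
  fixes f :: "real ^ 'n \<Rightarrow> 'b::comm_monoid_mult"
  shows "(\<Prod>b\<in>Basis. f b) = (\<Prod>i\<in>UNIV. f (axis i 1))"
proof -
  have B: "(Basis :: (real ^ 'n) set) = range (\<lambda>i. axis i (1::real))" by (auto simp: Basis_vec_def)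
  have inj: "inj (\<lambda>i. axis i (1::real) :: real ^ 'n)" by (auto simp: inj_def axis_eq_axis)
  show ?thesis unfolding B by (subst prod.reindex[OF inj]) (simp add: o_def)
qed

text \<open>Lebesgue measure is determined by its values on boxes, and renaming coordinates carries
  a box to a box with the same edge lengths in another order.\<close>

lemma distr_lborel_reindex:
  fixes h :: "'k::finite \<Rightarrow> 'n::finite"
  assumes h: "bij h"
  shows "distr lborel borel (reindex h) = (lborel :: (real ^ 'k) measure)"
proof (rule lborel_eqI[symmetric])
  fix l u :: "real ^ 'k" assume le: "\<And>b. b \<in> Basis \<Longrightarrow> l \<bullet> b \<le> u \<bullet> b"
  have le': "l $ i \<le> u $ i" for i using le[of "axis i 1"] by (simp add: inner_axis axis_in_Basis_iff)
  have meas: "reindex h \<in> borel_measurable borel"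
    by (intro borel_measurable_continuous_onI linear_continuous_on bounded_linear_reindex)
  have "reindex h -` box l u = box (reindex (inv h) l) (reindex (inv h) u)"
  proof (intro set_eqI)
    fix v :: "real ^ 'n"
    have "(\<forall>i. l $ i < v $ h i \<and> v $ h i < u $ i) \<longleftrightarrow> (\<forall>j. l $ inv h j < v $ j \<and> v $ j < u $ inv h j)"
      using h by (metis bij_inv_eq_iff)
    then show "v \<in> reindex h -` box l u \<longleftrightarrow> v \<in> box (reindex (inv h) l) (reindex (inv h) u)"
      by (simp add: mem_box_cart)
  qed
  then have "emeasure (distr lborel borel (reindex h)) (box l u)
      = emeasure lborel (box (reindex (inv h) l) (reindex (inv h) u))"
    using meas by (simp add: emeasure_distr)
  also have "\<dots> = ennreal (\<Prod>j\<in>UNIV. (u - l) $ inv h j)"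
  proof (subst emeasure_lborel_box)
    show "reindex (inv h) l \<bullet> b \<le> reindex (inv h) u \<bullet> b" if "b \<in> Basis" for b
      using le' that by (auto simp: Basis_vec_def inner_axis)
  qed (simp add: prod_Basis_vec inner_axis)
  also have "(\<Prod>j\<in>UNIV. (u - l) $ inv h j) = (\<Prod>b\<in>Basis. (u - l) \<bullet> b)"
    using prod.reindex_bij_betw[OF bij_imp_bij_inv[OF h], of "\<lambda>i. (u - l) $ i"]
    by (simp add: prod_Basis_vec inner_axis)
  finally show "emeasure (distr lborel borel (reindex h)) (box l u) = ennreal (\<Prod>b\<in>Basis. (u - l) \<bullet> b)" .
qed simp

lemma nn_integral_lborel_reindex:
  fixes h :: "'k::finite \<Rightarrow> 'n::finite"
  assumes "bij h" "F \<in> borel_measurable borel"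
  shows "(\<integral>\<^sup>+x. F (reindex h x) \<partial>lborel) = (\<integral>\<^sup>+y. F y \<partial>lborel)"
proof -
  have "reindex h \<in> borel_measurable lborel"
    using borel_measurable_continuous_onI[OF linear_continuous_on[OF bounded_linear_reindex[of h]]] by simp
  then have "(\<integral>\<^sup>+y. F y \<partial>distr lborel borel (reindex h)) = (\<integral>\<^sup>+x. F (reindex h x) \<partial>lborel)"
    using assms(2) by (simp add: nn_integral_distr)
  then show ?thesis by (simp add: distr_lborel_reindex[OF assms(1)])
qed

section \<open>Change of variables for nonnegative integrals\<close>

lemma nn_integral_absolutely_integrable:
  fixes F :: "'a::euclidean_space \<Rightarrow> real"
  assumes m: "(\<lambda>x. indicator S x * F x) \<in> borel_measurable borel" and pos: "\<And>x. x \<in> S \<Longrightarrow> 0 \<le> F x"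
  shows "(\<integral>\<^sup>+x. ennreal (indicator S x * F x) \<partial>lborel)
     = (if F absolutely_integrable_on S then ennreal (integral S F) else \<infinity>)"
proof -
  let ?g = "\<lambda>x. indicator S x * F x"
  have g0: "0 \<le> ?g x" for x using pos by (simp add: indicator_def)
  have iff: "F absolutely_integrable_on S \<longleftrightarrow> integrable lborel ?g"
    using m integrable_completion[of ?g lborel] by (simp add: set_integrable_def)
  show ?thesis
  proof (cases "F absolutely_integrable_on S")
    case True
    then have int: "integrable lborel ?g" using iff by simp
    have "integral\<^sup>L lborel ?g = integral S F"
      using set_lebesgue_integral_eq_integral(2)[OF True] m integral_completion[of ?g lborel]
      by (simp add: set_lebesgue_integral_def)
    then show ?thesis using True nn_integral_eq_integral[OF int] g0 by simp
  next
    case False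
    then have "\<not> integrable lborel ?g" using iff by simp
    then have "\<not> (\<integral>\<^sup>+x. ennreal (?g x) \<partial>lborel) < \<infinity>"
      using integrableI_nonneg[of ?g lborel] m g0 by auto
    then have "(\<integral>\<^sup>+x. ennreal (?g x) \<partial>lborel) = \<infinity>"
      by (metis infinity_ennreal_def top.not_eq_extremum)
    then show ?thesis using False by simp
  qed
qed

text \<open>\<open>cov_invertible_real\<close> compares absolute integrability together with the
  value of the integral. For nonnegative functions this pair is the same information as one integral
  in \<open>ennreal\<close>, the value \<infinity> standing for failure of integrability.\<close>

lemma nn_integral_change_of_variables_wellorder:
  fixes f :: "real ^ 'n::{finite,wellorder} \<Rightarrow> real" and g h :: "real ^ 'n::_ \<Rightarrow> real ^ 'n::_"
  assumes g: "\<And>x. x \<in> S \<Longrightarrow> (g has_derivative g' x) (at x)"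
    and h: "\<And>y. y \<in> T \<Longrightarrow> (h has_derivative h' y) (at y)"
    and gh: "\<And>x. x \<in> S \<Longrightarrow> g x \<in> T \<and> h (g x) = x" "\<And>y. y \<in> T \<Longrightarrow> h y \<in> S \<and> g (h y) = y"
    and id: "\<And>y. y \<in> T \<Longrightarrow> h' y \<circ> g' (h y) = id"
    and m: "(\<lambda>y. indicator T y * f y) \<in> borel_measurable borel"
      "(\<lambda>x. indicator S x * (\<bar>det (matrix (g' x))\<bar> * f (g x))) \<in> borel_measurable borel"
    and f: "\<And>y. y \<in> T \<Longrightarrow> 0 \<le> f y"
  shows "(\<integral>\<^sup>+y. ennreal (indicator T y * f y) \<partial>lborel) =
    (\<integral>\<^sup>+x. ennreal (indicator S x * (\<bar>det (matrix (g' x))\<bar> * f (g x))) \<partial>lborel)"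
proof -
  \<comment> \<open>As \<open>b\<close> is arbitrary, the equivalence yields both that the two
    functions are integrable together and that their integrals agree.\<close>
  have cov: "(\<lambda>x. \<bar>det (matrix (g' x))\<bar> * f (g x)) absolutely_integrable_on S \<and>
      integral S (\<lambda>x. \<bar>det (matrix (g' x))\<bar> * f (g x)) = b \<longleftrightarrow> f absolutely_integrable_on T \<and> integral T f = b" for b
    by (rule cov_invertible_real[where h = h and h' = h'])
      (use g h gh id in \<open>auto intro: has_derivative_at_withinI\<close>)
  have f': "0 \<le> \<bar>det (matrix (g' x))\<bar> * f (g x)" if "x \<in> S" for x
    using f gh(1)[OF that] by simp
  let ?F = "\<lambda>x. \<bar>det (matrix (g' x))\<bar> * f (g x)"
  have "?F absolutely_integrable_on S \<longleftrightarrow> f absolutely_integrable_on T"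
    using cov by blast
  moreover have "integral S ?F = integral T f" if "f absolutely_integrable_on T"
    using cov[of "integral T f"] that by blast
  ultimately show ?thesis
    using nn_integral_absolutely_integrable[OF m(1) f] nn_integral_absolutely_integrable[OF m(2) f'] by simp
qed

lemma nn_integral_change_of_variables:
  fixes f :: "real ^ 'n::finite \<Rightarrow> real" and g h :: "real ^ 'n \<Rightarrow> real ^ 'n"
  assumes g: "\<And>x. x \<in> S \<Longrightarrow> (g has_derivative g' x) (at x)"
    and h: "\<And>y. y \<in> T \<Longrightarrow> (h has_derivative h' y) (at y)"
    and gh: "\<And>x. x \<in> S \<Longrightarrow> g x \<in> T \<and> h (g x) = x" "\<And>y. y \<in> T \<Longrightarrow> h y \<in> S \<and> g (h y) = y"
    and id: "\<And>y v. y \<in> T \<Longrightarrow> h' y (g' (h y) v) = v"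
    and m: "(\<lambda>y. indicator T y * f y) \<in> borel_measurable borel"
      "(\<lambda>x. indicator S x * (\<bar>det (matrix (g' x))\<bar> * f (g x))) \<in> borel_measurable borel"
    and f: "\<And>y. y \<in> T \<Longrightarrow> 0 \<le> f y"
  shows "(\<integral>\<^sup>+y. ennreal (indicator T y * f y) \<partial>lborel) =
    (\<integral>\<^sup>+x. ennreal (indicator S x * (\<bar>det (matrix (g' x))\<bar> * f (g x))) \<partial>lborel)"
proof -
  obtain e :: "'n ord_index \<Rightarrow> 'n" where e: "bij e" using bij_ord_index by blast
  define E where "E = (reindex e :: real ^ 'n \<Rightarrow> real ^ 'n ord_index)"
  define E' where "E' = (reindex (inv e) :: real ^ 'n ord_index \<Rightarrow> real ^ 'n)"
  have EE [simp]: "E (E' w) = w" "E' (E v) = v" for v w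
    using e by (simp_all add: E_def E'_def)
  have bl: "bounded_linear E" "bounded_linear E'"
    unfolding E_def E'_def by (rule bounded_linear_reindex)+
  have E'm: "E' \<in> borel_measurable borel"
    by (intro borel_measurable_continuous_onI linear_continuous_on bl)
  have nn: "(\<integral>\<^sup>+x. F x \<partial>lborel) = (\<integral>\<^sup>+w. F (E' w) \<partial>lborel)" if "F \<in> borel_measurable borel" for F
    using nn_integral_lborel_reindex[OF bij_imp_bij_inv[OF e] that] by (simp add: E'_def)
  have ind: "indicator (E' -` A) w = indicator A (E' w)" for A w by (simp add: indicator_def)
  have det: "det (matrix (\<lambda>v. E (g' (E' w) (E' v)))) = det (matrix (g' (E' w)))" for w
    unfolding E_def E'_def by (rule det_matrix_reindex[OF e])
  have comp: "((\<lambda>w. E (k (E' w))) has_derivative (\<lambda>v. E (k' (E' v)))) (at w)"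
    if "(k has_derivative k') (at (E' w))" for k k' w
    using has_derivative_compose[OF bounded_linear_imp_has_derivative[OF bl(2)] that]
    by (rule bounded_linear.has_derivative[OF bl(1)])
  have m1: "(\<lambda>w. indicator (E' -` T) w * f (E' w)) \<in> borel_measurable borel"
    using measurable_compose[OF E'm m(1)] by (simp add: ind)
  have m2: "(\<lambda>w. indicator (E' -` S) w * (\<bar>det (matrix (\<lambda>v. E (g' (E' w) (E' v))))\<bar> * f (E' (E (g (E' w)))))) \<in> borel_measurable borel"
    using measurable_compose[OF E'm m(2)] by (simp add: ind det)
  have "(\<integral>\<^sup>+w. ennreal (indicator (E' -` T) w * f (E' w)) \<partial>lborel) =
    (\<integral>\<^sup>+w. ennreal (indicator (E' -` S) w * (\<bar>det (matrix (\<lambda>v. E (g' (E' w) (E' v))))\<bar> * f (E' (E (g (E' w)))))) \<partial>lborel)"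
  proof (rule nn_integral_change_of_variables_wellorder[where g = "\<lambda>w. E (g (E' w))" and h = "\<lambda>w. E (h (E' w))"
      and f = "\<lambda>w. f (E' w)" and g' = "\<lambda>w v. E (g' (E' w) (E' v))" and h' = "\<lambda>w v. E (h' (E' w) (E' v))"])
    show "(\<lambda>v. E (h' (E' y) (E' v))) \<circ> (\<lambda>v. E (g' (E' (E (h (E' y)))) (E' v))) = id" if "y \<in> E' -` T" for y
      using that id by (auto simp: fun_eq_iff)
  qed (use gh f m1 m2 in \<open>auto intro!: comp g h\<close>)
  then show ?thesis
    using nn[OF measurable_compose[OF m(1) measurable_ennreal]] nn[OF measurable_compose[OF m(2) measurable_ennreal]]
    by (simp add: ind det)
qed

section \<open>Bilinear forms and matrices\<close>

lemma has_derivative_vec_lambda2: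
  fixes M :: "'a::real_normed_vector \<Rightarrow> real ^ 'n ^ 'm"
  assumes "\<And>i j. ((\<lambda>x. M x $ i $ j) has_derivative (\<lambda>h. M' h $ i $ j)) (at x)"
  shows "(M has_derivative M') (at x)"
proof -
  have "((\<lambda>x. M x \<bullet> b) has_derivative (\<lambda>h. M' h \<bullet> b)) (at x)" if "b \<in> Basis" for b
    using that assms by (auto simp: Basis_vec_def inner_axis)
  then show ?thesis using has_derivative_componentwise_within[of M M' x UNIV] by simp
qed

lemma matrix_nth: "matrix L $ i $ j = L (axis j 1) $ i"
  by (simp add: matrix_def)

lemma linear_vec_sum:
  fixes L :: "real ^ 'n \<Rightarrow> 'b::real_vector"
  assumes "linear L" shows "L v = (\<Sum>i\<in>UNIV. v $ i *\<^sub>R L (axis i 1))"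
proof -
  have "L v = L (\<Sum>i\<in>UNIV. v $ i *\<^sub>R axis i 1)"
    by (subst basis_expansion[symmetric]) (simp add: scalar_mult_eq_scaleR)
  then show ?thesis using assms by (simp add: linear_sum linear_scale)
qed

lemma bilinear_vec_sum:
  fixes b :: "real ^ 'n \<Rightarrow> real ^ 'n \<Rightarrow> real"
  assumes "bilinear b" shows "b u v = (\<Sum>i\<in>UNIV. \<Sum>j\<in>UNIV. (u $ i * v $ j) * b (axis i 1) (axis j 1))"
proof -
  have "b u v = (\<Sum>i\<in>UNIV. u $ i * b (axis i 1) v)"
    using linear_vec_sum[of "\<lambda>u. b u v" u] assms by (simp add: bilinear_def)
  also have "\<dots> = (\<Sum>i\<in>UNIV. u $ i * (\<Sum>j\<in>UNIV. v $ j * b (axis i 1) (axis j 1)))"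
    using linear_vec_sum[of "b (axis i 1)" v for i] assms by (simp add: bilinear_def)
  finally show ?thesis by (simp add: sum_distrib_left mult.assoc)
qed

lemma bilinear_diff_left: "bilinear h \<Longrightarrow> h (x - y) z = h x z - h y z"
  using bilinear_ladd[of h x "- y" z] by (simp add: bilinear_lneg)

lemma bilinear_diff_right: "bilinear h \<Longrightarrow> h z (x - y) = h z x - h z y"
  using bilinear_radd[of h z x "- y"] by (simp add: bilinear_rneg)

definition gram :: "(real ^ 'n \<Rightarrow> real ^ 'n \<Rightarrow> real) \<Rightarrow> real ^ 'n ^ 'n" where
  "gram b = (\<chi> i j. b (axis i 1) (axis j 1))"

lemma gram_inner:
  assumes "bilinear b" shows "u \<bullet> (gram b *v v) = b u v"
  by (subst bilinear_vec_sum[OF assms])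
    (simp add: inner_vec_def matrix_vector_mult_def gram_def sum_distrib_left mult_ac)

text \<open>A change of coordinates enters the Gram matrix twice, so its determinant enters squared.
  This is why the density of the volume changes by the absolute value of the Jacobian.\<close>

lemma gram_compose:
  assumes b: "bilinear b" and L: "linear L"
  shows "gram (\<lambda>u v. b (L u) (L v)) = transpose (matrix L) ** gram b ** matrix L"
proof -
  have bl: "bilinear (\<lambda>u v. b (L u) (L v))"
    using b L by (auto simp: bilinear_def intro: linear_compose[unfolded o_def])
  have "u \<bullet> (gram (\<lambda>u v. b (L u) (L v)) *v v) = u \<bullet> ((transpose (matrix L) ** gram b ** matrix L) *v v)" for u v
  proof -
    have "u \<bullet> ((transpose (matrix L) ** gram b ** matrix L) *v v)
      = u \<bullet> (transpose (matrix L) *v (gram b *v (matrix L *v v)))"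
      by (simp add: matrix_vector_mul_assoc matrix_mul_assoc)
    also have "\<dots> = (matrix L *v u) \<bullet> (gram b *v (matrix L *v v))"
      by (simp add: inner_commute[of u] dot_lmul_matrix inner_commute[of "matrix L *v u"])
    also have "\<dots> = b (L u) (L v)" using L b by (simp add: gram_inner matrix_works)
    finally show ?thesis by (simp add: gram_inner[OF bl])
  qed
  then show ?thesis unfolding matrix_eq by (metis vector_eq_ldot)
qed

text \<open>On the segment from the identity to \<open>G\<close> every matrix is positive definite,
  hence has trivial kernel. A sign change of the determinant would produce a singular matrix on the
  segment.\<close>

lemma det_pos_of_positive_definite:
  fixes G :: "real ^ 'n ^ 'n"
  assumes pos: "\<And>v. v \<noteq> 0 \<Longrightarrow> 0 < v \<bullet> (G *v v)"
  shows "0 < det G"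
proof (rule ccontr)
  assume *: "\<not> 0 < det G"
  define M where "M t = (1 - t) *\<^sub>R mat 1 + t *\<^sub>R G" for t :: real
  have "continuous_on {0..1} (\<lambda>t. det (M t))"
    unfolding M_def det_def by (intro continuous_intros)
  then obtain t where t: "0 \<le> t" "t \<le> 1" "det (M t) = 0"
    using IVT2'[of "\<lambda>t. det (M t)" 1 0 0] * by (auto simp: M_def)
  then obtain v where v: "v \<noteq> 0" "M t *v v = 0"
    using invertible_det_nz[of "M t"] matrix_left_invertible_ker[of "M t"] invertible_left_inverse[of "M t"] by auto
  have "v \<bullet> (M t *v v) = (1 - t) * (v \<bullet> v) + t * (v \<bullet> (G *v v))"
    by (simp add: M_def matrix_vector_mult_add_rdistrib scaleR_matrix_vector_assoc[symmetric] inner_add_right)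
  moreover have "0 < (1 - t) * (v \<bullet> v) + t * (v \<bullet> (G *v v))"
  proof (cases "t = 0")
    case False
    then show ?thesis using t pos[OF v(1)] by (intro add_nonneg_pos) auto
  qed (use v in simp)
  ultimately show False using v by simp
qed

text \<open>A product rule with three moving factors: the form and both of its arguments. The form
  is assumed differentiable for fixed arguments only, so everything is expanded in the standard
  basis.\<close>

lemma has_derivative_bilinear_family:
  fixes B :: "'a::real_normed_vector \<Rightarrow> real ^ 'n \<Rightarrow> real ^ 'n \<Rightarrow> real"
  assumes S: "open S" "x \<in> S" and bil: "\<And>y. y \<in> S \<Longrightarrow> bilinear (B y)"
    and B: "\<And>u v. ((\<lambda>y. B y u v) has_derivative B' u v) (at x)"
    and a: "(a has_derivative a') (at x)" and b: "(b has_derivative b') (at x)"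
  shows "((\<lambda>y. B y (a y) (b y)) has_derivative
    (\<lambda>h. B' (a x) (b x) h + B x (a' h) (b x) + B x (a x) (b' h))) (at x)"
proof -
  let ?e = "\<lambda>i. axis i 1 :: real ^ 'n"
  let ?D = "\<lambda>a b a' b' h. \<Sum>i\<in>UNIV. \<Sum>j\<in>UNIV. (a x $ i * b x $ j) * B' (?e i) (?e j) h
      + (a x $ i * b' h $ j + a' h $ i * b x $ j) * B x (?e i) (?e j)"
  have 1: "((\<lambda>y. B y (a y) (b y)) has_derivative ?D a b a' b') (at x)"
    if "(a has_derivative a') (at x)" "(b has_derivative b') (at x)" for a b a' b'
  proof (rule has_derivative_transform_within_open[OF _ S])
    show "((\<lambda>y. \<Sum>i\<in>UNIV. \<Sum>j\<in>UNIV. (a y $ i * b y $ j) * B y (?e i) (?e j)) has_derivative ?D a b a' b') (at x)"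
      by (intro has_derivative_sum has_derivative_mult B bounded_linear.has_derivative[OF bounded_linear_vec_nth] that)
  qed (simp add: bilinear_vec_sum[OF bil, symmetric])
  \<comment> \<open>Bilinearity of \<open>B'\<close> is not among the assumptions. It follows by
    comparing derivatives for constant arguments.\<close>
  have 2: "B' u v h = (\<Sum>i\<in>UNIV. \<Sum>j\<in>UNIV. (u $ i * v $ j) * B' (?e i) (?e j) h)" for u v h
    using has_derivative_unique[OF B 1[OF has_derivative_const[of u] has_derivative_const[of v]]]
    by (simp add: fun_eq_iff)
  have "?D a b a' b' h = B' (a x) (b x) h + B x (a' h) (b x) + B x (a x) (b' h)" for h
    unfolding 2[of "a x" "b x" h] bilinear_vec_sum[OF bil[OF S(2)], of "a' h" "b x"]
      bilinear_vec_sum[OF bil[OF S(2)], of "a x" "b' h"] sum.distrib[symmetric]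
    by (intro sum.cong refl) (simp add: algebra_simps)
  then show ?thesis using 1[OF a b] by simp
qed

section \<open>Coordinate changes\<close>

locale smooth_manifold =
  fixes A :: "('m::{t2_space, second_countable_topology}, 'n::finite) atlas"
  assumes atlas: "smooth_atlas A"
begin

abbreviation chart_img :: "('m, 'n) chart \<Rightarrow> (real ^ 'n) set" where
  "chart_img c \<equiv> chart_map c ` chart_dom c"

definition overlap :: "('m, 'n) chart \<Rightarrow> ('m, 'n) chart \<Rightarrow> (real ^ 'n) set" where
  "overlap c d = chart_map c ` (chart_dom c \<inter> chart_dom d)"

definition trans :: "('m, 'n) chart \<Rightarrow> ('m, 'n) chart \<Rightarrow> real ^ 'n \<Rightarrow> real ^ 'n" where
  "trans c d = chart_map d \<circ> chart_inv c"

text \<open>The value \<open>D^2 T(h, w)\<close> for the transition map \<open>T\<close> at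
  \<open>p\<close>. This is the term by which the derivative of the components of a vector field
  fails to transform like a tensor.\<close>

definition hess :: "('m, 'n) chart \<Rightarrow> ('m, 'n) chart \<Rightarrow> 'm \<Rightarrow> real ^ 'n \<Rightarrow> real ^ 'n \<Rightarrow> real ^ 'n" where
  "hess c d p h w = frechet_derivative (\<lambda>y. frechet_derivative (trans c d) (at y) w) (at (chart_map c p)) h"

context
  fixes c assumes c: "c \<in> A"
begin

lemma is_chart: "is_chart c" using atlas c by (auto simp: smooth_atlas_def)

lemma open_chart_dom: "open (chart_dom c)" and open_chart_img: "open (chart_img c)"
  and continuous_on_chart_map: "continuous_on (chart_dom c) (chart_map c)"
  and continuous_on_chart_inv: "continuous_on (chart_img c) (chart_inv c)"
  using is_chart by (auto simp: is_chart_def homeomorphism_def)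

lemma chart_inv_map [simp]: "p \<in> chart_dom c \<Longrightarrow> chart_inv c (chart_map c p) = p"
  using is_chart by (auto simp: is_chart_def homeomorphism_def)

lemma chart_map_inv [simp]: "x \<in> chart_img c \<Longrightarrow> chart_map c (chart_inv c x) = x"
  using is_chart by (auto simp: is_chart_def homeomorphism_def)

lemma chart_inv_mem: "x \<in> chart_img c \<Longrightarrow> chart_inv c x \<in> chart_dom c"
  by auto

lemma overlap_eq: "overlap c d = chart_img c \<inter> chart_inv c -` chart_dom d"
  by (force simp: overlap_def)

lemma open_overlap:
  assumes "d \<in> A" shows "open (overlap c d)"
proof -
  have "open (chart_dom d)" using atlas assms by (auto simp: smooth_atlas_def is_chart_def)
  then show ?thesis
    unfolding overlap_eq using continuous_on_chart_inv open_chart_img by (rule continuous_open_preimage[rotated 2])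
qed

lemma trans_smooth: "d \<in> A \<Longrightarrow> differentiable_times_on k (overlap c d) (trans c d)"
  using atlas c by (auto simp: smooth_atlas_def smooth_on_def overlap_def trans_def)

lemma map_mem_overlap: "p \<in> chart_dom c \<Longrightarrow> p \<in> chart_dom d \<Longrightarrow> chart_map c p \<in> overlap c d"
  by (simp add: overlap_def)

lemma trans_map [simp]: "p \<in> chart_dom c \<Longrightarrow> trans c d (chart_map c p) = chart_map d p"
  by (simp add: trans_def)

lemma trans_has_derivative:
  assumes "d \<in> A" "p \<in> chart_dom c" "p \<in> chart_dom d"
  shows "(trans c d has_derivative coord_change c d p) (at (chart_map c p))"
proof -
  have "trans c d differentiable (at (chart_map c p))"
    using trans_smooth[OF assms(1), of "Suc 0"] map_mem_overlap[OF assms(2,3)] by simp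
  then show ?thesis by (simp add: coord_change_def trans_def has_derivative_frechet)
qed

lemma trans_has_derivative_at:
  assumes "d \<in> A" "x \<in> overlap c d"
  shows "(trans c d has_derivative coord_change c d (chart_inv c x)) (at x)"
  using trans_has_derivative[OF assms(1), of "chart_inv c x"] assms(2) unfolding overlap_def by auto

lemma linear_coord_change:
  "d \<in> A \<Longrightarrow> p \<in> chart_dom c \<Longrightarrow> p \<in> chart_dom d \<Longrightarrow> linear (coord_change c d p)"
  using trans_has_derivative by (rule has_derivative_linear)

lemma coord_change_same:
  assumes p: "p \<in> chart_dom c" shows "coord_change c c p v = v"
proof -
  have "(trans c c has_derivative (\<lambda>v. v)) (at (chart_map c p))"
  proof (rule has_derivative_transform_within_open[OF has_derivative_ident open_chart_img])
    show "x = trans c c x" if "x \<in> chart_img c" for x using that by (simp add: trans_def)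
  qed (use p in auto)
  then show ?thesis using has_derivative_unique[OF trans_has_derivative[OF c p p]] by (simp add: fun_eq_iff)
qed

lemma hess_symmetric:
  assumes d: "d \<in> A" "p \<in> chart_dom c" "p \<in> chart_dom d"
  shows "hess c d p h w = hess c d p w h"
  unfolding hess_def
  by (rule second_derivative_symmetric[OF open_overlap[OF d(1)] map_mem_overlap[OF d(2,3)] trans_smooth[OF d(1)]])

end

lemma coord_change_comp:
  assumes "c \<in> A" "d \<in> A" "e \<in> A" and p: "p \<in> chart_dom c" "p \<in> chart_dom d" "p \<in> chart_dom e"
  shows "coord_change d e p (coord_change c d p v) = coord_change c e p v"
proof -
  have "((\<lambda>x. trans d e (trans c d x)) has_derivative (\<lambda>v. coord_change d e p (coord_change c d p v))) (at (chart_map c p))"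
    using has_derivative_compose[OF trans_has_derivative[of c d p], of "trans d e" "coord_change d e p"]
      trans_has_derivative[of d e p] assms by simp
  then have "(trans c e has_derivative (\<lambda>v. coord_change d e p (coord_change c d p v))) (at (chart_map c p))"
  proof (rule has_derivative_transform_within_open)
    show "trans d e (trans c d x) = trans c e x" if "x \<in> overlap c d" for x
      using that assms by (auto simp: overlap_def)
  qed (use assms in \<open>auto intro: open_overlap map_mem_overlap\<close>)
  then show ?thesis using has_derivative_unique trans_has_derivative[of c e p] assms by metis
qed

lemma coord_change_inverse:
  assumes "c \<in> A" "d \<in> A" "p \<in> chart_dom c" "p \<in> chart_dom d"
  shows "coord_change d c p (coord_change c d p v) = v"
  using coord_change_comp[of c d c p v] coord_change_same[of c p v] assms by simp

lemma chart_at: "chart_at A p \<in> A" "p \<in> chart_dom (chart_at A p)"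
proof -
  have "p \<in> (\<Union>c\<in>A. chart_dom c)" using atlas by (simp add: smooth_atlas_def)
  then have "\<exists>c. c \<in> A \<and> p \<in> chart_dom c" by blast
  from someI_ex[OF this] show "chart_at A p \<in> A" "p \<in> chart_dom (chart_at A p)"
    by (auto simp: chart_at_def)
qed

section \<open>Vector fields in charts\<close>

lemma vf_in_map:
  "c \<in> A \<Longrightarrow> p \<in> chart_dom c \<Longrightarrow> vf_in A X c (chart_map c p) = coord_change (chart_at A p) c p (X p)"
  by (simp add: vf_in_def to_chart_def)

lemma vf_in_chart_at: "vf_in A X (chart_at A p) (coord_at A p) = X p"
  using chart_at[of p] by (simp add: coord_at_def vf_in_map coord_change_same)

lemma vf_in_trans:
  assumes "c \<in> A" "d \<in> A" "p \<in> chart_dom c" "p \<in> chart_dom d"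
  shows "vf_in A X d (chart_map d p) = coord_change c d p (vf_in A X c (chart_map c p))"
  using assms chart_at[of p] by (simp add: vf_in_map coord_change_comp)

lemma vf_in_eq_0_iff:
  assumes "c \<in> A" "p \<in> chart_dom c"
  shows "vf_in A X c (chart_map c p) = 0 \<longleftrightarrow> X p = 0"
  using vf_in_map[OF assms, of X] coord_change_inverse[of "chart_at A p" c p "X p"] chart_at[of p] assms
    linear_0[OF linear_coord_change[of c "chart_at A p" p]] linear_0[OF linear_coord_change[of "chart_at A p" c p]]
  by auto

text \<open>The order is kept finite because products with the bump functions, which are of class
  \<open>C^1\<close> only, have to be covered.\<close>

definition dto_vfield :: "nat \<Rightarrow> ('m, 'n) vfield \<Rightarrow> bool" where
  "dto_vfield k X \<longleftrightarrow> (\<forall>c\<in>A. differentiable_times_on k (chart_img c) (vf_in A X c))"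

lemma vf_in_has_derivative:
  assumes "dto_vfield 1 X" "c \<in> A" "p \<in> chart_dom c"
  shows "(vf_in A X c has_derivative frechet_derivative (vf_in A X c) (at (chart_map c p))) (at (chart_map c p))"
  using assms by (intro has_derivative_frechet) (auto simp: dto_vfield_def)

text \<open>Differentiating \<open>X\<^sub>d \<circ> T = DT X\<^sub>c\<close>, where \<open>T\<close> is the transition map.\<close>

lemma vf_in_derivative_trans:
  assumes X: "dto_vfield 1 X" and c: "c \<in> A" and d: "d \<in> A" and p: "p \<in> chart_dom c" "p \<in> chart_dom d"
  shows "frechet_derivative (vf_in A X d) (at (chart_map d p)) (coord_change c d p h) =
    hess c d p h (vf_in A X c (chart_map c p)) +
    coord_change c d p (frechet_derivative (vf_in A X c) (at (chart_map c p)) h)"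
proof -
  let ?x = "chart_map c p"
  let ?DT = "\<lambda>y. frechet_derivative (trans c d) (at y)"
  note ov = open_overlap[OF c d] map_mem_overlap[OF c p]
  have DT: "?DT (chart_map c q) = coord_change c d q" if "q \<in> chart_dom c" "q \<in> chart_dom d" for q
    using trans_has_derivative[OF c d that] by (rule frechet_derivative_eqI)
  have 1: "((\<lambda>y. ?DT y (vf_in A X c y)) has_derivative
      (\<lambda>h. hess c d p h (vf_in A X c ?x) + ?DT ?x (frechet_derivative (vf_in A X c) (at ?x) h))) (at ?x)"
    unfolding hess_def
    by (rule has_derivative_deriv_apply[OF ov trans_smooth[OF c d] vf_in_has_derivative[OF X c p(1)]])
  have "((\<lambda>y. vf_in A X d (trans c d y)) has_derivative
      (\<lambda>h. hess c d p h (vf_in A X c ?x) + ?DT ?x (frechet_derivative (vf_in A X c) (at ?x) h))) (at ?x)"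
  proof (rule has_derivative_transform_within_open[OF 1 ov])
    fix y assume "y \<in> overlap c d"
    then obtain q where q: "y = chart_map c q" "q \<in> chart_dom c" "q \<in> chart_dom d" by (auto simp: overlap_def)
    show "?DT y (vf_in A X c y) = vf_in A X d (trans c d y)"
      using vf_in_trans[OF c d q(2,3)] by (simp add: q(1) DT[OF q(2,3)] c q(2))
  qed
  moreover have "((\<lambda>y. vf_in A X d (trans c d y)) has_derivative
      (\<lambda>h. frechet_derivative (vf_in A X d) (at (chart_map d p)) (coord_change c d p h))) (at ?x)"
    using has_derivative_compose[OF trans_has_derivative[OF c d p], of "vf_in A X d"]
      vf_in_has_derivative[OF X d p(2)] c p by simp
  ultimately show ?thesis
    by (auto dest: has_derivative_unique simp: DT[OF p] dest!: fun_cong[where x = h])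
qed

definition bracket_in :: "('m, 'n) vfield \<Rightarrow> ('m, 'n) vfield \<Rightarrow> ('m, 'n) chart \<Rightarrow> real ^ 'n \<Rightarrow> real ^ 'n" where
  "bracket_in X Y c x = frechet_derivative (vf_in A Y c) (at x) (vf_in A X c x)
     - frechet_derivative (vf_in A X c) (at x) (vf_in A Y c x)"

text \<open>The bracket is defined in the preferred chart of each point. Moving to the chart
  \<open>c\<close> produces \<open>D^2 T(X, Y)\<close> and \<open>D^2 T(Y, X)\<close> with opposite
  signs, and these cancel by symmetry.\<close>

lemma vf_in_lie_bracket:
  assumes X: "dto_vfield 1 X" and Y: "dto_vfield 1 Y" and c: "c \<in> A" and x: "x \<in> chart_img c"
  shows "vf_in A (lie_bracket A X Y) c x = bracket_in X Y c x"
proof -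
  obtain p where p: "p \<in> chart_dom c" "x = chart_map c p" using x by auto
  let ?a = "chart_at A p"
  note a = chart_at[of p]
  have "vf_in A (lie_bracket A X Y) c x = coord_change ?a c p (bracket_in X Y ?a (chart_map ?a p))"
    unfolding p(2) vf_in_map[OF c p(1)] lie_bracket_def bracket_in_def vf_jacobian_def
    by (simp add: coord_at_def[symmetric] vf_in_chart_at)
  also have "\<dots> = bracket_in X Y c (chart_map c p)"
    unfolding bracket_in_def
    using vf_in_derivative_trans[OF X a(1) c a(2) p(1)] vf_in_derivative_trans[OF Y a(1) c a(2) p(1)]
      vf_in_trans[OF a(1) c a(2) p(1)] hess_symmetric[OF a(1) c a(2) p(1)]
      linear_diff[OF linear_coord_change[OF a(1) c a(2) p(1)]] by simp
  finally show ?thesis by (simp add: p(2))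
qed

end

section \<open>Riemannian metrics in charts\<close>

text \<open>Justifies the definite description in \<open>lie_metric_endo\<close>. Existence comes
  from the nonzero Gram determinant, uniqueness from positivity on the difference of two
  solutions.\<close>

lemma riesz_unique:
  fixes b :: "real ^ 'n \<Rightarrow> real ^ 'n \<Rightarrow> real"
  assumes b: "bilinear b" "\<And>u v. b u v = b v u" "\<And>u. u \<noteq> 0 \<Longrightarrow> 0 < b u u" and l: "linear l"
  shows "\<exists>!w. \<forall>v. b w v = l v"
proof -
  have "det (gram b) \<noteq> 0"
    using det_pos_of_positive_definite[of "gram b"] b by (simp add: gram_inner)
  then obtain w where w: "gram b *v w = (\<chi> i. l (axis i 1))" using cramer by blast
  have "b w v = l v" for v
    using gram_inner[OF b(1), of v w] b(2)[of v w] linear_vec_sum[OF l, of v] by (simp add: w inner_vec_def)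
  moreover have "w' = w" if "\<forall>v. b w' v = l v" for w'
  proof (rule ccontr)
    assume "w' \<noteq> w"
    then have "0 < b (w' - w) (w' - w)" using b(3) by simp
    moreover have "b (w' - w) (w' - w) = 0"
      using that calculation(1) \<open>\<And>v. b w v = l v\<close> bilinear_diff_left[OF b(1)] by simp
    ultimately show False by simp
  qed
  ultimately show ?thesis by blast
qed

section \<open>The trace of an endomorphism\<close>

definition tr :: "(real ^ 'n \<Rightarrow> real ^ 'n) \<Rightarrow> real" where
  "tr L = trace (matrix L)"

lemma tr_sum: "tr L = (\<Sum>i\<in>UNIV. L (axis i 1) $ i)"
  by (simp add: tr_def trace_def matrix_nth)

lemma tr_add: "tr (\<lambda>v. L v + M v) = tr L + tr M"
  and tr_diff: "tr (\<lambda>v. L v - M v) = tr L - tr M"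
  and tr_scaleR: "tr (\<lambda>v. a *\<^sub>R L v) = a * tr L"
  by (simp_all add: tr_sum sum.distrib sum_subtractf sum_distrib_left)

lemma tr_rank_one: "linear l \<Longrightarrow> tr (\<lambda>v. l v *\<^sub>R w) = l w"
  using linear_vec_sum[of l w] by (simp add: tr_sum mult.commute)

lemma tr_conj:
  assumes "linear L" "linear M" "linear N" and MN: "\<And>v. N (M v) = v"
  shows "tr (\<lambda>v. M (L (N v))) = tr L"
proof -
  have "matrix N ** matrix M = mat 1"
    using matrix_compose[OF assms(2,3)] MN by (simp add: o_def flip: matrix_id_mat_1 id_def)
  moreover have "matrix (\<lambda>v. M (L (N v))) = matrix M ** (matrix L ** matrix N)"
    using matrix_compose[OF assms(3,1)] matrix_compose[OF linear_compose[OF assms(3,1)] assms(2)] by (simp add: o_def)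
  ultimately show ?thesis
    unfolding tr_def by (metis matrix_mul_assoc matrix_mul_rid trace_mul_sym)
qed

locale riemannian_manifold = smooth_manifold A
  for A :: "('m::{t2_space, second_countable_topology}, 'n::finite) atlas" +
  fixes g :: "('m, 'n) metric"
  assumes metric: "riemannian_metric A g"
begin

lemma metric_bilinear: "bilinear (g p)" and metric_sym: "g p u v = g p v u"
  and metric_pos: "u \<noteq> 0 \<Longrightarrow> 0 < g p u u"
  using metric by (auto simp: riemannian_metric_def)

lemmas metric_simps = bilinear_ladd[OF metric_bilinear] bilinear_radd[OF metric_bilinear]
  bilinear_diff_left[OF metric_bilinear] bilinear_diff_right[OF metric_bilinear]
  bilinear_lmul[OF metric_bilinear] bilinear_rmul[OF metric_bilinear]
  bilinear_lneg[OF metric_bilinear] bilinear_rneg[OF metric_bilinear]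
  bilinear_lzero[OF metric_bilinear] bilinear_rzero[OF metric_bilinear]

abbreviation m_in :: "('m, 'n) chart \<Rightarrow> real ^ 'n \<Rightarrow> real ^ 'n \<Rightarrow> real ^ 'n \<Rightarrow> real" where
  "m_in \<equiv> metric_in A g"

lemma metric_in_map:
  "c \<in> A \<Longrightarrow> p \<in> chart_dom c \<Longrightarrow> m_in c (chart_map c p) u v =
    g p (coord_change c (chart_at A p) p u) (coord_change c (chart_at A p) p v)"
  by (simp add: metric_in_def from_chart_def)

lemma metric_in_chart_at: "m_in (chart_at A p) (coord_at A p) u v = g p u v"
  using chart_at[of p] by (simp add: coord_at_def metric_in_map coord_change_same)

lemma metric_in_trans:
  assumes "c \<in> A" "d \<in> A" "p \<in> chart_dom c" "p \<in> chart_dom d"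
  shows "m_in c (chart_map c p) u v = m_in d (chart_map d p) (coord_change c d p u) (coord_change c d p v)"
  using assms chart_at[of p] by (simp add: metric_in_map coord_change_comp)

lemma metric_in_vf:
  assumes "c \<in> A" "p \<in> chart_dom c"
  shows "m_in c (chart_map c p) (vf_in A X c (chart_map c p)) (vf_in A Y c (chart_map c p)) = g p (X p) (Y p)"
  using assms chart_at[of p] by (simp add: metric_in_map vf_in_map coord_change_inverse)

lemma bilinear_metric_in:
  assumes "c \<in> A" "x \<in> chart_img c" shows "bilinear (m_in c x)"
proof -
  obtain p where p: "p \<in> chart_dom c" "x = chart_map c p" using assms by auto
  have "linear (coord_change c (chart_at A p) p)"
    using linear_coord_change[of c "chart_at A p" p] chart_at[of p] assms p by simp
  then show ?thesis
    unfolding bilinear_def linear_iff p(2) metric_in_map[OF assms(1) p(1)] by (simp add: metric_simps)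
qed

lemma metric_in_sym: "m_in c x u v = m_in c x v u"
  by (simp add: metric_in_def metric_sym)

lemma metric_in_pos:
  assumes c: "c \<in> A" "x \<in> chart_img c" and v: "v \<noteq> 0" shows "0 < m_in c x v v"
proof -
  obtain p where p: "p \<in> chart_dom c" "x = chart_map c p" using c by auto
  have "coord_change c (chart_at A p) p v \<noteq> 0"
    using coord_change_inverse[of c "chart_at A p" p v] chart_at[of p] c p v
      linear_0[OF linear_coord_change[of "chart_at A p" c p]] by auto
  then show ?thesis unfolding p(2) metric_in_map[OF c(1) p(1)] by (rule metric_pos)
qed

lemma metric_in_dto: "c \<in> A \<Longrightarrow> differentiable_times_on k (chart_img c) (\<lambda>x. m_in c x u v)"
  using metric by (auto simp: riemannian_metric_def smooth_on_def)

lemma metric_in_has_derivative: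
  assumes "c \<in> A" "p \<in> chart_dom c"
  shows "((\<lambda>x. m_in c x u v) has_derivative frechet_derivative (\<lambda>x. m_in c x u v) (at (chart_map c p))) (at (chart_map c p))"
  using metric_in_dto[OF assms(1), of "Suc 0" u v] assms(2) by (intro has_derivative_frechet) simp

section \<open>The Lie derivative of the metric in charts\<close>

definition lie_in :: "('m, 'n) vfield \<Rightarrow> ('m, 'n) chart \<Rightarrow> real ^ 'n \<Rightarrow> real ^ 'n \<Rightarrow> real ^ 'n \<Rightarrow> real" where
  "lie_in X c x u v = frechet_derivative (\<lambda>y. m_in c y u v) (at x) (vf_in A X c x)
     + m_in c x (frechet_derivative (vf_in A X c) (at x) u) v
     + m_in c x u (frechet_derivative (vf_in A X c) (at x) v)"

lemma lie_metric_eq: "lie_metric A g X p u v = lie_in X (chart_at A p) (coord_at A p) u v"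
  by (simp add: lie_metric_def lie_in_def vf_jacobian_def vf_in_chart_at metric_in_chart_at)

text \<open>Differentiating the transformation law of the metric along \<open>X\<close> gives two
  \<open>hess\<close> terms, one for each argument. The Jacobian of \<open>X\<close>, inserted into
  each argument in turn, gives the same two terms with the opposite sign.\<close>

lemma lie_in_trans:
  assumes X: "dto_vfield 1 X" and c: "c \<in> A" and d: "d \<in> A" and p: "p \<in> chart_dom c" "p \<in> chart_dom d"
  shows "lie_in X c (chart_map c p) u v = lie_in X d (chart_map d p) (coord_change c d p u) (coord_change c d p v)"
proof -
  let ?x = "chart_map c p"
  let ?DT = "\<lambda>y. frechet_derivative (trans c d) (at y)"
  note ov = open_overlap[OF c d] map_mem_overlap[OF c p]
  have DT: "?DT (chart_map c q) = coord_change c d q" if "q \<in> chart_dom c" "q \<in> chart_dom d" for q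
    using trans_has_derivative[OF c d that] by (rule frechet_derivative_eqI)
  have bil: "bilinear (m_in d (trans c d y))" if "y \<in> overlap c d" for y
    using that by (auto simp: overlap_def c intro!: bilinear_metric_in d)
  have der: "((\<lambda>y. m_in d (trans c d y) u v) has_derivative
      (\<lambda>h. frechet_derivative (\<lambda>y. m_in d y u v) (at (chart_map d p)) (coord_change c d p h))) (at ?x)" for u v
    using has_derivative_compose[OF trans_has_derivative[OF c d p], of "\<lambda>y. m_in d y u v"]
      metric_in_has_derivative[OF d p(2), of u v] c p by simp
  have DTder: "((\<lambda>y. ?DT y u) has_derivative (\<lambda>h. hess c d p h u)) (at ?x)" for u
    unfolding hess_def using trans_smooth[OF c d, of 2] ov(2)
    by (intro has_derivative_frechet) (simp add: numeral_2_eq_2)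
  have "((\<lambda>y. m_in d (trans c d y) (?DT y u) (?DT y v)) has_derivative
      (\<lambda>h. frechet_derivative (\<lambda>y. m_in d y (?DT ?x u) (?DT ?x v)) (at (chart_map d p)) (coord_change c d p h)
        + m_in d (trans c d ?x) (hess c d p h u) (?DT ?x v) + m_in d (trans c d ?x) (?DT ?x u) (hess c d p h v))) (at ?x)"
    by (rule has_derivative_bilinear_family[OF ov bil der DTder DTder])
  then have "((\<lambda>y. m_in c y u v) has_derivative
      (\<lambda>h. frechet_derivative (\<lambda>y. m_in d y (?DT ?x u) (?DT ?x v)) (at (chart_map d p)) (coord_change c d p h)
        + m_in d (trans c d ?x) (hess c d p h u) (?DT ?x v) + m_in d (trans c d ?x) (?DT ?x u) (hess c d p h v))) (at ?x)"
  proof (rule has_derivative_transform_within_open[OF _ ov])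
    fix y assume "y \<in> overlap c d"
    then obtain q where q: "y = chart_map c q" "q \<in> chart_dom c" "q \<in> chart_dom d" by (auto simp: overlap_def)
    show "m_in d (trans c d y) (?DT y u) (?DT y v) = m_in c y u v"
      using metric_in_trans[OF c d q(2,3)] by (simp add: q(1) DT[OF q(2,3)] c q(2))
  qed
  then have D: "frechet_derivative (\<lambda>y. m_in c y u v) (at ?x) h =
      frechet_derivative (\<lambda>y. m_in d y (coord_change c d p u) (coord_change c d p v)) (at (chart_map d p)) (coord_change c d p h)
        + m_in d (chart_map d p) (hess c d p h u) (coord_change c d p v) + m_in d (chart_map d p) (coord_change c d p u) (hess c d p h v)" for h
    by (simp add: frechet_derivative_eqI DT[OF p] c p)
  have J: "coord_change c d p (frechet_derivative (vf_in A X c) (at ?x) h) =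
      frechet_derivative (vf_in A X d) (at (chart_map d p)) (coord_change c d p h) - hess c d p (vf_in A X c ?x) h" for h
    using vf_in_derivative_trans[OF X c d p, of h] hess_symmetric[OF c d p, of h] by simp
  have b: "bilinear (m_in d (chart_map d p))" using d p by (intro bilinear_metric_in) auto
  show ?thesis
    unfolding lie_in_def D metric_in_trans[OF c d p] J vf_in_trans[OF c d p]
    by (simp add: bilinear_diff_left[OF b] bilinear_diff_right[OF b])
qed

text \<open>The first summand of \<open>lie_in\<close> differentiates a separate function for each
  pair of arguments. Its linearity comes from that of \<open>m_in c y\<close> at all
  \<open>y\<close> near the point; symmetry then transfers the result to the second
  argument.\<close>

lemma bilinear_lie_in:
  assumes X: "dto_vfield 1 X" and c: "c \<in> A" "p \<in> chart_dom c"
  shows "bilinear (lie_in X c (chart_map c p))"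
proof -
  let ?x = "chart_map c p"
  have x: "?x \<in> chart_img c" using c by simp
  have b: "bilinear (m_in c y)" if "y \<in> chart_img c" for y using bilinear_metric_in[OF c(1) that] .
  note bs = bilinear_ladd[OF b] bilinear_radd[OF b] bilinear_lmul[OF b] bilinear_rmul[OF b]
  note m = metric_in_has_derivative[OF c]
  have J: "linear (frechet_derivative (vf_in A X c) (at ?x))"
    using vf_in_has_derivative[OF X c] by (rule has_derivative_linear)
  have add: "frechet_derivative (\<lambda>y. m_in c y (u + u') v) (at ?x) h =
      frechet_derivative (\<lambda>y. m_in c y u v) (at ?x) h + frechet_derivative (\<lambda>y. m_in c y u' v) (at ?x) h" for u u' v h
    by (subst frechet_derivative_cong_open[OF open_chart_img[OF c(1)] x, of _ "\<lambda>y. m_in c y u v + m_in c y u' v"])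
      (simp_all add: bs frechet_derivative_eqI[OF has_derivative_add[OF m m]])
  have mul: "frechet_derivative (\<lambda>y. m_in c y (a *\<^sub>R u) v) (at ?x) h = a * frechet_derivative (\<lambda>y. m_in c y u v) (at ?x) h" for a u v h
    by (subst frechet_derivative_cong_open[OF open_chart_img[OF c(1)] x, of _ "\<lambda>y. a * m_in c y u v"])
      (simp_all add: bs frechet_derivative_eqI[OF has_derivative_mult_right[OF m]])
  have sym: "lie_in X c ?x u v = lie_in X c ?x v u" for u v
    unfolding lie_in_def using metric_in_sym[of c] by simp
  have lin: "linear (\<lambda>u. lie_in X c ?x u v)" for v
    by (rule linearI) (simp_all add: lie_in_def add mul bs x linear_add[OF J] linear_scale[OF J] algebra_simps)
  have "linear (\<lambda>v. lie_in X c ?x u v)" for u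
    using lin[of u] unfolding sym[of u] .
  then show ?thesis unfolding bilinear_def using lin by blast
qed

lemma lie_metric_endo_works:
  assumes X: "dto_vfield 1 X" shows "g p (lie_metric_endo A g X p u) v = lie_metric A g X p u v"
proof -
  have "linear (lie_metric A g X p u)"
    using bilinear_lie_in[OF X chart_at[of p]] by (simp add: lie_metric_eq[abs_def] coord_at_def bilinear_def)
  from theI'[OF riesz_unique[OF metric_bilinear metric_sym metric_pos this]]
  show ?thesis by (auto simp: lie_metric_endo_def)
qed

section \<open>Volume density and divergence in charts\<close>

abbreviation dens :: "('m, 'n) chart \<Rightarrow> real ^ 'n \<Rightarrow> real" where
  "dens \<equiv> vol_density A g"

lemma dens_eq: "dens c x = sqrt (det (gram (m_in c x)))"
  by (simp add: vol_density_def gram_def)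

lemma det_gram_pos:
  assumes "c \<in> A" "x \<in> chart_img c" shows "0 < det (gram (m_in c x))"
  by (rule det_pos_of_positive_definite) (simp add: gram_inner bilinear_metric_in metric_in_pos assms)

lemma dens_pos: "c \<in> A \<Longrightarrow> x \<in> chart_img c \<Longrightarrow> 0 < dens c x"
  by (simp add: dens_eq det_gram_pos)

lemma dens_dto:
  assumes c: "c \<in> A" shows "differentiable_times_on k (chart_img c) (dens c)"
  unfolding dens_eq[abs_def]
  by (intro dto_sqrt dto_det open_chart_img c det_gram_pos) (simp_all add: gram_def metric_in_dto c)

lemma dens_trans:
  assumes c: "c \<in> A" and d: "d \<in> A" and p: "p \<in> chart_dom c" "p \<in> chart_dom d"
  shows "dens c (chart_map c p) = \<bar>det (matrix (coord_change c d p))\<bar> * dens d (chart_map d p)"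
proof -
  have "m_in c (chart_map c p) = (\<lambda>u v. m_in d (chart_map d p) (coord_change c d p u) (coord_change c d p v))"
    by (intro ext metric_in_trans[OF c d p])
  then have "det (gram (m_in c (chart_map c p))) = (det (matrix (coord_change c d p)))\<^sup>2 * det (gram (m_in d (chart_map d p)))"
    using gram_compose[of "m_in d (chart_map d p)" "coord_change c d p"] bilinear_metric_in[OF d, of "chart_map d p"]
      linear_coord_change[OF c d p] p by (simp add: det_mul power2_eq_square)
  then show ?thesis by (simp add: dens_eq real_sqrt_mult)
qed

lemma dens_has_derivative:
  assumes "c \<in> A" "p \<in> chart_dom c"
  shows "(dens c has_derivative frechet_derivative (dens c) (at (chart_map c p))) (at (chart_map c p))"
  using dens_dto[OF assms(1), of "Suc 0"] assms(2) by (intro has_derivative_frechet) simp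

definition div_in :: "('m, 'n) vfield \<Rightarrow> ('m, 'n) chart \<Rightarrow> real ^ 'n \<Rightarrow> real" where
  "div_in X c x = tr (frechet_derivative (\<lambda>x. dens c x *\<^sub>R vf_in A X c x) (at x)) / dens c x"

text \<open>The split into the trace of the Jacobian and the logarithmic derivative of the density
  along \<open>X\<close>: these two parts can be followed through a change of chart
  separately.\<close>

lemma div_in_eq:
  assumes X: "dto_vfield 1 X" and c: "c \<in> A" "p \<in> chart_dom c"
  shows "div_in X c (chart_map c p) = tr (frechet_derivative (vf_in A X c) (at (chart_map c p))) +
    frechet_derivative (dens c) (at (chart_map c p)) (vf_in A X c (chart_map c p)) / dens c (chart_map c p)"
proof -
  have "linear (frechet_derivative (dens c) (at (chart_map c p)))"
    using dens_has_derivative[OF c] by (rule has_derivative_linear)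
  then show ?thesis
    unfolding div_in_def using dens_pos[of c "chart_map c p"] c
    by (subst frechet_derivative_eqI[OF has_derivative_scaleR[OF dens_has_derivative[OF c] vf_in_has_derivative[OF X c]]])
      (simp add: tr_add tr_scaleR tr_rank_one add_divide_distrib)
qed

text \<open>Squaring the densities avoids differentiating \<open>\<bar>det DT\<bar>\<close>.\<close>

lemma log_dens_derivative_trans:
  assumes c: "c \<in> A" and d: "d \<in> A" and p: "p \<in> chart_dom c" "p \<in> chart_dom d"
  shows "frechet_derivative (dens c) (at (chart_map c p)) h / dens c (chart_map c p) =
    frechet_derivative (dens d) (at (chart_map d p)) (coord_change c d p h) / dens d (chart_map d p)
    + tr (\<lambda>w. coord_change d c p (hess c d p h w))"
proof -
  let ?x = "chart_map c p" and ?y = "chart_map d p"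
  let ?DT = "\<lambda>y. frechet_derivative (trans c d) (at y)"
  note ov = open_overlap[OF c d] map_mem_overlap[OF c p]
  have DT: "?DT (chart_map c q) = coord_change c d q" if "q \<in> chart_dom c" "q \<in> chart_dom d" for q
    using trans_has_derivative[OF c d that] by (rule frechet_derivative_eqI)
  have DTder: "((\<lambda>y. ?DT y u) has_derivative (\<lambda>h. hess c d p h u)) (at ?x)" for u
    unfolding hess_def using trans_smooth[OF c d, of 2] ov(2)
    by (intro has_derivative_frechet) (simp add: numeral_2_eq_2)
  define \<delta> where "\<delta> y = det (matrix (?DT y))" for y
  define \<delta>' where "\<delta>' h = \<delta> ?x * tr (\<lambda>w. coord_change d c p (hess c d p h w))" for h
  have lin: "linear (coord_change c d p)" "linear (coord_change d c p)"
    using linear_coord_change c d p by blast+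
  \<comment> \<open>\<open>hess\<close> is linear in its first argument because it is a derivative
    there; symmetry transfers this to the second.\<close>
  have linh: "linear (hess c d p h)" for h
    using has_derivative_linear[OF DTder, of h] unfolding hess_symmetric[OF c d p, of _ h] .
  have inv: "matrix (coord_change d c p) ** matrix (coord_change c d p) = mat 1"
    using matrix_compose[OF lin] coord_change_inverse[OF c d p] by (simp add: o_def flip: matrix_id_mat_1 id_def)
  then have "det (matrix (coord_change d c p)) * \<delta> ?x = 1"
    by (metis \<delta>_def DT[OF p] det_mul det_I)
  then have \<delta>0: "\<delta> ?x \<noteq> 0" by auto
  have "((\<lambda>y. matrix (?DT y)) has_derivative (\<lambda>h. matrix (hess c d p h))) (at ?x)"
    by (rule has_derivative_vec_lambda2)
      (simp add: matrix_nth bounded_linear.has_derivative[OF bounded_linear_vec_nth DTder])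
  from has_derivative_det[OF this] have \<delta>: "(\<delta> has_derivative \<delta>') (at ?x)"
    using inv matrix_compose[OF linh lin(2)] by (simp add: \<delta>_def[abs_def] \<delta>'_def[abs_def] DT[OF p] tr_def o_def)
  have dd: "((\<lambda>y. dens d (trans c d y)) has_derivative
      (\<lambda>h. frechet_derivative (dens d) (at ?y) (coord_change c d p h))) (at ?x)"
    using has_derivative_compose[OF trans_has_derivative[OF c d p], of "dens d"] dens_has_derivative[OF d p(2)] c p by simp
  have "((\<lambda>y. (\<delta> y * dens d (trans c d y))\<^sup>2) has_derivative (\<lambda>h. 2 * ((\<delta> ?x * frechet_derivative (dens d) (at ?y) (coord_change c d p h) +
      \<delta>' h * dens d ?y)) * (\<delta> ?x * dens d ?y))) (at ?x)"
    using has_derivative_power[OF has_derivative_mult[OF \<delta> dd], of 2] c p by (simp add: mult_ac)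
  then have "((\<lambda>y. (dens c y)\<^sup>2) has_derivative (\<lambda>h. 2 * ((\<delta> ?x * frechet_derivative (dens d) (at ?y) (coord_change c d p h) +
      \<delta>' h * dens d ?y)) * (\<delta> ?x * dens d ?y))) (at ?x)"
  proof (rule has_derivative_transform_within_open[OF _ ov])
    fix y assume "y \<in> overlap c d"
    then obtain q where q: "y = chart_map c q" "q \<in> chart_dom c" "q \<in> chart_dom d" by (auto simp: overlap_def)
    show "(\<delta> y * dens d (trans c d y))\<^sup>2 = (dens c y)\<^sup>2"
      using dens_trans[OF c d q(2,3)] by (simp add: q(1) DT[OF q(2,3)] c q(2) \<delta>_def power_mult_distrib)
  qed
  moreover have "((\<lambda>y. (dens c y)\<^sup>2) has_derivative (\<lambda>h. 2 * frechet_derivative (dens c) (at ?x) h * dens c ?x)) (at ?x)"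
    using has_derivative_power[OF dens_has_derivative[OF c p(1)], of 2] by (simp add: mult_ac)
  ultimately have "2 * frechet_derivative (dens c) (at ?x) h * dens c ?x =
      2 * ((\<delta> ?x * frechet_derivative (dens d) (at ?y) (coord_change c d p h) + \<delta>' h * dens d ?y)) * (\<delta> ?x * dens d ?y)"
    by (auto dest: has_derivative_unique dest!: fun_cong[where x = h])
  then have "frechet_derivative (dens c) (at ?x) h * dens c ?x =
      (\<delta> ?x * frechet_derivative (dens d) (at ?y) (coord_change c d p h) + \<delta>' h * dens d ?y) * (\<delta> ?x * dens d ?y)"
    by (simp only: mult.assoc)
  moreover have "(dens c ?x)\<^sup>2 = (\<delta> ?x * dens d ?y)\<^sup>2"
    using dens_trans[OF c d p] by (simp add: \<delta>_def DT[OF p] power_mult_distrib)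
  \<comment> \<open>Dividing by the equal squares of the two densities turns the identity into one
    between logarithmic derivatives. The sign of the Jacobian determinant drops out.\<close>
  ultimately have "frechet_derivative (dens c) (at ?x) h * dens c ?x / (dens c ?x)\<^sup>2 =
      (\<delta> ?x * frechet_derivative (dens d) (at ?y) (coord_change c d p h) + \<delta>' h * dens d ?y) * (\<delta> ?x * dens d ?y) / (\<delta> ?x * dens d ?y)\<^sup>2"
    by simp
  moreover have "dens c ?x > 0" "dens d ?y > 0" using dens_pos c d p by auto
  moreover have "a * r / r\<^sup>2 = a / r" "(e * a + e * t * b) * (e * b) / (e * b)\<^sup>2 = a / b + t"
    if "0 < r" "0 < b" "e \<noteq> 0" for a r e t b :: real
    using that by (simp_all add: field_simps power2_eq_square)
  ultimately show ?thesis
    using \<delta>0 by (simp add: \<delta>'_def)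
qed

text \<open>Under a change of chart the trace of the Jacobian loses the trace of
  \<open>DT^{-1} D^2 T(X, -)\<close>, and the logarithmic derivative of the density gains exactly
  that.\<close>

lemma div_in_trans:
  assumes X: "dto_vfield 1 X" and c: "c \<in> A" and d: "d \<in> A" and p: "p \<in> chart_dom c" "p \<in> chart_dom d"
  shows "div_in X c (chart_map c p) = div_in X d (chart_map d p)"
proof -
  let ?x = "chart_map c p" and ?y = "chart_map d p"
  have lin: "linear (coord_change c d p)" "linear (coord_change d c p)"
    using linear_coord_change c d p by blast+
  have linD: "linear (frechet_derivative (vf_in A X d) (at ?y))"
    using vf_in_has_derivative[OF X d p(2)] by (rule has_derivative_linear)
  have J: "frechet_derivative (vf_in A X c) (at ?x) =
      (\<lambda>h. coord_change d c p (frechet_derivative (vf_in A X d) (at ?y) (coord_change c d p h))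
        - coord_change d c p (hess c d p (vf_in A X c ?x) h))"
  proof
    fix h
    have "coord_change c d p (frechet_derivative (vf_in A X c) (at ?x) h) =
      frechet_derivative (vf_in A X d) (at ?y) (coord_change c d p h) - hess c d p (vf_in A X c ?x) h"
      using vf_in_derivative_trans[OF X c d p, of h] hess_symmetric[OF c d p, of h] by simp
    then show "frechet_derivative (vf_in A X c) (at ?x) h =
      coord_change d c p (frechet_derivative (vf_in A X d) (at ?y) (coord_change c d p h))
        - coord_change d c p (hess c d p (vf_in A X c ?x) h)"
      by (metis coord_change_inverse[OF c d p] linear_diff[OF lin(2)])
  qed
  have "tr (frechet_derivative (vf_in A X c) (at ?x)) = tr (frechet_derivative (vf_in A X d) (at ?y))
      - tr (\<lambda>h. coord_change d c p (hess c d p (vf_in A X c ?x) h))"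
    unfolding J tr_diff
    using tr_conj[OF linD lin(2,1) coord_change_inverse[OF d c p(2,1)]] by simp
  then show ?thesis
    using div_in_eq[OF X c p(1)] div_in_eq[OF X d p(2)]
      log_dens_derivative_trans[OF c d p, of "vf_in A X c ?x"] vf_in_trans[OF c d p, of X] by simp
qed

lemma divergence_eq_div_in:
  assumes X: "dto_vfield 1 X" and c: "c \<in> A" "p \<in> chart_dom c"
  shows "divergence A g X p = div_in X c (chart_map c p)"
proof -
  have "divergence A g X p = div_in X (chart_at A p) (chart_map (chart_at A p) p)"
    by (simp add: divergence_def div_in_def tr_def coord_at_def)
  then show ?thesis using div_in_trans[OF X _ c(1) _ c(2)] chart_at by metis
qed

end

section \<open>Smoothness of the bracket and of the endomorphisms \<open>\<beta>(X)\<close>\<close>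

context smooth_manifold
begin

definition dto_fun :: "nat \<Rightarrow> ('m \<Rightarrow> real) \<Rightarrow> bool" where
  "dto_fun k f \<longleftrightarrow> (\<forall>c\<in>A. differentiable_times_on k (chart_img c) (\<lambda>x. f (chart_inv c x)))"

lemma vf_in_add:
  assumes "c \<in> A" "x \<in> chart_img c"
  shows "vf_in A (\<lambda>p. X p + Y p) c x = vf_in A X c x + vf_in A Y c x"
  using assms linear_add[OF linear_coord_change[OF chart_at(1) assms(1) chart_at(2)]] chart_inv_mem[OF assms]
  by (simp add: vf_in_def to_chart_def)

lemma vf_in_scaleR:
  assumes "c \<in> A" "x \<in> chart_img c"
  shows "vf_in A (\<lambda>p. f p *\<^sub>R X p) c x = f (chart_inv c x) *\<^sub>R vf_in A X c x"
  using assms linear_scale[OF linear_coord_change[OF chart_at(1) assms(1) chart_at(2)]] chart_inv_mem[OF assms]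
  by (simp add: vf_in_def to_chart_def)

lemma dto_vfield_add:
  assumes "dto_vfield k X" "dto_vfield k Y" shows "dto_vfield k (\<lambda>p. X p + Y p)"
  unfolding dto_vfield_def
proof
  fix c assume c: "c \<in> A"
  have "differentiable_times_on k (chart_img c) (\<lambda>x. vf_in A X c x + vf_in A Y c x)"
    using assms c by (intro dto_add open_chart_img) (auto simp: dto_vfield_def)
  then show "differentiable_times_on k (chart_img c) (vf_in A (\<lambda>p. X p + Y p) c)"
    using dto_cong[OF open_chart_img[OF c], of "vf_in A (\<lambda>p. X p + Y p) c" "\<lambda>x. vf_in A X c x + vf_in A Y c x"]
      vf_in_add[OF c] by simp
qed

lemma dto_vfield_scaleR:
  assumes "dto_fun k f" "dto_vfield k X" shows "dto_vfield k (\<lambda>p. f p *\<^sub>R X p)"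
  unfolding dto_vfield_def
proof
  fix c assume c: "c \<in> A"
  have "differentiable_times_on k (chart_img c) (\<lambda>x. f (chart_inv c x) *\<^sub>R vf_in A X c x)"
    using assms c by (intro dto_scaleR open_chart_img) (auto simp: dto_vfield_def dto_fun_def)
  then show "differentiable_times_on k (chart_img c) (vf_in A (\<lambda>p. f p *\<^sub>R X p) c)"
    using dto_cong[OF open_chart_img[OF c], of "vf_in A (\<lambda>p. f p *\<^sub>R X p) c" "\<lambda>x. f (chart_inv c x) *\<^sub>R vf_in A X c x"]
      vf_in_scaleR[OF c] by simp
qed

lemma dto_fun_const: "dto_fun k (\<lambda>p. a)"
  by (simp add: dto_fun_def)

lemma dto_vfield_diff:
  assumes "dto_vfield k X" "dto_vfield k Y" shows "dto_vfield k (\<lambda>p. X p - Y p)"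
  using dto_vfield_add[OF assms(1) dto_vfield_scaleR[OF dto_fun_const[of k "-1"] assms(2)]] by simp

lemma dto_vfield_1: "dto_vfield (Suc k) X \<Longrightarrow> dto_vfield 1 X"
  unfolding dto_vfield_def by (intro ballI, rule dto_mono[of 1 "Suc k"], simp, blast)

lemma dto_vfield_lie_bracket:
  assumes X: "dto_vfield (Suc k) X" and Y: "dto_vfield (Suc k) Y"
  shows "dto_vfield k (lie_bracket A X Y)"
  unfolding dto_vfield_def
proof
  fix c assume c: "c \<in> A"
  have "differentiable_times_on k (chart_img c) (bracket_in X Y c)"
    unfolding bracket_in_def
    using X Y c by (intro dto_diff dto_frechet_apply open_chart_img) (auto simp: dto_vfield_def intro: dto_SucD)
  then show "differentiable_times_on k (chart_img c) (vf_in A (lie_bracket A X Y) c)"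
    using dto_cong[OF open_chart_img[OF c], of "vf_in A (lie_bracket A X Y) c" "bracket_in X Y c"]
      vf_in_lie_bracket[OF dto_vfield_1[OF X] dto_vfield_1[OF Y] c] by simp
qed

lemma vfields_c_iff:
  "X \<in> vfields_c A \<longleftrightarrow> (\<forall>k. dto_vfield k X) \<and> compact (closure {p. X p \<noteq> 0})"
  by (auto simp: vfields_c_def smooth_on_def dto_vfield_def)

end

context riemannian_manifold
begin

lemma dto_metric_in:
  assumes c: "c \<in> A" and a: "differentiable_times_on k (chart_img c) a" and b: "differentiable_times_on k (chart_img c) b"
  shows "differentiable_times_on k (chart_img c) (\<lambda>x. m_in c x (a x) (b x))"
proof -
  note S = open_chart_img[OF c]
  have "differentiable_times_on k (chart_img c)
      (\<lambda>x. \<Sum>i\<in>UNIV. \<Sum>j\<in>UNIV. (a x $ i * b x $ j) * m_in c x (axis i 1) (axis j 1))"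
    by (intro dto_sum dto_mult S dto_vec_nth a b metric_in_dto c)
  then show ?thesis
    using dto_cong[OF S, of "\<lambda>x. m_in c x (a x) (b x)"
        "\<lambda>x. \<Sum>i\<in>UNIV. \<Sum>j\<in>UNIV. (a x $ i * b x $ j) * m_in c x (axis i 1) (axis j 1)"]
      bilinear_vec_sum[OF bilinear_metric_in[OF c]] by simp
qed

lemma dto_fun_metric:
  assumes "dto_vfield k X" "dto_vfield k Y" shows "dto_fun k (\<lambda>p. g p (X p) (Y p))"
  unfolding dto_fun_def
proof
  fix c assume c: "c \<in> A"
  have "differentiable_times_on k (chart_img c) (\<lambda>x. m_in c x (vf_in A X c x) (vf_in A Y c x))"
    using assms c by (intro dto_metric_in) (auto simp: dto_vfield_def)
  then show "differentiable_times_on k (chart_img c) (\<lambda>x. g (chart_inv c x) (X (chart_inv c x)) (Y (chart_inv c x)))"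
    by (subst dto_cong[OF open_chart_img[OF c], of _ "\<lambda>x. m_in c x (vf_in A X c x) (vf_in A Y c x)"])
      (auto simp: metric_in_vf c)
qed

lemma dto_fun_divergence:
  assumes X: "dto_vfield (Suc k) X" shows "dto_fun k (divergence A g X)"
  unfolding dto_fun_def
proof
  fix c assume c: "c \<in> A"
  note S = open_chart_img[OF c]
  have 1: "differentiable_times_on (Suc k) (chart_img c) (\<lambda>x. dens c x *\<^sub>R vf_in A X c x)"
    using X c by (intro dto_scaleR S dens_dto) (auto simp: dto_vfield_def)
  have "differentiable_times_on k (chart_img c) (div_in X c)"
    unfolding div_in_def[abs_def] tr_sum using 1
    by (intro dto_divide dto_sum dto_vec_nth S dens_dto dens_pos c) auto
  then show "differentiable_times_on k (chart_img c) (\<lambda>x. divergence A g X (chart_inv c x))"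
    by (subst dto_cong[OF S, of _ "div_in X c"]) (auto simp: divergence_eq_div_in[OF dto_vfield_1[OF X] c] c)
qed

lemma lie_in_dto:
  assumes X: "dto_vfield (Suc k) X" and c: "c \<in> A" and a: "differentiable_times_on k (chart_img c) a"
  shows "differentiable_times_on k (chart_img c) (\<lambda>x. lie_in X c x (a x) v)"
proof -
  note S = open_chart_img[OF c]
  have Xc: "differentiable_times_on (Suc k) (chart_img c) (vf_in A X c)" using X c by (simp add: dto_vfield_def)
  have "differentiable_times_on k (chart_img c) (\<lambda>x. \<Sum>i\<in>UNIV. a x $ i * lie_in X c x (axis i 1) v)"
    unfolding lie_in_def
    by (intro dto_sum dto_mult dto_add dto_frechet_apply dto_metric_in S c metric_in_dto dto_vec_nth a
        Xc dto_SucD[OF Xc] dto_const)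
  moreover have "lie_in X c x (a x) v = (\<Sum>i\<in>UNIV. a x $ i * lie_in X c x (axis i 1) v)" if "x \<in> chart_img c" for x
    using bilinear_lie_in[OF dto_vfield_1[OF X] c] that linear_vec_sum[of "\<lambda>u. lie_in X c x u v" "a x"]
    by (auto simp: bilinear_def)
  ultimately show ?thesis
    using dto_cong[OF S, of "\<lambda>x. lie_in X c x (a x) v" "\<lambda>x. \<Sum>i\<in>UNIV. a x $ i * lie_in X c x (axis i 1) v"] by simp
qed

text \<open>The solution \<open>w\<close> of \<open>g(w, v) = l(v)\<close> depends smoothly on the point by Cramer's rule.\<close>

lemma dto_riesz:
  assumes c: "c \<in> A" and l: "\<And>v. differentiable_times_on k (chart_img c) (l v)"
    and w: "\<And>x v. x \<in> chart_img c \<Longrightarrow> m_in c x (w x) v = l v x"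
  shows "differentiable_times_on k (chart_img c) w"
proof -
  note S = open_chart_img[OF c]
  let ?w = "\<lambda>x. \<chi> n. det (\<chi> i j. if j = n then (\<chi> i. l (axis i 1) x) $ i else gram (m_in c x) $ i $ j) / det (gram (m_in c x))"
  have "w x = ?w x" if x: "x \<in> chart_img c" for x
  proof -
    have "(gram (m_in c x) *v w x) $ i = l (axis i 1) x" for i
      using gram_inner[OF bilinear_metric_in[OF c x], of "axis i 1" "w x"] w[OF x, of "axis i 1"]
      by (simp add: inner_axis' metric_in_sym[of c x "axis i 1"])
    then have "gram (m_in c x) *v w x = (\<chi> i. l (axis i 1) x)" by (simp add: vec_eq_iff)
    moreover have "det (gram (m_in c x)) \<noteq> 0" using det_gram_pos[OF c x] by simp
    ultimately show ?thesis by (blast dest: cramer[THEN iffD1, rotated])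
  qed
  moreover have "differentiable_times_on k (chart_img c) ?w"
  proof -
    have cases: "differentiable_times_on k (chart_img c)
        (\<lambda>x. if b then (\<chi> i. l (axis i 1) x) $ i else gram (m_in c x) $ i $ j)" for b i j
      by (cases b) (simp_all add: gram_def metric_in_dto c l)
    show ?thesis
      by (intro dto_vec[OF S], simp, intro dto_divide dto_det S det_gram_pos c)
        (simp_all add: cases, simp add: gram_def metric_in_dto c)
  qed
  ultimately show ?thesis using dto_cong[OF S, of w ?w] by simp
qed

text \<open>In each chart the components solve a linear system whose matrix and right side are known
  to be differentiable, so \<open>dto_riesz\<close> applies and no explicit formula for them is
  needed.\<close>

lemma dto_vfield_lie_metric_endo:
  assumes X: "dto_vfield (Suc k) X" and Y: "dto_vfield k Y"
  shows "dto_vfield k (\<lambda>p. lie_metric_endo A g X p (Y p))"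
  unfolding dto_vfield_def
proof
  fix c assume c: "c \<in> A"
  note X1 = dto_vfield_1[OF X]
  show "differentiable_times_on k (chart_img c) (vf_in A (\<lambda>p. lie_metric_endo A g X p (Y p)) c)"
  proof (rule dto_riesz[OF c, of k "\<lambda>v x. lie_in X c x (vf_in A Y c x) v"])
    show "differentiable_times_on k (chart_img c) (\<lambda>x. lie_in X c x (vf_in A Y c x) v)" for v
      using Y c by (intro lie_in_dto X) (auto simp: dto_vfield_def)
    fix x v assume "x \<in> chart_img c"
    then obtain p where p: "p \<in> chart_dom c" "x = chart_map c p" by auto
    note a = chart_at[of p]
    show "m_in c x (vf_in A (\<lambda>p. lie_metric_endo A g X p (Y p)) c x) v = lie_in X c x (vf_in A Y c x) v"
      unfolding p(2) metric_in_map[OF c p(1)] vf_in_map[OF c p(1)] lie_in_trans[OF X1 c a(1) p(1) a(2)]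
        coord_change_inverse[OF a(1) c a(2) p(1)] lie_metric_endo_works[OF X1] lie_metric_eq coord_at_def ..
  qed
qed

lemma dto_vfield_beta:
  assumes X: "dto_vfield (Suc k) X" and Y: "dto_vfield k Y"
  shows "dto_vfield k (\<lambda>p. beta A g X p (Y p))"
  unfolding beta_def
  by (intro dto_vfield_add dto_vfield_scaleR dto_fun_divergence dto_vfield_lie_metric_endo assms)

lemma linear_lie_metric_endo:
  assumes X: "dto_vfield 1 X" shows "linear (lie_metric_endo A g X p)"
proof (rule linearI)
  have bil: "bilinear (lie_metric A g X p)"
    using bilinear_lie_in[OF X chart_at[of p]] by (simp add: lie_metric_eq[abs_def] coord_at_def)
  have eqI: "u = v" if "\<And>w. g p u w = g p v w" for u v
    using metric_pos[of "u - v" p] that by (auto simp: metric_simps)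
  show "lie_metric_endo A g X p (u + v) = lie_metric_endo A g X p u + lie_metric_endo A g X p v" for u v
    by (rule eqI) (simp add: metric_simps lie_metric_endo_works[OF X] bilinear_ladd[OF bil])
  show "lie_metric_endo A g X p (a *\<^sub>R u) = a *\<^sub>R lie_metric_endo A g X p u" for a u
    by (rule eqI) (simp add: metric_simps lie_metric_endo_works[OF X] bilinear_lmul[OF bil])
qed

lemma linear_beta: "dto_vfield 1 X \<Longrightarrow> linear (beta A g X p)"
  unfolding beta_def[abs_def] by (intro linear_compose_add linear_lie_metric_endo linear_compose_scale_right linear_id[unfolded id_def])

lemma lie_metric_sym: "lie_metric A g X p u v = lie_metric A g X p v u"
  unfolding lie_metric_eq lie_in_def by (simp add: metric_in_sym[of "chart_at A p"])

lemma beta_sym: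
  assumes X: "dto_vfield 1 X" shows "g p (beta A g X p u) v = g p u (beta A g X p v)"
  unfolding beta_def using lie_metric_sym[of X p u v] metric_sym[of p u "lie_metric_endo A g X p v"]
  by (simp add: metric_simps lie_metric_endo_works[OF X])

section \<open>Product rules for the divergence\<close>

lemma lie_bracket_eq_jacobian:
  "lie_bracket A X Y p = frechet_derivative (vf_in A Y (chart_at A p)) (at (coord_at A p)) (X p)
    - frechet_derivative (vf_in A X (chart_at A p)) (at (coord_at A p)) (Y p)"
  by (simp add: lie_bracket_def vf_jacobian_def)

text \<open>The Leibniz rule for the Lie derivative along \<open>X\<close> of the function
  \<open>g(Y,Z)\<close>, whose derivative is the left side. The terms that differentiate
  \<open>X\<close> cancel between \<open>lie_metric\<close> and the two brackets.\<close>

lemma metric_derivative: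
  fixes p
  assumes X: "dto_vfield 1 X" and Y: "dto_vfield 1 Y" and Z: "dto_vfield 1 Z"
  defines "a \<equiv> chart_at A p"
  shows "frechet_derivative (\<lambda>x. g (chart_inv a x) (Y (chart_inv a x)) (Z (chart_inv a x))) (at (coord_at A p)) (X p)
    = lie_metric A g X p (Y p) (Z p) + g p (lie_bracket A X Y p) (Z p) + g p (Y p) (lie_bracket A X Z p)"
proof -
  have a: "a \<in> A" "p \<in> chart_dom a" "chart_map a p = coord_at A p"
    using chart_at[of p] by (auto simp: a_def coord_at_def)
  have x: "coord_at A p \<in> chart_img a" unfolding a(3)[symmetric] using a(2) by (rule imageI)
  let ?D = "\<lambda>V. frechet_derivative (vf_in A V a) (at (coord_at A p))"
  have eq: "m_in a x (vf_in A Y a x) (vf_in A Z a x) = g (chart_inv a x) (Y (chart_inv a x)) (Z (chart_inv a x))"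
    if "x \<in> chart_img a" for x using that a by (auto simp: metric_in_vf)
  have D: "(vf_in A V a has_derivative ?D V) (at (coord_at A p))" if "dto_vfield 1 V" for V
    using vf_in_has_derivative[OF that a(1,2)] a(3) by simp
  have m: "((\<lambda>x. m_in a x u v) has_derivative frechet_derivative (\<lambda>x. m_in a x u v) (at (coord_at A p))) (at (coord_at A p))" for u v
    using metric_in_has_derivative[OF a(1,2)] a(3) by simp
  have "frechet_derivative (\<lambda>x. m_in a x (vf_in A Y a x) (vf_in A Z a x)) (at (coord_at A p)) (X p) =
      frechet_derivative (\<lambda>x. m_in a x (Y p) (Z p)) (at (coord_at A p)) (X p) + g p (?D Y (X p)) (Z p) + g p (Y p) (?D Z (X p))"
    using frechet_derivative_eqI[OF has_derivative_bilinear_family[OF open_chart_img[OF a(1)] x bilinear_metric_in[OF a(1)] m D[OF Y] D[OF Z]]]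
    by (simp add: a_def vf_in_chart_at metric_in_chart_at)
  also have "frechet_derivative (\<lambda>x. m_in a x (vf_in A Y a x) (vf_in A Z a x)) (at (coord_at A p)) =
      frechet_derivative (\<lambda>x. g (chart_inv a x) (Y (chart_inv a x)) (Z (chart_inv a x))) (at (coord_at A p))"
    by (rule frechet_derivative_cong_open[OF open_chart_img[OF a(1)] x eq])
  finally show ?thesis
    by (simp add: lie_metric_eq lie_in_def lie_bracket_eq_jacobian vf_in_chart_at metric_in_chart_at metric_simps a_def)
qed

lemma divergence_scaleR:
  fixes p
  assumes f: "dto_fun 1 f" and X: "dto_vfield 1 X"
  defines "a \<equiv> chart_at A p"
  shows "divergence A g (\<lambda>p. f p *\<^sub>R X p) p = f p * divergence A g X p +
    frechet_derivative (\<lambda>x. f (chart_inv a x)) (at (coord_at A p)) (X p)"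
proof -
  have a: "a \<in> A" "p \<in> chart_dom a" "chart_map a p = coord_at A p"
    using chart_at[of p] by (auto simp: a_def coord_at_def)
  let ?x = "chart_map a p"
  have inv: "chart_inv a ?x = p" using a(1,2) by (rule chart_inv_map)
  have at: "vf_in A V a (coord_at A p) = V p" for V by (simp add: a_def vf_in_chart_at)
  have x: "?x \<in> chart_img a" using a(2) by (rule imageI)
  let ?f = "\<lambda>x. f (chart_inv a x)"
  have f': "(?f has_derivative frechet_derivative ?f (at ?x)) (at ?x)"
    using f a(1) x by (intro has_derivative_frechet) (auto simp: dto_fun_def)
  have "frechet_derivative (vf_in A (\<lambda>p. f p *\<^sub>R X p) a) (at ?x) = frechet_derivative (\<lambda>x. ?f x *\<^sub>R vf_in A X a x) (at ?x)"
    by (rule frechet_derivative_cong_open[OF open_chart_img[OF a(1)] x vf_in_scaleR[OF a(1)]])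
  also have "\<dots> = (\<lambda>h. f p *\<^sub>R frechet_derivative (vf_in A X a) (at ?x) h + frechet_derivative ?f (at ?x) h *\<^sub>R X p)"
    using frechet_derivative_eqI[OF has_derivative_scaleR[OF f' vf_in_has_derivative[OF X a(1,2)]]] inv[unfolded a(3)]
    by (simp add: a(3) at)
  finally have D: "frechet_derivative (vf_in A (\<lambda>p. f p *\<^sub>R X p) a) (at ?x) =
    (\<lambda>h. f p *\<^sub>R frechet_derivative (vf_in A X a) (at ?x) h + frechet_derivative ?f (at ?x) h *\<^sub>R X p)" .
  show ?thesis
    unfolding divergence_eq_div_in[OF X a(1,2)] divergence_eq_div_in[OF dto_vfield_scaleR[OF f X] a(1,2)]
      div_in_eq[OF X a(1,2)] div_in_eq[OF dto_vfield_scaleR[OF f X] a(1,2)] D tr_add tr_scaleR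
      tr_rank_one[OF has_derivative_linear[OF f']] vf_in_scaleR[OF a(1) x]
      linear_scale[OF has_derivative_linear[OF dens_has_derivative[OF a(1,2)]]]
    using dens_pos[OF a(1) x] inv[unfolded a(3)] by (simp add: a(3) at algebra_simps)
qed

lemma divergence_add:
  assumes X: "dto_vfield 1 X" and Y: "dto_vfield 1 Y"
  shows "divergence A g (\<lambda>p. X p + Y p) p = divergence A g X p + divergence A g Y p"
proof -
  let ?a = "chart_at A p"
  let ?x = "chart_map ?a p"
  note a = chart_at[of p]
  have x: "?x \<in> chart_img ?a" using a(2) by (rule imageI)
  have D: "frechet_derivative (vf_in A (\<lambda>p. X p + Y p) ?a) (at ?x) =
     (\<lambda>h. frechet_derivative (vf_in A X ?a) (at ?x) h + frechet_derivative (vf_in A Y ?a) (at ?x) h)"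
    using frechet_derivative_cong_open[OF open_chart_img[OF a(1)] x vf_in_add[OF a(1), of _ X Y]]
      frechet_derivative_eqI[OF has_derivative_add[OF vf_in_has_derivative[OF X a] vf_in_has_derivative[OF Y a]]] by simp
  show ?thesis
    unfolding divergence_eq_div_in[OF X a] divergence_eq_div_in[OF Y a] divergence_eq_div_in[OF dto_vfield_add[OF X Y] a]
      div_in_eq[OF X a] div_in_eq[OF Y a] div_in_eq[OF dto_vfield_add[OF X Y] a] D tr_add vf_in_add[OF a(1) x]
      linear_add[OF has_derivative_linear[OF dens_has_derivative[OF a]]]
    by (simp add: add_divide_distrib)
qed

text \<open>This is where \<beta>(X) comes from: the Leibniz rule contributes the Lie derivative of
  the metric, and scaling \<open>X\<close> by a function contributes the divergence. What remains on
  the right are two brackets.\<close>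

lemma divergence_metric_scaleR:
  assumes X: "dto_vfield 1 X" and Y: "dto_vfield 1 Y" and Z: "dto_vfield 1 Z"
  shows "divergence A g (\<lambda>p. g p (Y p) (Z p) *\<^sub>R X p) p =
    g p (beta A g X p (Y p) + lie_bracket A X Y p) (Z p) + g p (Y p) (lie_bracket A X Z p)"
  unfolding divergence_scaleR[OF dto_fun_metric[OF Y Z] X] metric_derivative[OF X Y Z] beta_def
  by (simp add: metric_simps lie_metric_endo_works[OF X])

end

section \<open>The volume measure\<close>

lemma measurable_indicator_mult:
  fixes f :: "'a::topological_space \<Rightarrow> real"
  assumes "S \<in> sets borel" "S \<subseteq> U" "open U" "continuous_on U f"
  shows "(\<lambda>x. indicator S x * f x) \<in> borel_measurable borel"
proof -
  have "(\<lambda>x. indicator S x *\<^sub>R f x) \<in> borel_measurable borel"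
    by (rule borel_measurable_continuous_on_indicator[OF assms(1) continuous_on_subset[OF assms(4,2)]])
  then show ?thesis by simp
qed

lemma ennreal_mult_indicator: "ennreal r * indicator S x = ennreal (indicator S x * r)"
  by (simp add: indicator_def)

context smooth_manifold
begin

text \<open>The image under a chart is the preimage under the inverse chart, which is continuous on
  an open set.\<close>

lemma borel_chart_img:
  assumes c: "c \<in> A" and B: "B \<in> sets borel" "B \<subseteq> chart_dom c"
  shows "chart_map c ` B \<in> sets borel"
proof -
  have "chart_inv c \<in> borel_measurable (restrict_space borel (chart_img c))"
    by (rule borel_measurable_continuous_on_restrict[OF continuous_on_chart_inv[OF c]])
  from measurable_sets[OF this B(1)]
  have "chart_inv c -` B \<inter> chart_img c \<in> sets (restrict_space borel (chart_img c))"
    by (simp add: space_restrict_space)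
  then have "chart_inv c -` B \<inter> chart_img c \<in> sets borel"
    using open_chart_img[OF c] by (subst (asm) sets_restrict_space_iff) auto
  moreover have "chart_inv c -` B \<inter> chart_img c = chart_map c ` B"
    using B(2) c by force
  ultimately show ?thesis by simp
qed

text \<open>Lindelof's theorem, from second countability. Enumeration by the natural numbers,
  possibly with repetitions, prepares for making the domains disjoint.\<close>

lemma countable_subatlas:
  obtains e :: "nat \<Rightarrow> ('m, 'n) chart" where "range e \<subseteq> A" "(\<Union>i. chart_dom (e i)) = UNIV"
proof -
  have op: "open S" if "S \<in> chart_dom ` A" for S using that by (auto dest: open_chart_dom)
  obtain F where F: "F \<subseteq> chart_dom ` A" "countable F" "\<Union>F = \<Union>(chart_dom ` A)"
    using Lindelof[OF op] by blast
  have U: "\<Union>F = UNIV" using F(3) atlas by (simp add: smooth_atlas_def)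
  then have ne: "F \<noteq> {}" by auto
  have "\<exists>c. c \<in> A \<and> chart_dom c = from_nat_into F i" for i
    using from_nat_into[OF ne, of i] F(1) by force
  then obtain e where e: "\<And>i. e i \<in> A" "\<And>i. chart_dom (e i) = from_nat_into F i" by metis
  have "(\<Union>i. chart_dom (e i)) = UNIV"
    using U range_from_nat_into[OF ne F(2)] by (simp add: e)
  then show ?thesis using that e by blast
qed

end

context riemannian_manifold
begin

definition vol_in :: "('m, 'n) chart \<Rightarrow> 'm set \<Rightarrow> ennreal" where
  "vol_in c B = (\<integral>\<^sup>+x. ennreal (dens c x) * indicator (chart_map c ` B) x \<partial>lborel)"

text \<open>The Jacobian factor in the transformation of the densities is the one of the change of
  variables. It is stated for Borel sets since the disjoint pieces of the manifold need not be
  open.\<close>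

lemma vol_in_trans:
  assumes c: "c \<in> A" and d: "d \<in> A" and B: "B \<in> sets borel" "B \<subseteq> chart_dom c" "B \<subseteq> chart_dom d"
  shows "vol_in c B = vol_in d B"
proof -
  let ?S = "chart_map c ` B" and ?T = "chart_map d ` B"
  have Bcd: "p \<in> chart_dom c" "p \<in> chart_dom d" if "p \<in> B" for p using B that by auto
  have eq: "dens c x = \<bar>det (matrix (coord_change c d (chart_inv c x)))\<bar> * dens d (trans c d x)" if "x \<in> ?S" for x
  proof -
    from that obtain p where p: "p \<in> B" "x = chart_map c p" by auto
    then have "p \<in> chart_dom c" "p \<in> chart_dom d" using B by auto
    then show ?thesis using dens_trans[OF c d] c by (simp add: p(2))
  qed
  have S: "?S \<in> sets borel" "?S \<subseteq> chart_img c" and T: "?T \<in> sets borel" "?T \<subseteq> chart_img d"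
    using borel_chart_img c d B by auto
  have mS: "(\<lambda>x. indicator ?S x * dens c x) \<in> borel_measurable borel"
    by (rule measurable_indicator_mult[OF S open_chart_img[OF c] dto_imp_continuous_on[OF dens_dto[OF c, of 0]]])
  have mT: "(\<lambda>x. indicator ?T x * dens d x) \<in> borel_measurable borel"
    by (rule measurable_indicator_mult[OF T open_chart_img[OF d] dto_imp_continuous_on[OF dens_dto[OF d, of 0]]])
  have eq': "indicator ?S x * dens c x = indicator ?S x * (\<bar>det (matrix (coord_change c d (chart_inv c x)))\<bar> * dens d (trans c d x))" for x
    using eq[of x] by (auto simp: indicator_def)
  have "(\<integral>\<^sup>+y. ennreal (indicator ?T y * dens d y) \<partial>lborel) =
      (\<integral>\<^sup>+x. ennreal (indicator ?S x * (\<bar>det (matrix (coord_change c d (chart_inv c x)))\<bar> * dens d (trans c d x))) \<partial>lborel)"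
  proof (rule nn_integral_change_of_variables[where h = "trans d c" and h' = "\<lambda>y. coord_change d c (chart_inv d y)"])
    show "(trans c d has_derivative coord_change c d (chart_inv c x)) (at x)" if "x \<in> ?S" for x
      using that B by (intro trans_has_derivative_at c d) (auto simp: overlap_def)
    show "(trans d c has_derivative coord_change d c (chart_inv d y)) (at y)" if "y \<in> ?T" for y
      using that B by (intro trans_has_derivative_at c d) (auto simp: overlap_def)
    show "trans c d x \<in> ?T \<and> trans d c (trans c d x) = x" if "x \<in> ?S" for x
      using that by (auto simp: Bcd c d)
    show "trans d c y \<in> ?S \<and> trans c d (trans d c y) = y" if "y \<in> ?T" for y
      using that by (auto simp: Bcd c d)
    show "coord_change d c (chart_inv d y) (coord_change c d (chart_inv c (trans d c y)) v) = v" if "y \<in> ?T" for y v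
      using that by (auto simp: Bcd c d coord_change_inverse[OF c d])
    show "(\<lambda>x. indicator ?S x * (\<bar>det (matrix (coord_change c d (chart_inv c x)))\<bar> * dens d (trans c d x))) \<in> borel_measurable borel"
      using mS unfolding eq' .
    show "0 \<le> dens d y" if "y \<in> ?T" for y using that T dens_pos[OF d, of y] by auto
  qed (rule mT)
  then show ?thesis unfolding vol_in_def ennreal_mult_indicator eq' by simp
qed

lemma vol_in_suminf:
  assumes c: "c \<in> A" and B: "\<And>i. B i \<in> sets borel" "\<And>i. B i \<subseteq> chart_dom c" "disjoint_family B"
  shows "(\<Sum>i. vol_in c (B i)) = vol_in c (\<Union>i. B i)"
proof -
  have inj: "inj_on (chart_map c) (chart_dom c)"
    using chart_inv_map[OF c] by (metis inj_on_inverseI)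
  have S: "chart_map c ` B i \<in> sets borel" "chart_map c ` B i \<subseteq> chart_img c" for i
    using borel_chart_img[OF c] B by (simp_all add: image_mono)
  have disj: "disjoint_family (\<lambda>i. chart_map c ` B i)"
    using B(2,3) inj unfolding disjoint_family_on_def
    by (metis image_empty inj_on_image_Int)
  have m: "(\<lambda>x. ennreal (dens c x) * indicator (chart_map c ` B i) x) \<in> borel_measurable lborel" for i
    unfolding ennreal_mult_indicator
    using measurable_indicator_mult[OF S open_chart_img[OF c] dto_imp_continuous_on[OF dens_dto[OF c, of 0]]] by simp
  have "(\<Sum>i. vol_in c (B i)) = (\<integral>\<^sup>+x. (\<Sum>i. ennreal (dens c x) * indicator (chart_map c ` B i) x) \<partial>lborel)"
    unfolding vol_in_def by (rule nn_integral_suminf[symmetric, OF m])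
  also have "\<dots> = vol_in c (\<Union>i. B i)"
    unfolding vol_in_def image_UN by (simp add: suminf_indicator[OF disj])
  finally show ?thesis .
qed

lemma vol_in_empty [simp]: "vol_in c {} = 0"
  by (simp add: vol_in_def)

text \<open>The manifold is cut into countably many disjoint Borel pieces, each inside one chart,
  and the volume of a set is the sum of the chart volumes of its pieces. Agreement of the chart
  volumes on overlaps makes this sum correct in every chart.\<close>

theorem is_vol_vol: "is_vol A g (vol A g)"
proof -
  obtain e :: "nat \<Rightarrow> ('m, 'n) chart" where e: "range e \<subseteq> A" "(\<Union>i. chart_dom (e i)) = UNIV"
    by (rule countable_subatlas)
  have eA: "e i \<in> A" for i using e(1) by auto
  define D where "D = disjointed (\<lambda>i. chart_dom (e i))"
  have D: "disjoint_family D" "(\<Union>i. D i) = UNIV" "D i \<subseteq> chart_dom (e i)" "D i \<in> sets borel" for i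
  proof -
    have "range (\<lambda>i. chart_dom (e i)) \<subseteq> sets borel" by (auto intro!: borel_open open_chart_dom eA)
    then show "D i \<in> sets borel" unfolding D_def using sets.range_disjointed_sets by blast
  qed (use e(2) in \<open>simp_all add: D_def disjoint_family_disjointed UN_disjointed_eq disjointed_subset[of "\<lambda>i. chart_dom (e i)"]\<close>)
  define m where "m B = (\<Sum>i. vol_in (e i) (B \<inter> D i))" for B
  have "countably_additive (sets borel) m"
    unfolding countably_additive_def
  proof (intro allI impI)
    fix B :: "nat \<Rightarrow> 'm set" assume B: "range B \<subseteq> sets borel" "disjoint_family B"
    have "(\<Sum>k. m (B k)) = (\<Sum>k. \<Sum>i. vol_in (e i) (B k \<inter> D i))" by (simp add: m_def)
    \<comment> \<open>The two sums are exchanged by reading the sum over \<open>i\<close> as an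
      integral for the counting measure.\<close>
    also have "\<dots> = (\<Sum>i. \<Sum>k. vol_in (e i) (B k \<inter> D i))"
      using nn_integral_suminf[of "\<lambda>i k. vol_in (e i) (B k \<inter> D i)" "count_space UNIV"]
      by (simp add: nn_integral_count_space_nat)
    also have "\<dots> = (\<Sum>i. vol_in (e i) (\<Union>k. B k \<inter> D i))"
      using B D(1,4) by (intro suminf_cong vol_in_suminf eA) (auto simp: disjoint_family_on_def dest: subsetD[OF D(3)])
    also have "\<dots> = m (\<Union>k. B k)" by (simp add: m_def)
    finally show "(\<Sum>k. m (B k)) = m (\<Union>k. B k)" .
  qed
  then have em: "emeasure (measure_of UNIV (sets borel) m) B = m B" if "B \<in> sets borel" for B
    using that sets.sigma_algebra_axioms[of "borel :: 'm measure"]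
    by (intro emeasure_measure_of_sigma) (auto simp: positive_def m_def)
  have ex: "is_vol A g (measure_of UNIV (sets borel) m)"
    unfolding is_vol_def
  proof (intro conjI ballI impI)
    show "sets (measure_of UNIV (sets borel) m) = sets borel"
      using sets.sigma_sets_eq[of "borel :: 'm measure"] by simp
    fix c B assume c: "c \<in> A" and B: "B \<in> sets borel" "B \<subseteq> chart_dom c"
    have "m B = (\<Sum>i. vol_in c (B \<inter> D i))"
      unfolding m_def using B D by (intro suminf_cong vol_in_trans eA c) auto
    also have "\<dots> = vol_in c (\<Union>i. B \<inter> D i)"
      using B D by (intro vol_in_suminf c) (auto simp: disjoint_family_on_def)
    also have "(\<Union>i. B \<inter> D i) = B" using D(2) by auto
    finally show "emeasure (measure_of UNIV (sets borel) m) B =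
        (\<integral>\<^sup>+x. ennreal (dens c x) * indicator (chart_map c ` B) x \<partial>lborel)"
      using em[OF B(1)] by (simp add: vol_in_def)
  qed
  \<comment> \<open>\<open>is_vol\<close> prescribes the measure only of sets inside a single chart.
    The pieces \<open>B \<inter> D i\<close> are such sets, and countable additivity extends the
    agreement to \<open>B\<close>.\<close>
  have uniq: "emeasure \<mu> B = m B" if \<mu>: "is_vol A g \<mu>" and B: "B \<in> sets borel" for \<mu> B
  proof -
    have "emeasure \<mu> (\<Union>i. B \<inter> D i) = (\<Sum>i. emeasure \<mu> (B \<inter> D i))"
      using \<mu> B D by (intro suminf_emeasure[symmetric]) (auto simp: is_vol_def disjoint_family_on_def)
    also have "(\<Union>i. B \<inter> D i) = B" using D(2) by auto
    also have "(\<Sum>i. emeasure \<mu> (B \<inter> D i)) = m B"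
      unfolding m_def
    proof (rule suminf_cong)
      fix i
      have "B \<inter> D i \<in> sets borel" "B \<inter> D i \<subseteq> chart_dom (e i)" using B D(3,4)[of i] by auto
      then show "emeasure \<mu> (B \<inter> D i) = vol_in (e i) (B \<inter> D i)"
        using \<mu> eA[of i] by (simp add: is_vol_def vol_in_def)
    qed
    finally show ?thesis .
  qed
  have "\<mu> = \<nu>" if "is_vol A g \<mu>" "is_vol A g \<nu>" for \<mu> \<nu>
    using that uniq by (intro measure_eqI) (auto simp: is_vol_def)
  then show ?thesis unfolding vol_def using ex by (intro theI'[of "is_vol A g"]) blast
qed

lemma sets_vol [simp, measurable_cong]: "sets (vol A g) = sets borel"
  using is_vol_vol by (simp add: is_vol_def)

lemma emeasure_vol:
  "c \<in> A \<Longrightarrow> B \<in> sets borel \<Longrightarrow> B \<subseteq> chart_dom c \<Longrightarrow> emeasure (vol A g) B = vol_in c B"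
  using is_vol_vol by (simp add: is_vol_def vol_in_def)

text \<open>The image under the inverse chart of Lebesgue measure with density \<open>dens c\<close>
  is \<open>vol A g\<close> restricted to the chart. Once this is checked on Borel sets, the
  integral is carried over.\<close>

lemma integral_vol_chart:
  assumes c: "c \<in> A" and f: "f \<in> borel_measurable borel" "\<And>p. p \<notin> chart_dom c \<Longrightarrow> f p = 0"
  shows "(\<integral>p. f p \<partial>vol A g) = (\<integral>x. indicator (chart_img c) x * (dens c x * f (chart_inv c x)) \<partial>lborel)"
proof -
  \<comment> \<open>The inverse chart has to be Borel on all of space. Its value off the image of
    the chart is arbitrary because the weight \<open>w\<close> vanishes there.\<close>
  define \<phi> where "\<phi> x = (if x \<in> chart_img c then chart_inv c x else undefined)" for x
  define w where "w x = indicator (chart_img c) x * dens c x" for x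
  define N where "N = density lborel (\<lambda>x. ennreal (w x))"
  have U: "chart_img c \<in> sets borel" "chart_dom c \<in> sets borel" using open_chart_img open_chart_dom c by auto
  have \<phi>: "\<phi> \<in> borel_measurable borel"
    unfolding \<phi>_def by (intro borel_measurable_continuous_on_if U continuous_on_chart_inv c continuous_on_const)
  have w: "w \<in> borel_measurable borel"
    unfolding w_def by (rule measurable_indicator_mult[OF U(1) _ open_chart_img[OF c] dto_imp_continuous_on[OF dens_dto[OF c, of 0]]]) simp
  have w0: "0 \<le> w x" for x using dens_pos[OF c, of x] by (auto simp: w_def indicator_def)
  have meas_eq: "distr N borel \<phi> = density (vol A g) (indicator (chart_dom c))"
  proof (rule measure_eqI)
    fix B assume "B \<in> sets (distr N borel \<phi>)"
    then have B: "B \<in> sets borel" by simp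
    have "emeasure (distr N borel \<phi>) B = (\<integral>\<^sup>+x. ennreal (w x) * indicator (\<phi> -` B) x \<partial>lborel)"
      using B \<phi> w measurable_sets[OF \<phi> B] by (simp add: N_def emeasure_distr emeasure_density)
    also have "\<dots> = vol_in c (B \<inter> chart_dom c)"
      unfolding vol_in_def
    proof (rule nn_integral_cong)
      fix x
      have "x \<in> chart_map c ` (B \<inter> chart_dom c) \<longleftrightarrow> x \<in> chart_img c \<and> \<phi> x \<in> B"
        using c by (auto simp: \<phi>_def)
      then show "ennreal (w x) * indicator (\<phi> -` B) x = ennreal (dens c x) * indicator (chart_map c ` (B \<inter> chart_dom c)) x"
        by (auto simp: w_def indicator_def)
    qed
    also have "\<dots> = emeasure (vol A g) (B \<inter> chart_dom c)"
      using B U by (intro emeasure_vol[symmetric] c) auto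
    also have "\<dots> = emeasure (density (vol A g) (indicator (chart_dom c))) B"
    proof -
      have "emeasure (density (vol A g) (indicator (chart_dom c))) B
          = (\<integral>\<^sup>+p. indicator (chart_dom c) p * indicator B p \<partial>vol A g)"
        using B U by (intro emeasure_density) auto
      also have "\<dots> = (\<integral>\<^sup>+p. indicator (B \<inter> chart_dom c) p \<partial>vol A g)"
        by (intro nn_integral_cong) (auto simp: indicator_def)
      finally show ?thesis using B U by simp
    qed
    finally show "emeasure (distr N borel \<phi>) B = emeasure (density (vol A g) (indicator (chart_dom c))) B" .
  qed simp
  have "(\<integral>p. f p \<partial>vol A g) = (\<integral>p. indicator (chart_dom c) p *\<^sub>R f p \<partial>vol A g)"
    using f(2) by (intro Bochner_Integration.integral_cong) (auto simp: indicator_def)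
  also have "\<dots> = (\<integral>p. f p \<partial>density (vol A g) (\<lambda>p. ennreal (indicator (chart_dom c) p)))"
    using f(1) U by (intro integral_density[symmetric]) auto
  also have "density (vol A g) (\<lambda>p. ennreal (indicator (chart_dom c) p)) = distr N borel \<phi>"
    unfolding meas_eq by (simp add: ennreal_indicator)
  also have "(\<integral>p. f p \<partial>distr N borel \<phi>) = (\<integral>x. f (\<phi> x) \<partial>N)"
    using f(1) \<phi> by (intro integral_distr) (auto simp: N_def)
  also have "\<dots> = (\<integral>x. w x *\<^sub>R f (\<phi> x) \<partial>lborel)"
    unfolding N_def using f(1) \<phi> w w0 by (intro integral_density) auto
  also have "\<dots> = (\<integral>x. indicator (chart_img c) x * (dens c x * f (chart_inv c x)) \<partial>lborel)"
    by (intro Bochner_Integration.integral_cong) (auto simp: w_def \<phi>_def indicator_def)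
  finally show ?thesis .
qed

end

section \<open>Bump functions\<close>

text \<open>The square makes the positive part continuously differentiable at 0. One derivative is
  all that a bump function must have here.\<close>

definition sq_plus :: "real \<Rightarrow> real" where
  "sq_plus t = (max 0 t)\<^sup>2"

lemma dto_sq_plus: "differentiable_times_on 1 UNIV sq_plus"
proof -
  have "(sq_plus has_derivative (\<lambda>v. 2 * max 0 t * v)) (at t)" for t
  proof (cases t "0 :: real" rule: linorder_cases)
    case less
    have "(sq_plus has_derivative (\<lambda>v. 0)) (at t)"
      by (rule has_derivative_transform_within_open[of "\<lambda>_. 0" _ _ _ "{..<0}"]) (use less in \<open>auto simp: sq_plus_def\<close>)
    then show ?thesis using less by simp
  next
    case greater
    have "(sq_plus has_derivative (\<lambda>v. 2 * t * v)) (at t)"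
      by (rule has_derivative_transform_within_open[of "\<lambda>t. t\<^sup>2" _ _ _ "{0<..}"])
        (use greater in \<open>auto simp: sq_plus_def intro!: derivative_eq_intros\<close>)
    then show ?thesis using greater by simp
  next
    case equal
    \<comment> \<open>At 0 the difference quotient of \<open>sq_plus\<close> is
      \<open>max 0 h\<close>.\<close>
    have "((\<lambda>h. max 0 h) \<longlongrightarrow> max 0 0) (at (0::real))" by (intro tendsto_intros)
    then have "((\<lambda>h. max 0 h) \<longlongrightarrow> 0) (at (0::real))" by simp
    then have "((\<lambda>h. sq_plus h / h) \<longlongrightarrow> 0) (at 0)"
      by (rule Lim_transform_eventually) (auto simp: eventually_at_filter sq_plus_def max_def power2_eq_square)
    then have "(sq_plus has_field_derivative 0) (at 0)"
      by (simp add: DERIV_def sq_plus_def)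
    moreover have "(\<lambda>v. 2 * max 0 t * v) = (*) 0" using equal by (simp add: fun_eq_iff)
    ultimately show ?thesis unfolding equal has_field_derivative_def by simp
  qed
  moreover have "continuous_on UNIV (\<lambda>t::real. 2 * max 0 t * v)" for v by (intro continuous_intros)
  ultimately have "differentiable_times_on (Suc 0) UNIV sq_plus"
    by (intro dto_SucI[where D = "\<lambda>t v. 2 * max 0 t * v"]) auto
  then show ?thesis by simp
qed

text \<open>Let \<open>q\<close> be \<open>|x - a|^2 / r^2\<close>. The inner square is
  \<open>(max 0 (q - 1))^2\<close>, which is 0 for \<open>q \<le> 1\<close> and at least 1 for
  \<open>q \<ge> 2\<close>. So the outer one is 1 on the ball of radius \<open>r\<close> and 0 from
  radius \<open>sqrt 2 * r\<close> on, in particular from \<open>2 * r\<close> on.\<close>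

definition plateau :: "'a::euclidean_space \<Rightarrow> real \<Rightarrow> 'a \<Rightarrow> real" where
  "plateau a r x = sq_plus (1 - sq_plus (1 - (2 - (x - a) \<bullet> (x - a) * inverse (r\<^sup>2))))"

lemma dto_plateau: "differentiable_times_on 1 UNIV (plateau a r)"
proof -
  have "differentiable_times_on 1 UNIV (\<lambda>x. (x - a) \<bullet> (x - a))"
    by (intro dto_bounded_bilinear[OF bounded_bilinear_inner] dto_diff dto_ident dto_const open_UNIV)
  then show ?thesis
    unfolding plateau_def[abs_def]
    by (intro dto_compose[OF open_UNIV dto_sq_plus] dto_diff dto_const dto_mult open_UNIV UNIV_I)
qed

lemma plateau_eq_1:
  assumes "0 < r" "dist a x \<le> r" shows "plateau a r x = 1"
proof -
  have "(x - a) \<bullet> (x - a) \<le> r\<^sup>2"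
    using assms by (simp add: dot_square_norm dist_norm norm_minus_commute power_mono)
  then have "(x - a) \<bullet> (x - a) * inverse (r\<^sup>2) \<le> 1" using assms(1) by (simp add: field_simps)
  then show ?thesis by (simp add: plateau_def sq_plus_def)
qed

lemma plateau_eq_0:
  assumes "0 < r" "2 * r \<le> dist a x" shows "plateau a r x = 0"
proof -
  have "(2 * r)\<^sup>2 \<le> (x - a) \<bullet> (x - a)"
    using power_mono[OF assms(2), of 2] assms(1) by (simp add: dot_square_norm dist_norm norm_minus_commute)
  then have "4 \<le> (x - a) \<bullet> (x - a) * inverse (r\<^sup>2)" using assms(1) by (simp add: field_simps power2_eq_square)
  then have "1 \<le> (max 0 ((x - a) \<bullet> (x - a) * inverse (r\<^sup>2) - 1))\<^sup>2"
    by (intro one_le_power) simp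
  then show ?thesis by (simp add: plateau_def sq_plus_def)
qed

context smooth_manifold
begin

lemma chart_cball:
  assumes "c \<in> A" "p \<in> chart_dom c"
  obtains r where "0 < r" "cball (chart_map c p) r \<subseteq> chart_img c"
  using open_chart_img[OF assms(1)] assms(2) open_contains_cball by (metis imageI)

lemma open_chart_preimage:
  assumes "c \<in> A" "open S" shows "open (chart_img c \<inter> chart_inv c -` S)"
  using continuous_on_chart_inv[OF assms(1)] open_chart_img[OF assms(1)] assms(2) by (rule continuous_open_preimage)

lemma dto_fun_continuous_on:
  assumes "dto_fun k f" shows "continuous_on UNIV f"
proof -
  have "continuous (at p) f" for p
  proof -
    note a = chart_at[of p]
    let ?a = "chart_at A p"
    have "continuous_on (chart_img ?a) (\<lambda>x. f (chart_inv ?a x))"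
      using assms a(1) dto_imp_continuous_on by (auto simp: dto_fun_def)
    then have "continuous_on (chart_dom ?a) (\<lambda>p. f (chart_inv ?a (chart_map ?a p)))"
      by (rule continuous_on_compose2[OF _ continuous_on_chart_map[OF a(1)]]) auto
    then have "continuous_on (chart_dom ?a) f" by (rule continuous_on_eq) (simp add: a(1))
    then show ?thesis using a open_chart_dom[OF a(1)] by (simp add: continuous_on_eq_continuous_at)
  qed
  then show ?thesis by (simp add: continuous_at_imp_continuous_on)
qed

text \<open>A plateau in a chart around \<open>p\<close>, extended by zero. The extension is
  differentiable because the chart domain and the complement of \<open>K\<close> are open and cover
  the manifold; \<open>K\<close> is closed, being compact in a Hausdorff space.\<close>

lemma bump_exists:
  obtains c K b N where "c \<in> A" "compact K" "K \<subseteq> chart_dom c" "dto_fun 1 b" "\<And>q. q \<notin> K \<Longrightarrow> b q = 0"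
    "open N" "p \<in> N" "\<And>q. q \<in> N \<Longrightarrow> b q = 1"
proof -
  define c where "c = chart_at A p"
  have c: "c \<in> A" "p \<in> chart_dom c" using chart_at by (simp_all add: c_def)
  obtain R where R: "0 < R" "cball (chart_map c p) R \<subseteq> chart_img c" by (rule chart_cball[OF c])
  define r where "r = R / 2"
  have r: "0 < r" "2 * r = R" using R by (auto simp: r_def)
  let ?\<psi> = "plateau (chart_map c p) r"
  define b where "b q = (if q \<in> chart_dom c then ?\<psi> (chart_map c q) else 0)" for q
  define K where "K = chart_inv c ` cball (chart_map c p) R"
  define N where "N = chart_dom c \<inter> chart_map c -` ball (chart_map c p) r"
  have K: "compact K"
    unfolding K_def by (intro compact_continuous_image continuous_on_subset[OF continuous_on_chart_inv[OF c(1)] R(2)]) simp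
  have Kc: "K \<subseteq> chart_dom c" using R(2) chart_inv_mem[OF c(1)] by (auto simp: K_def)
  have b0: "b q = 0" if "q \<notin> K" for q
  proof (cases "q \<in> chart_dom c")
    case True
    have "chart_map c q \<notin> cball (chart_map c p) R"
      using that chart_inv_map[OF c(1) True] by (metis K_def imageI)
    then show ?thesis using True r by (simp add: b_def plateau_eq_0)
  qed (simp add: b_def)
  have "differentiable_times_on 1 (chart_img d) (\<lambda>x. b (chart_inv d x))" if d: "d \<in> A" for d
  proof (rule dto_local)
    fix x assume x: "x \<in> chart_img d"
    show "\<exists>T. open T \<and> x \<in> T \<and> differentiable_times_on 1 T (\<lambda>x. b (chart_inv d x))"
    proof (cases "x \<in> overlap d c")
      case True
      note T = open_overlap[OF d c(1)]
      have "differentiable_times_on 1 (overlap d c) (\<lambda>y. ?\<psi> (trans d c y))"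
        by (intro dto_compose[OF T dto_plateau trans_smooth[OF d c(1)]] UNIV_I)
      moreover have "?\<psi> (trans d c y) = b (chart_inv d y)" if "y \<in> overlap d c" for y
        using that d by (auto simp: overlap_def b_def)
      ultimately have "differentiable_times_on 1 (overlap d c) (\<lambda>x. b (chart_inv d x))"
        using dto_cong[OF T, of "\<lambda>y. ?\<psi> (trans d c y)" "\<lambda>x. b (chart_inv d x)" 1] by blast
      then show ?thesis using T True by blast
    next
      case False
      \<comment> \<open>A point outside the domain of \<open>c\<close> is outside \<open>K\<close>,
        so \<open>b\<close> vanishes on a whole neighbourhood of it.\<close>
      let ?T = "chart_img d \<inter> chart_inv d -` (- K)"
      have T: "open ?T" using compact_imp_closed[OF K] by (intro open_chart_preimage d) (simp add: open_Compl)
      have "x \<in> ?T" using False x Kc by (auto simp: overlap_eq[OF d])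
      moreover have "differentiable_times_on 1 ?T (\<lambda>x. b (chart_inv d x))"
        using dto_cong[OF T, of "\<lambda>_. 0" "\<lambda>x. b (chart_inv d x)" 1] b0 dto_const by auto
      ultimately show ?thesis using T by blast
    qed
  qed
  then have "dto_fun 1 b" by (simp add: dto_fun_def)
  moreover have "open N"
    unfolding N_def using continuous_on_chart_map[OF c(1)] open_chart_dom[OF c(1)] open_ball by (rule continuous_open_preimage)
  moreover have "p \<in> N" using c r by (simp add: N_def)
  moreover have "b q = 1" if "q \<in> N" for q
    using that r by (auto simp: N_def b_def intro!: plateau_eq_1)
  ultimately show ?thesis using that c(1) K Kc b0 by metis
qed

end

section \<open>The divergence theorem\<close>

lemma lborel_integrable_compact_support:
  fixes f :: "'a::euclidean_space \<Rightarrow> real"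
  assumes "continuous_on UNIV f" "compact K" "\<And>x. x \<notin> K \<Longrightarrow> f x = 0"
  shows "integrable lborel f"
proof -
  have "integrable lborel (\<lambda>x. indicator K x *\<^sub>R f x)"
    by (intro borel_integrable_compact assms continuous_on_subset[OF assms(1)]) auto
  moreover have "(\<lambda>x. indicator K x *\<^sub>R f x) = f"
    using assms(3) by (auto simp: fun_eq_iff indicator_def)
  ultimately show ?thesis by simp
qed

context riemannian_manifold
begin

section \<open>Finiteness of the volume on compact sets, and integrability\<close>

lemma emeasure_vol_compact:
  assumes K: "compact K" shows "emeasure (vol A g) K < \<infinity>"
proof -
  have "\<exists>N. open N \<and> p \<in> N \<and> emeasure (vol A g) N < \<infinity>" for p
  proof -
    define c where "c = chart_at A p"
    have c: "c \<in> A" "p \<in> chart_dom c" using chart_at by (simp_all add: c_def)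
    obtain R where R: "0 < R" "cball (chart_map c p) R \<subseteq> chart_img c" by (rule chart_cball[OF c])
    let ?B = "ball (chart_map c p) R"
    define N where "N = chart_dom c \<inter> chart_map c -` ?B"
    have N: "open N"
      unfolding N_def using continuous_on_chart_map[OF c(1)] open_chart_dom[OF c(1)] open_ball by (rule continuous_open_preimage)
    have "continuous_on (cball (chart_map c p) R) (dens c)"
      using dto_imp_continuous_on[OF dens_dto[OF c(1), of 0]] R(2) by (rule continuous_on_subset)
    then have "bounded (dens c ` cball (chart_map c p) R)"
      by (intro compact_imp_bounded compact_continuous_image) auto
    then obtain M where "\<forall>x\<in>cball (chart_map c p) R. \<bar>dens c x\<bar> \<le> M"
      by (auto simp: bounded_iff)
    then have M: "dens c x \<le> M" if "x \<in> cball (chart_map c p) R" for x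
      using that abs_le_D1 by blast
    have "emeasure (vol A g) N = vol_in c N"
      using N by (intro emeasure_vol c) (auto simp: N_def)
    also have "\<dots> \<le> (\<integral>\<^sup>+x. ennreal M * indicator (cball (chart_map c p) R) x \<partial>lborel)"
      unfolding vol_in_def using M by (intro nn_integral_mono) (auto simp: N_def indicator_def ennreal_leI)
    also have "\<dots> = ennreal M * emeasure lborel (cball (chart_map c p) R)"
      by (simp add: nn_integral_cmult_indicator)
    also have "\<dots> < \<infinity>"
      using emeasure_lborel_cball_finite[of "chart_map c p" R] by (simp add: ennreal_mult_less_top)
    finally show ?thesis using N c R by (intro exI[of _ N]) (auto simp: N_def)
  qed
  then obtain N where N: "\<And>p. open (N p)" "\<And>p. p \<in> N p" "\<And>p. emeasure (vol A g) (N p) < \<infinity>" by metis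
  have cover: "K \<subseteq> (\<Union>p\<in>UNIV. N p)" using N(2) by blast
  obtain F where F: "finite F" "K \<subseteq> (\<Union>p\<in>F. N p)"
    by (rule compactE_image[OF K N(1) cover])
  have "emeasure (vol A g) K \<le> emeasure (vol A g) (\<Union>p\<in>F. N p)"
    using F N(1) by (intro emeasure_mono) auto
  also have "\<dots> \<le> (\<Sum>p\<in>F. emeasure (vol A g) (N p))"
    using F N(1) by (intro emeasure_subadditive_finite) auto
  also have "\<dots> < \<infinity>" using F(1) N(3) by (simp add: less_top)
  finally show ?thesis .
qed

lemma integrable_vol:
  fixes f :: "'m \<Rightarrow> real"
  assumes f: "continuous_on UNIV f" and K: "compact K" "\<And>p. p \<notin> K \<Longrightarrow> f p = 0"
  shows "integrable (vol A g) f"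
proof -
  have "bounded (f ` K)"
    using compact_continuous_image[OF continuous_on_subset[OF f] K(1)] by (auto intro: compact_imp_bounded)
  then obtain M where "\<And>p. p \<in> K \<Longrightarrow> \<bar>f p\<bar> \<le> M" by (auto simp: bounded_iff)
  then show ?thesis
    using K f compact_imp_closed[OF K(1)] emeasure_vol_compact[OF K(1)]
    by (intro integrableI_bounded_set[of K _ _ M])
      (auto simp: measurable_cong_sets[OF sets_vol refl] intro: borel_measurable_continuous_onI)
qed

lemma divergence_eq_0:
  assumes V: "dto_vfield 1 V" and S: "open S" "p \<in> S" "\<And>q. q \<in> S \<Longrightarrow> V q = 0"
  shows "divergence A g V p = 0"
proof -
  let ?a = "chart_at A p"
  note a = chart_at[of p]
  let ?T = "chart_img ?a \<inter> chart_inv ?a -` S"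
  have T: "open ?T" "chart_map ?a p \<in> ?T" using open_chart_preimage[OF a(1) S(1)] a S(2) by auto
  have 0: "vf_in A V ?a x = 0" if "x \<in> ?T" for x
    using that S(3) a(1) by (auto simp: vf_in_eq_0_iff)
  have "frechet_derivative (vf_in A V ?a) (at (chart_map ?a p)) = (\<lambda>h. 0)"
    using frechet_derivative_cong_open[OF T 0] by simp
  then show ?thesis
    unfolding divergence_eq_div_in[OF V a] div_in_eq[OF V a] 0[OF T(2)]
    using linear_0[OF has_derivative_linear[OF dens_has_derivative[OF a]]] by (simp add: tr_sum)
qed

text \<open>Multiplied by the density, the divergence becomes the Euclidean divergence of
  \<open>F\<close>, the density times the components of \<open>V\<close>. The compact support lets
  \<open>F\<close> be extended by zero to all of space, where each partial derivative has integral
  0.\<close>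

lemma integral_divergence_chart:
  assumes V: "dto_vfield 1 V" and c: "c \<in> A" and K: "compact K" "K \<subseteq> chart_dom c" "\<And>p. p \<notin> K \<Longrightarrow> V p = 0"
  shows "(\<integral>p. divergence A g V p \<partial>vol A g) = 0"
proof -
  define F where "F x = (if x \<in> chart_img c then dens c x *\<^sub>R vf_in A V c x else 0)" for x
  define \<phi> where "\<phi> i x = F x $ i" for i x
  let ?C = "chart_map c ` K"
  have C: "compact ?C" using K(1) continuous_on_subset[OF continuous_on_chart_map[OF c] K(2)]
    by (rule compact_continuous_image[rotated])
  have F0: "F x = 0" if "x \<notin> ?C" for x
  proof -
    have "V p = 0" if "p \<in> chart_dom c" "x = chart_map c p" for p using that \<open>x \<notin> ?C\<close> K(3) by auto
    then show ?thesis using c by (auto simp: F_def vf_in_eq_0_iff)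
  qed
  have oC: "open (- ?C)" using compact_imp_closed[OF C] by (simp add: open_Compl)
  have "differentiable_times_on 1 UNIV F"
  proof (rule dto_local)
    fix x
    show "\<exists>T. open T \<and> x \<in> T \<and> differentiable_times_on 1 T F"
    proof (cases "x \<in> chart_img c")
      case True
      have "differentiable_times_on 1 (chart_img c) (\<lambda>x. dens c x *\<^sub>R vf_in A V c x)"
        using V c by (intro dto_scaleR open_chart_img dens_dto) (auto simp: dto_vfield_def)
      then have "differentiable_times_on 1 (chart_img c) F"
        using dto_cong[OF open_chart_img[OF c], of F "\<lambda>x. dens c x *\<^sub>R vf_in A V c x"] by (simp add: F_def)
      then show ?thesis using True open_chart_img[OF c] by blast
    next
      case False
      then have "x \<in> - ?C" using K(2) by auto
      moreover have "differentiable_times_on 1 (- ?C) F"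
        using dto_cong[OF oC, of F "\<lambda>_. 0" 1] F0 dto_const by auto
      ultimately show ?thesis using oC by blast
    qed
  qed
  then have \<phi>: "differentiable_times_on 1 UNIV (\<phi> i)" for i
    unfolding \<phi>_def[abs_def] by (intro dto_vec_nth open_UNIV)
  let ?D = "\<lambda>i x. frechet_derivative (\<phi> i) (at x) (axis i 1)"
  have D0: "?D i x = 0" if "x \<notin> ?C" for i x
    using frechet_derivative_cong_open[OF oC, of x "\<phi> i" "\<lambda>_. 0"] that F0 by (simp add: \<phi>_def)
  have int: "integrable lborel (?D i)" for i
    using \<phi>[of i] by (intro lborel_integrable_compact_support[OF _ C D0]) simp_all
  have eq: "indicator (chart_img c) x * (dens c x * divergence A g V (chart_inv c x)) = (\<Sum>i\<in>UNIV. ?D i x)" for x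
  proof (cases "x \<in> chart_img c")
    case True
    then obtain p where p: "p \<in> chart_dom c" "x = chart_map c p" by auto
    let ?W = "\<lambda>x. dens c x *\<^sub>R vf_in A V c x"
    have W: "(?W has_derivative frechet_derivative ?W (at x)) (at x)"
      unfolding p(2) using has_derivative_scaleR[OF dens_has_derivative[OF c p(1)] vf_in_has_derivative[OF V c p(1)]]
      by (intro has_derivative_frechet) (auto simp: differentiable_def)
    have "?D i x = frechet_derivative ?W (at x) (axis i 1) $ i" for i
      using frechet_derivative_cong_open[OF open_chart_img[OF c] True, of "\<phi> i" "\<lambda>x. ?W x $ i"]
        frechet_derivative_eqI[OF bounded_linear.has_derivative[OF bounded_linear_vec_nth W]]
      by (simp add: \<phi>_def F_def)
    moreover have "divergence A g V (chart_inv c x) = div_in V c x"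
      using divergence_eq_div_in[OF V c p(1)] c p by simp
    ultimately show ?thesis using True dens_pos[OF c True] by (simp add: div_in_def tr_sum)
  next
    case False
    then have "x \<notin> ?C" using K(2) by auto
    then show ?thesis using False D0 by simp
  qed
  have "(\<integral>p. divergence A g V p \<partial>vol A g) =
      (\<integral>x. indicator (chart_img c) x * (dens c x * divergence A g V (chart_inv c x)) \<partial>lborel)"
  proof (rule integral_vol_chart[OF c])
    have "dto_fun 0 (divergence A g V)" using V by (intro dto_fun_divergence) simp
    then show "divergence A g V \<in> borel_measurable borel"
      by (intro borel_measurable_continuous_onI dto_fun_continuous_on)
    show "divergence A g V p = 0" if "p \<notin> chart_dom c" for p
      using that K compact_imp_closed[OF K(1)] by (intro divergence_eq_0[OF V, of "- K"]) (auto simp: open_Compl)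
  qed
  also have "\<dots> = (\<Sum>i\<in>UNIV. \<integral>x. ?D i x \<partial>lborel)"
    unfolding eq using int by (intro Bochner_Integration.integral_sum) simp
  also have "\<dots> = 0"
    using lborel_integral_derivative_eq_0[OF \<phi> C, of _ "axis _ 1"] F0 by (simp add: \<phi>_def)
  finally show ?thesis .
qed

text \<open>A normalised partition of unity is avoided. One bump \<open>b a\<close> at a time splits
  \<open>W\<close> into \<open>b a * W\<close>, supported in a chart, and a remainder that vanishes
  off the other neighbourhoods of the finite cover. The fixed compact set \<open>K\<close> keeps all
  the divergences integrable.\<close>

theorem integral_divergence:
  assumes V: "dto_vfield 1 V" and K: "compact K" "\<And>p. p \<notin> K \<Longrightarrow> V p = 0"
  shows "(\<integral>p. divergence A g V p \<partial>vol A g) = 0"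
proof -
  have "\<exists>N b c K. open N \<and> p \<in> N \<and> (\<forall>q\<in>N. b q = 1) \<and> dto_fun 1 b \<and> c \<in> A \<and> compact K \<and> K \<subseteq> chart_dom c \<and>
      (\<forall>q. q \<notin> K \<longrightarrow> b q = 0)" for p
    by (rule bump_exists[of p]) blast
  then obtain N b c C where N: "\<And>p. open (N p)" "\<And>p. p \<in> N p" "\<And>p q. q \<in> N p \<Longrightarrow> b p q = (1::real)"
    and b: "\<And>p. dto_fun 1 (b p)" "\<And>p. c p \<in> A" "\<And>p. compact (C p)" "\<And>p. C p \<subseteq> chart_dom (c p)"
      "\<And>p q. q \<notin> C p \<Longrightarrow> b p q = 0" by metis
  have cover: "K \<subseteq> (\<Union>p\<in>UNIV. N p)" using N(2) by blast
  obtain F where F: "finite F" "K \<subseteq> (\<Union>p\<in>F. N p)"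
    by (rule compactE_image[OF K(1) N(1) cover])
  have int: "integrable (vol A g) (divergence A g W)" if W: "dto_vfield 1 W" "\<And>p. p \<notin> K \<Longrightarrow> W p = 0" for W
  proof (rule integrable_vol[OF dto_fun_continuous_on K(1)])
    show "dto_fun 0 (divergence A g W)" using W(1) by (intro dto_fun_divergence) simp
    show "divergence A g W p = 0" if "p \<notin> K" for p
      using that W(2) compact_imp_closed[OF K(1)] by (intro divergence_eq_0[OF W(1), of "- K"]) (auto simp: open_Compl)
  qed
  have "(\<integral>p. divergence A g W p \<partial>vol A g) = 0"
    if "dto_vfield 1 W" "\<And>p. p \<notin> K \<Longrightarrow> W p = 0" "\<And>p. p \<notin> (\<Union>p\<in>F. N p) \<Longrightarrow> W p = 0" for W
    using F(1) that
  proof (induction F arbitrary: W rule: finite_induct)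
    case empty
    have "divergence A g W p = 0" for p
      by (rule divergence_eq_0[OF empty.prems(1) open_UNIV UNIV_I]) (rule empty.prems(3), simp)
    then show ?case by simp
  next
    case (insert a F)
    let ?U = "\<lambda>p. b a p *\<^sub>R W p" and ?W = "\<lambda>p. (1 - b a p) *\<^sub>R W p"
    have U: "dto_vfield 1 ?U" by (intro dto_vfield_scaleR b insert.prems(1))
    have eqW: "?W = (\<lambda>p. W p - ?U p)" by (simp add: scaleR_left_diff_distrib)
    have W: "dto_vfield 1 ?W" unfolding eqW by (intro dto_vfield_diff U insert.prems(1))
    have "(\<integral>p. divergence A g ?U p \<partial>vol A g) = 0"
      by (rule integral_divergence_chart[OF U b(2)[of a] b(3)[of a] b(4)]) (simp add: b(5))
    moreover have "(\<integral>p. divergence A g ?W p \<partial>vol A g) = 0"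
    proof (rule insert.IH[OF W])
      \<comment> \<open>On \<open>N a\<close> the factor \<open>1 - b a p\<close> is 0; off
        \<open>N a\<close> the point lies in none of the neighbourhoods, so \<open>W\<close> itself
        vanishes.\<close>
      show "?W p = 0" if "p \<notin> (\<Union>p\<in>F. N p)" for p
        using that insert.prems(3)[of p] N(3)[of p a] by (cases "p \<in> N a") auto
    qed (simp add: insert.prems(2))
    moreover have "divergence A g W p = divergence A g ?U p + divergence A g ?W p" for p
      using divergence_add[OF U W, of p] by (simp add: scaleR_left_diff_distrib)
    ultimately show ?case
      using int[OF U] int[OF W] insert.prems(2) by simp
  qed
  then show ?thesis using V K(2) F(2) by blast
qed

section \<open>The Lie algebra of the diffeomorphism group\<close>

lemma vfields_cI:
  assumes U: "U \<in> vfields_c A" and V: "V \<in> vfields_c A" and "\<And>k. dto_vfield k W"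
    and 0: "\<And>p. U p = 0 \<Longrightarrow> V p = 0 \<Longrightarrow> W p = 0"
  shows "W \<in> vfields_c A"
proof -
  have "compact (closure {p. U p \<noteq> 0} \<union> closure {p. V p \<noteq> 0})"
    using U V by (intro compact_Un) (auto simp: vfields_c_iff)
  moreover have "closure {p. W p \<noteq> 0} \<subseteq> closure {p. U p \<noteq> 0} \<union> closure {p. V p \<noteq> 0}"
    unfolding closure_Un[symmetric] using 0 by (intro closure_mono) auto
  ultimately have "compact (closure {p. W p \<noteq> 0})"
    by (metis closed_closure compact_Int_closed inf.absorb_iff2)
  then show ?thesis using assms(3) by (simp add: vfields_c_iff)
qed

lemma vfields_c_dto: "X \<in> vfields_c A \<Longrightarrow> dto_vfield k X"
  by (simp add: vfields_c_iff)

lemma vfields_c_support: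
  assumes "X \<in> vfields_c A"
  obtains K where "compact K" "\<And>p. p \<notin> K \<Longrightarrow> X p = 0"
proof (rule that)
  show "compact (closure {p. X p \<noteq> 0})" using assms by (simp add: vfields_c_iff)
  show "X p = 0" if "p \<notin> closure {p. X p \<noteq> 0}" for p
    using that closure_subset[of "{p. X p \<noteq> 0}"] by blast
qed

lemma vfields_c_diff: "X \<in> vfields_c A \<Longrightarrow> Y \<in> vfields_c A \<Longrightarrow> X - Y \<in> vfields_c A"
  unfolding fun_diff_def by (rule vfields_cI[of X Y]) (auto intro: dto_vfield_diff vfields_c_dto)

lemma vfields_c_lie_bracket:
  assumes X: "X \<in> vfields_c A" and Y: "Y \<in> vfields_c A" shows "lie_bracket A X Y \<in> vfields_c A"
proof (rule vfields_cI[OF X Y])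
  show "dto_vfield k (lie_bracket A X Y)" for k
    by (intro dto_vfield_lie_bracket vfields_c_dto X Y)
  show "lie_bracket A X Y p = 0" if "X p = 0" "Y p = 0" for p
    using that has_derivative_linear[OF vf_in_has_derivative[OF vfields_c_dto[OF X] chart_at[of p]]]
      has_derivative_linear[OF vf_in_has_derivative[OF vfields_c_dto[OF Y] chart_at[of p]]]
    by (simp add: lie_bracket_def vf_jacobian_def coord_at_def linear_0)
qed

definition ad_adj :: "('m, 'n) vfield \<Rightarrow> ('m, 'n) vfield \<Rightarrow> ('m, 'n) vfield" where
  "ad_adj X Y = (\<lambda>p. beta A g X p (Y p) + lie_bracket A X Y p)"

lemma vfields_c_ad_adj:
  assumes X: "X \<in> vfields_c A" and Y: "Y \<in> vfields_c A" shows "ad_adj X Y \<in> vfields_c A"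
  unfolding ad_adj_def
proof (rule vfields_cI[OF Y vfields_c_lie_bracket[OF X Y]])
  show "dto_vfield k (\<lambda>p. beta A g X p (Y p) + lie_bracket A X Y p)" for k
    by (intro dto_vfield_add dto_vfield_beta vfields_c_dto vfields_c_lie_bracket X Y)
qed (simp add: linear_0[OF linear_beta[OF vfields_c_dto[OF X]]])

lemma vfields_c_ad: "X \<in> vfields_c A \<Longrightarrow> Y \<in> vfields_c A \<Longrightarrow> ad_diff A X Y \<in> vfields_c A"
  \<comment> \<open>With \<open>B\<close> the bracket, \<open>- B\<close> is written as
    \<open>(B - B) - B\<close>, so that closure under differences suffices.\<close>
  using vfields_c_diff[OF vfields_c_diff[OF vfields_c_lie_bracket vfields_c_lie_bracket] vfields_c_lie_bracket, of X Y X Y X Y]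
  by (simp add: ad_diff_def)

lemma ad_diff_skew: "ad_diff A Y X = - ad_diff A X Y"
  by (simp add: ad_diff_def lie_bracket_def fun_eq_iff)

lemma integrable_metric:
  assumes X: "X \<in> vfields_c A" and Y: "Y \<in> vfields_c A"
  shows "integrable (vol A g) (\<lambda>p. g p (X p) (Y p))"
proof -
  obtain K where K: "compact K" "\<And>p. p \<notin> K \<Longrightarrow> X p = 0" using vfields_c_support[OF X] by blast
  show ?thesis
    by (rule integrable_vol[OF dto_fun_continuous_on[OF dto_fun_metric[of 0]] K(1)])
      (simp_all add: X Y vfields_c_dto K(2) metric_simps)
qed

abbreviation G :: "('m, 'n) vfield \<Rightarrow> ('m, 'n) vfield \<Rightarrow> real" where
  "G \<equiv> H0_metric A g"

lemma G_sym: "G X Y = G Y X"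
  unfolding H0_metric_def by (simp add: metric_sym)

lemma G_diff:
  "X \<in> vfields_c A \<Longrightarrow> Y \<in> vfields_c A \<Longrightarrow> Z \<in> vfields_c A \<Longrightarrow> G (X - Y) Z = G X Z - G Y Z"
  by (simp add: H0_metric_def metric_simps integrable_metric)

text \<open>Integrating the divergence of \<open>g(Y,Z) X\<close>.\<close>

lemma G_ad_adj:
  assumes X: "X \<in> vfields_c A" and Y: "Y \<in> vfields_c A" and Z: "Z \<in> vfields_c A"
  shows "G (ad_adj X Y) Z = G Y (ad_diff A X Z)"
proof -
  obtain K where K: "compact K" "\<And>p. p \<notin> K \<Longrightarrow> X p = 0" using vfields_c_support[OF X] by blast
  have "dto_vfield 1 (\<lambda>p. g p (Y p) (Z p) *\<^sub>R X p)"
    by (intro dto_vfield_scaleR dto_fun_metric vfields_c_dto X Y Z)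
  from integral_divergence[OF this K(1)] K(2)
  have "(\<integral>p. g p (ad_adj X Y p) (Z p) + g p (Y p) (lie_bracket A X Z p) \<partial>vol A g) = 0"
    by (simp add: divergence_metric_scaleR[OF vfields_c_dto[OF X] vfields_c_dto[OF Y] vfields_c_dto[OF Z]] ad_adj_def)
  then have "G (ad_adj X Y) Z + G Y (lie_bracket A X Z) = 0"
    using integrable_metric[OF vfields_c_ad_adj[OF X Y] Z] integrable_metric[OF Y vfields_c_lie_bracket[OF X Z]]
    by (simp add: H0_metric_def)
  then show ?thesis by (simp add: ad_diff_def H0_metric_def metric_simps)
qed

text \<open>Koszul's formula provides the covariant derivative.\<close>

lemma levi_civita_exists: "\<exists>D. levi_civita (vfields_c A) (ad_diff A) G D"
proof -
  let ?L = "vfields_c A" and ?ad = "ad_diff A"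
  \<comment> \<open>Twice the covariant derivative, \<open>ad_adj X Y + ad_adj Y X - ad X Y\<close>,
    arranged in differences to suit \<open>G_diff\<close> and \<open>vfields_c_diff\<close>.\<close>
  define S where "S X Y = ad_adj X Y - (?ad X Y - ad_adj Y X)" for X Y
  define D where "D X Y = (\<lambda>p. (1/2) *\<^sub>R S X Y p)" for X Y
  have S: "S X Y \<in> ?L" if "X \<in> ?L" "Y \<in> ?L" for X Y
    unfolding S_def by (intro vfields_c_diff vfields_c_ad vfields_c_ad_adj that)
  have D: "D X Y \<in> ?L" if "X \<in> ?L" "Y \<in> ?L" for X Y
    unfolding D_def by (rule vfields_cI[OF S S, OF that that])
      (use S[OF that] in \<open>auto intro: dto_vfield_scaleR dto_fun_const vfields_c_dto\<close>)
  have GD: "2 * G (D X Y) Z = G Y (?ad X Z) - (G (?ad X Y) Z - G X (?ad Y Z))"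
    if "X \<in> ?L" "Y \<in> ?L" "Z \<in> ?L" for X Y Z
  proof -
    have "2 * G (D X Y) Z = G (S X Y) Z" by (simp add: H0_metric_def D_def metric_simps)
    then show ?thesis
      unfolding S_def using that by (simp add: G_diff vfields_c_diff vfields_c_ad vfields_c_ad_adj G_ad_adj)
  qed
  \<comment> \<open>The adjoint terms of \<open>S\<close> are symmetric in \<open>X\<close> and
    \<open>Y\<close>, so only the bracket terms survive.\<close>
  have "D X Y - D Y X = - ?ad X Y" for X Y
  proof
    fix p
    have "D X Y p - D Y X p = (1/2) *\<^sub>R (?ad Y X p - ?ad X Y p)"
      by (simp add: D_def S_def flip: scaleR_diff_right)
    also have "\<dots> = - ?ad X Y p"
      by (simp add: ad_diff_skew[of X Y])
    finally show "(D X Y - D Y X) p = (- ?ad X Y) p" by simp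
  qed
  \<comment> \<open>The right side of \<open>GD\<close> is antisymmetric in \<open>Y\<close> and
    \<open>Z\<close>.\<close>
  moreover have "G (D X Y) Z + G Y (D X Z) = 0" if "X \<in> ?L" "Y \<in> ?L" "Z \<in> ?L" for X Y Z
  proof -
    have "G X (?ad Z Y) = - G X (?ad Y Z)"
      unfolding ad_diff_skew[of Z Y] by (simp add: H0_metric_def metric_simps)
    then show ?thesis
      using GD[OF that] GD[OF that(1,3,2)] G_sym[of Y "D X Z"] G_sym[of Y "?ad X Z"] G_sym[of Z "?ad X Y"] by simp
  qed
  ultimately show ?thesis using D unfolding levi_civita_def by blast
qed

lemma H0_curvature_formula:
  assumes X: "X \<in> vfields_c A" and Y: "Y \<in> vfields_c A"
  shows "4 * G (H0_curvature A g X Y X) Y =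
    (\<integral>p. - (metric_norm g p
              (beta A g X p (Y p) - beta A g Y p (X p) + lie_bracket A X Y p))\<^sup>2
          - 4 * g p (endo_commutator (beta A g X p) (beta A g Y p) (X p)) (Y p)
       \<partial>vol A g)"
proof -
  let ?L = "vfields_c A" and ?ad = "ad_diff A"
  \<comment> \<open>Which covariant derivative is chosen does not matter, since Arnold's formula
    holds for every one with the Levi-Civita property.\<close>
  define D where "D = (SOME D. levi_civita ?L ?ad G D)"
  have "levi_civita ?L ?ad G D" unfolding D_def using levi_civita_exists by (rule someI_ex)
  then have "4 * G (curvature ?ad D X Y X) Y =
    3 * G (?ad X Y) (?ad X Y) - 2 * G (ad_adj Y X) (?ad X Y) - 2 * G (ad_adj X Y) (?ad Y X)
    + 4 * G (ad_adj X X) (ad_adj Y Y) - G (ad_adj X Y + ad_adj Y X) (ad_adj X Y + ad_adj Y X)"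
    by (rule arnold_formula)
      (rule vfields_c_diff G_diff vfields_c_ad vfields_c_ad_adj G_ad_adj ad_diff_skew G_sym X Y; assumption)+
  also have "\<dots> = (\<integral>p. 3 * g p (?ad X Y p) (?ad X Y p) - 2 * g p (ad_adj Y X p) (?ad X Y p) - 2 * g p (ad_adj X Y p) (?ad Y X p)
    + 4 * g p (ad_adj X X p) (ad_adj Y Y p) - g p ((ad_adj X Y + ad_adj Y X) p) ((ad_adj X Y + ad_adj Y X) p) \<partial>vol A g)"
  proof -
    \<comment> \<open>The sum \<open>U + V\<close> is written as \<open>U - ((X - X) - V)\<close>,
      again to use closure under differences.\<close>
    have "ad_adj X Y + ad_adj Y X \<in> ?L"
      using vfields_c_diff[OF vfields_c_ad_adj[OF X Y] vfields_c_diff[OF vfields_c_diff[OF X X] vfields_c_ad_adj[OF Y X]]] by simp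
    note L = X Y this vfields_c_ad[OF X Y] vfields_c_ad[OF Y X] vfields_c_ad_adj[OF X Y] vfields_c_ad_adj[OF Y X]
      vfields_c_ad_adj[OF X X] vfields_c_ad_adj[OF Y Y]
    \<comment> \<open>\<open>plus_fun_apply\<close> is switched off so that the sum of the two
      adjoints is treated as a single field, whose integrability is then known.\<close>
    show ?thesis
      unfolding H0_metric_def using L
      by (simp add: integrable_metric del: plus_fun_apply)
  qed
  also have "\<dots> = (\<integral>p. - (metric_norm g p
              (beta A g X p (Y p) - beta A g Y p (X p) + lie_bracket A X Y p))\<^sup>2
          - 4 * g p (endo_commutator (beta A g X p) (beta A g Y p) (X p)) (Y p) \<partial>vol A g)"
  \<comment> \<open>Write \<open>a\<close> for \<beta>(X)Y and \<open>b\<close> for \<beta>(Y)X.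
    Then \<open>ad X Y = - B\<close>, \<open>ad_adj X Y = a + B\<close> and
    \<open>ad_adj Y X = b - B\<close>, so the sum of the adjoints is \<open>a + b\<close>. Now
    \<open>|a + b|^2 = |a - b|^2 + 4 g(a,b)\<close>. The part with \<open>a - b\<close> and
    \<open>B\<close> completes to \<open>- |a - b + B|^2\<close>. By symmetry of the endomorphisms,
    \<open>- 4 g(a,b)\<close> and the term from \<open>ad_adj X X\<close> and
    \<open>ad_adj Y Y\<close> form the commutator term.\<close>
  proof (rule Bochner_Integration.integral_cong[OF refl])
    fix p
    define B where "B = lie_bracket A X Y p"
    have br: "lie_bracket A Y X p = - B" "lie_bracket A X X p = 0" "lie_bracket A Y Y p = 0"
      by (simp_all add: B_def lie_bracket_def)
    have norm: "(metric_norm g p u)\<^sup>2 = g p u u" for u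
      using metric_pos[of u p] by (cases "u = 0") (auto simp: metric_norm_def metric_simps)
    have comm: "g p (endo_commutator (beta A g X p) (beta A g Y p) (X p)) (Y p) =
        g p (beta A g Y p (X p)) (beta A g X p (Y p)) - g p (beta A g X p (X p)) (beta A g Y p (Y p))"
      by (simp add: endo_commutator_def metric_simps beta_sym[OF vfields_c_dto[OF X]] beta_sym[OF vfields_c_dto[OF Y]])
    show "3 * g p (?ad X Y p) (?ad X Y p) - 2 * g p (ad_adj Y X p) (?ad X Y p) - 2 * g p (ad_adj X Y p) (?ad Y X p)
        + 4 * g p (ad_adj X X p) (ad_adj Y Y p) - g p ((ad_adj X Y + ad_adj Y X) p) ((ad_adj X Y + ad_adj Y X) p)
      = - (metric_norm g p (beta A g X p (Y p) - beta A g Y p (X p) + lie_bracket A X Y p))\<^sup>2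
          - 4 * g p (endo_commutator (beta A g X p) (beta A g Y p) (X p)) (Y p)"
      unfolding norm comm ad_diff_def ad_adj_def plus_fun_apply uminus_apply br B_def[symmetric]
      using metric_sym[of p B "beta A g X p (Y p)"] metric_sym[of p B "beta A g Y p (X p)"]
        metric_sym[of p "beta A g X p (Y p)" "beta A g Y p (X p)"]
      by (simp add: metric_simps)
  qed
  finally show ?thesis by (simp add: H0_curvature_def D_def)
qed

end

theorem mainTheorem8:
  fixes A :: "('m::{t2_space, second_countable_topology}, 'n::finite) atlas"
    and g :: "('m, 'n) metric"
    and X Y :: "('m, 'n) vfield"
  assumes "smooth_atlas A"
    and "connected (UNIV :: 'm set)"
    and "riemannian_metric A g"
    and "X \<in> vfields_c A"
    and "Y \<in> vfields_c A"
  shows "4 * H0_metric A g (H0_curvature A g X Y X) Y =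
    (\<integral>p. - (metric_norm g p
              (beta A g X p (Y p) - beta A g Y p (X p) + lie_bracket A X Y p))\<^sup>2
          - 4 * g p (endo_commutator (beta A g X p) (beta A g Y p) (X p)) (Y p)
       \<partial>vol A g)"
proof -
  interpret riemannian_manifold A g
    using assms(1,3) by unfold_locales
  show ?thesis by (rule H0_curvature_formula[OF assms(4,5)])
qed

end
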